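(* Let $\mathfrak{h}=\mathbb{R}^2$ be the abelian Lie algebra with basis $\{a_1,a_2\}$, complex structure $J_ha_1=a_2$ and positive-definite metric $h=a^1\otimes a^1+a^2\otimes a^2$. Every non-trivial pseudo-Kähler extension of a $4$-dimensional pseudo-Kähler Lie algebra by $(\mathfrak{h},h,J_h)$ is AW-related to one of the following pseudo-Kähler extensions $\mathfrak{g}\rtimes_\varphi\mathbb{R}^2$ (matrices are relative to the basis $e_1,\dots,e_4$ of $\mathfrak{g}$): (i) $\mathfrak{g}=\mathbb{R}^4$ abelian with $g=e^1\otimes e^1-e^2\otimes e^2+e^3\otimes e^3-e^4\otimes e^4$, $Je_1=e_3$, $Je_2=e_4$, and either $$\varphi(a_1)=a\begin{pmatrix}1&2&-1&0\\ 0&1&0&1\\ 1&0&-1&0\\ 0&-1&2&-1\end{pmatrix},\quad \varphi(a_2)=a\begin{pmatrix}0&1&2&1\\ 1&0&-1&0\\ 0&1&0&1\\ -1&2&1&0\end{pmatrix},\quad a>0,$$ or $$\varphi(a_1)=\begin{pmatrix}a&-a+c&-b&b\\ a+c&-a&-b&b\\ b&-b&-a&a+c\\ b&-b&-a+c&a\end{pmatrix},\quad \varphi(a_2)=\begin{pmatrix}0&0&a-c&-a\\ 0&0&a&-a-c\\ a+c&-a&0&0\\ a&-a+c&0&0\end{pmatrix},$$ where $a>0$ and either $b=0=c$ or $b,c\in\mathbb{R}$ with $c\neq0$; (ii) $\mathfrak{g}=\mathfrak{rh}_3$, with only nonzero bracket $[e_1,e_2]=e_3$, with $Je_1=e_2$,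 $Je_3=e_4$, $g=e^1\odot e^3+e^2\odot e^4$, and $$\varphi(a_1)=\begin{pmatrix}0&0&0&0\\ 0&0&0&0\\ a&0&0&0\\ 0&-a&0&0\end{pmatrix},\quad \varphi(a_2)=\begin{pmatrix}0&0&0&0\\ 0&0&0&0\\ 0&a&0&0\\ a&0&0&0\end{pmatrix},\quad a>0;$$ (iii) $\mathfrak{g}=\mathfrak{r}'_2$, with nonzero brackets $[e_1,e_3]=e_3$, $[e_1,e_4]=e_4$, $[e_2,e_3]=e_4$, $[e_2,e_4]=-e_3$, with $$J=\begin{pmatrix}0&1&0&0\\ -1&0&0&0\\ 0&0&0&-1\\ 0&0&1&0\end{pmatrix},\quad g=\begin{pmatrix}a_{12}&0&-a_{14}&a_{13}\\ 0&a_{12}&a_{13}&a_{14}\\ -a_{14}&a_{13}&0&0\\ a_{13}&a_{14}&0&0\end{pmatrix},$$ where $a_{12},a_{13},a_{14}\in\mathbb{R}$ and $a_{13}^2+a_{14}^2\neq0$, and $$\varphi(a_1)=\begin{pmatrix}0&0&0&0\\ 0&0&0&0\\ a&0&0&0\\ 0&a&0&0\end{pmatrix},\quad \varphi(a_2)=\begin{pmatrix}0&0&0&0\\ 0&0&0&0\\ 0&-a&0&0\\ a&0&0&0\end{pmatrix},\quad a>0.$$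
   Context: A pseudo-Kähler Lie algebra is a triple $(\mathfrak{g},g,J)$ where $\mathfrak{g}$ is a real finite-dimensional Lie algebra, $g$ a non-degenerate symmetric bilinear form of arbitrary signature, $J:\mathfrak{g}\to\mathfrak{g}$ linear with $J^2=-\mathrm{id}$, $g(J\cdot,J\cdot)=g$, and $J$ parallel for the Levi-Civita connection of $g$ (equivalently, $J$ integrable and $\omega=g(J\cdot,\cdot)$ closed). For a linear map $f:\mathfrak{g}\to\mathfrak{g}$, $f^*$ is the $g$-adjoint and $f^s=\frac12(f+f^* )$, $f^a=\frac12(f-f^* )$. Given pseudo-Kähler Lie algebras $(\mathfrak{g},g,J_g)$, $(\mathfrak{h},h,J_h)$ and a Lie algebra homomorphism $\varphi:\mathfrak{h}\to\mathrm{Der}(\mathfrak{g})$ such that $J_g\circ\varphi(A)^s=\varphi(J_hA)^s$ and $J_g\circ\varphi(A)^a=\varphi(A)^a\circ J_g$ for all $A\in\mathfrak{h}$, the semidirect product $\mathfrak{g}\rtimes_\varphi\mathfrak{h}$ (bracket $[X+A,Y+B]=[X,Y]+\varphi(A)Y-\varphi(B)X+[A,B]$) with metric $\tilde g=g\oplus h$ and complex structure $\tilde J=J_g\oplus J_h$ is pseudo-Kähler and is called a pseudo-Kähler extension of $(\mathfrak{g},g,J_g)$ by $(\mathfrak{h},h,J_h)$. Two pseudo-Kähler extensions $\mathfrak{g}\rtimes_\varphi\mathfrak{h}$ and $\mathfrak{g}'\rtimes_{\varphi'}\mathfrak{h}'$ are AW-related if there are Lie algebra isomorphisms $f_g:\mathfrak{g}\to\mathfrak{g}'$,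 $f_h:\mathfrak{h}\to\mathfrak{h}'$ with $f_g^*g'=g$, $f_g\circ J_g=J'_g\circ f_g$, $f_h^*h'=h$, $f_h\circ J_h=J'_h\circ f_h$, such that for all $A\in\mathfrak{h}$, $A'\in\mathfrak{h}'$ one has $\big(f_g\varphi(A)f_g^{-1}-\varphi'(f_h(A))\big)^s=0$ (symmetric part with respect to $g'$) and $[f_g\varphi(A)f_g^{-1},\varphi'(A')]=0$. A pseudo-Kähler extension is trivial if it is AW-related to one with $\varphi=0$ (a direct product). Notation: $\{e^i\}$ is the basis dual to $\{e_i\}$, $\{a^i\}$ the basis dual to $\{a_i\}$; $e^i\odot e^j=e^i\otimes e^j+e^j\otimes e^i$. Matrices of endomorphisms act on column vectors of coordinates. *)

theory Defs
  imports "HOL-Analysis.Analysis"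
begin

section \<open>Pseudo-Kaehler Lie algebras\<close>

text \<open>
  The underlying real vector space is a type. The signature of the metric is arbitrary, so the
  class is \<^class>\<open>real_vector\<close>, with finite dimension as an explicit condition, rather than
  \<^class>\<open>euclidean_space\<close>.
\<close>

record 'v pk_structure =
  bracket :: "'v \<Rightarrow> 'v \<Rightarrow> 'v"
  metric :: "'v \<Rightarrow> 'v \<Rightarrow> real"
  cplx :: "'v \<Rightarrow> 'v"

definition lie_bracket :: "('v::real_vector \<Rightarrow> 'v \<Rightarrow> 'v) \<Rightarrow> bool" where
  "lie_bracket br \<longleftrightarrow>
     bilinear br \<and> (\<forall>x. br x x = 0) \<and>
     (\<forall>x y z. br x (br y z) + br y (br z x) + br z (br x y) = 0)"

definition pseudo_riemannian :: "('v::real_vector \<Rightarrow> 'v \<Rightarrow> real) \<Rightarrow> bool" where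
  "pseudo_riemannian g \<longleftrightarrow>
     bilinear g \<and> (\<forall>x y. g x y = g y x) \<and> (\<forall>x. (\<forall>y. g x y = 0) \<longrightarrow> x = 0)"

text \<open>
  The Levi-Civita connection of a left-invariant metric, restricted to left-invariant fields:
  the unique bilinear torsion-free product that is compatible with the metric.
\<close>

definition levi_civita ::
  "('v::real_vector, 'm) pk_structure_scheme \<Rightarrow> ('v \<Rightarrow> 'v \<Rightarrow> 'v) \<Rightarrow> bool" where
  "levi_civita L D \<longleftrightarrow>
     bilinear D \<and>
     (\<forall>x y. D x y - D y x = bracket L x y) \<and>
     (\<forall>x y z. metric L (D x y) z + metric L y (D x z) = 0)"

definition pseudo_kaehler :: "'v::real_vector pk_structure \<Rightarrow> bool" where
  "pseudo_kaehler L \<longleftrightarrow>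
     (\<exists>B. finite B \<and> span B = (UNIV :: 'v set)) \<and>
     lie_bracket (bracket L) \<and>
     pseudo_riemannian (metric L) \<and>
     linear (cplx L) \<and>
     (\<forall>x. cplx L (cplx L x) = - x) \<and>
     (\<forall>x y. metric L (cplx L x) (cplx L y) = metric L x y) \<and>
     (\<exists>D. levi_civita L D \<and> (\<forall>x y. D x (cplx L y) = cplx L (D x y)))"

lemma levi_civita_unique:
  assumes g: "pseudo_riemannian (metric L)"
    and D: "levi_civita L D" and D': "levi_civita L D'"
  shows "D = D'"
proof (intro ext)
  fix x y
  let ?g = "metric L"
  define S where "S u v = D u v - D' u v" for u v
  have bil: "bilinear ?g" and sym: "\<And>u v. ?g u v = ?g v u"
    using g by (auto simp: pseudo_riemannian_def)
  have S_sym: "S u v = S v u" for u v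
  proof -
    have "D u v - D v u = D' u v - D' v u"
      using D D' by (simp add: levi_civita_def)
    then show ?thesis by (simp add: S_def algebra_simps)
  qed
  have S_skew: "?g (S u v) w = - ?g (S u w) v" for u v w
  proof -
    have "?g (D u v) w + ?g v (D u w) = 0" "?g (D' u v) w + ?g v (D' u w) = 0"
      using D D' by (auto simp: levi_civita_def)
    then show ?thesis
      using sym[of v "D u w"] sym[of v "D' u w"]
      by (simp add: S_def bilinear_lsub[OF bil])
  qed
  have "?g (S x y) w = 0" for w
    using S_skew[of x y w] S_skew[of w x y] S_skew[of y w x] S_sym[of x y] S_sym[of x w] S_sym[of w y]
    by simp
  then have "S x y = 0"
    using g by (auto simp: pseudo_riemannian_def)
  then show "D x y = D' x y" by (simp add: S_def)
qed

lemma pseudo_riemannian_representation: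
  fixes g :: "'v::real_vector \<Rightarrow> 'v \<Rightarrow> real"
  assumes fin: "\<exists>B. finite B \<and> span B = (UNIV :: 'v set)"
    and g: "pseudo_riemannian g" and F: "linear F"
  shows "\<exists>!v. \<forall>y. g v y = F y"
proof -
  obtain B0 where B0: "finite B0" "span B0 = (UNIV :: 'v set)" using fin by auto
  obtain B where B: "B \<subseteq> B0" "independent B" "B0 \<subseteq> span B"
    using maximal_independent_subset[of B0] by metis
  have finB: "finite B" using B(1) B0(1) by (rule finite_subset)
  have spanB: "span B = (UNIV :: 'v set)"
    using B(3) B0(2) span_mono[of B0 "span B"] unfolding span_span by blast
  interpret V: finite_dimensional_vector_space "scaleR :: real \<Rightarrow> 'v \<Rightarrow> 'v" B
    using finB B(2) spanB
    by unfold_locales (auto simp: algebra_simps dependent_raw_def span_raw_def)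
  have bil: "bilinear g" using g by (simp add: pseudo_riemannian_def)
  have lin: "linear (g v)" for v using bil by (simp add: bilinear_def)
  have eqI: "(\<forall>y. G y = H y)" if "linear G" "linear H" "\<forall>b\<in>B. G b = H b" for G H :: "'v \<Rightarrow> real"
    using linear_eq_on[OF that(1,2)] that(3) spanB by (metis UNIV_I)
  have nd: "v = w" if "\<forall>y. g v y = g w y" for v w
  proof -
    have "\<forall>y. g (v - w) y = 0" using that by (simp add: bilinear_lsub[OF bil])
    then have "v - w = 0" using g unfolding pseudo_riemannian_def by blast
    then show ?thesis by simp
  qed
  define T where "T v = (\<Sum>b\<in>B. g v b *\<^sub>R b)" for v
  have T_lin: "linear T"
    by (rule linearI)
      (auto simp: T_def bilinear_ladd[OF bil] bilinear_lmul[OF bil] scaleR_add_left sum.distrib scaleR_sum_right)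
  have coeff: "\<forall>b\<in>B. c b = d b" if "(\<Sum>b\<in>B. c b *\<^sub>R b) = (\<Sum>b\<in>B. d b *\<^sub>R b)" for c d
  proof -
    have "(\<Sum>b\<in>B. (c b - d b) *\<^sub>R b) = 0"
      using that by (simp add: scaleR_diff_left sum_subtractf)
    then show ?thesis
      using independentD[OF B(2) finB subset_refl, of "\<lambda>b. c b - d b"] by auto
  qed
  have "inj T"
  proof (rule injI)
    fix v w assume "T v = T w"
    then have "\<forall>b\<in>B. g v b = g w b" unfolding T_def by (rule coeff)
    then show "v = w" using eqI[OF lin lin] nd by blast
  qed
  have "surj T"
    using V.linear_inj_imp_surj[of T] T_lin \<open>inj T\<close>
    by (simp add: linear_def)
  then obtain v where "T v = (\<Sum>b\<in>B. F b *\<^sub>R b)" by (metis surjD)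
  then have "\<forall>b\<in>B. g v b = F b" unfolding T_def by (rule coeff)
  then have "\<forall>y. g v y = F y" using eqI[OF lin F] by blast
  then show ?thesis using nd by metis
qed


section \<open>Symmetric and antisymmetric parts of endomorphisms\<close>

definition g_adjoint :: "('v \<Rightarrow> 'v \<Rightarrow> real) \<Rightarrow> ('v \<Rightarrow> 'v) \<Rightarrow> 'v \<Rightarrow> 'v" where
  "g_adjoint g f = (THE f'. \<forall>x y. g (f x) y = g x (f' y))"

definition sym_part :: "('v::real_vector \<Rightarrow> 'v \<Rightarrow> real) \<Rightarrow> ('v \<Rightarrow> 'v) \<Rightarrow> 'v \<Rightarrow> 'v" where
  "sym_part g f x = (1 / 2) *\<^sub>R (f x + g_adjoint g f x)"

definition antisym_part :: "('v::real_vector \<Rightarrow> 'v \<Rightarrow> real) \<Rightarrow> ('v \<Rightarrow> 'v) \<Rightarrow> 'v \<Rightarrow> 'v" where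
  "antisym_part g f x = (1 / 2) *\<^sub>R (f x - g_adjoint g f x)"

lemma g_adjoint:
  fixes g :: "'v::real_vector \<Rightarrow> 'v \<Rightarrow> real"
  assumes fin: "\<exists>B. finite B \<and> span B = (UNIV :: 'v set)"
    and g: "pseudo_riemannian g" and f: "linear f"
  shows "g (f x) y = g x (g_adjoint g f y)"
proof -
  have bil: "bilinear g" and sym: "\<And>u v. g u v = g v u"
    using g by (auto simp: pseudo_riemannian_def)
  have "linear (\<lambda>x. g (f x) y)" for y
    by (rule linearI)
      (simp_all add: linear_add[OF f] linear_scale[OF f] bilinear_ladd[OF bil] bilinear_lmul[OF bil])
  then have ex: "\<exists>!v. \<forall>x. g v x = g (f x) y" for y
    using pseudo_riemannian_representation[OF fin g] by blast
  then obtain f' where f': "\<And>y. \<forall>x. g (f' y) x = g (f x) y" by metis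
  have "\<exists>!f'. \<forall>x y. g (f x) y = g x (f' y)"
  proof (rule ex1I[of _ f'])
    show "\<forall>x y. g (f x) y = g x (f' y)" using f' sym by metis
    fix k assume "\<forall>x y. g (f x) y = g x (k y)"
    then show "k = f'" using ex f' sym by (intro ext) metis
  qed
  from theI'[OF this] show ?thesis unfolding g_adjoint_def by blast
qed


section \<open>Pseudo-Kaehler extensions\<close>

definition derivation :: "('v::real_vector \<Rightarrow> 'v \<Rightarrow> 'v) \<Rightarrow> ('v \<Rightarrow> 'v) \<Rightarrow> bool" where
  "derivation br f \<longleftrightarrow> linear f \<and> (\<forall>x y. f (br x y) = br (f x) y + br x (f y))"

definition endo_commutator :: "('v::real_vector \<Rightarrow> 'v) \<Rightarrow> ('v \<Rightarrow> 'v) \<Rightarrow> 'v \<Rightarrow> 'v" where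
  "endo_commutator f k x = f (k x) - k (f x)"

definition lie_action ::
  "('g::real_vector \<Rightarrow> 'g \<Rightarrow> 'g) \<Rightarrow> ('h::real_vector \<Rightarrow> 'h \<Rightarrow> 'h) \<Rightarrow> ('h \<Rightarrow> 'g \<Rightarrow> 'g) \<Rightarrow> bool" where
  "lie_action brg brh \<phi> \<longleftrightarrow>
     (\<forall>A. derivation brg (\<phi> A)) \<and>
     (\<forall>x. linear (\<lambda>A. \<phi> A x)) \<and>
     (\<forall>A B. \<phi> (brh A B) = endo_commutator (\<phi> A) (\<phi> B))"

text \<open>
  An extension is represented by its data \<open>(G, H, \<phi>)\<close>, which AW-relatedness refers to; the
  resulting pseudo-Kaehler Lie algebra is \<open>semidirect G H \<phi>\<close> below.
\<close>

definition pk_extension ::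
  "'g::real_vector pk_structure \<Rightarrow> 'h::real_vector pk_structure \<Rightarrow> ('h \<Rightarrow> 'g \<Rightarrow> 'g) \<Rightarrow> bool" where
  "pk_extension G H \<phi> \<longleftrightarrow>
     pseudo_kaehler G \<and> pseudo_kaehler H \<and>
     lie_action (bracket G) (bracket H) \<phi> \<and>
     (\<forall>A. cplx G \<circ> sym_part (metric G) (\<phi> A) = sym_part (metric G) (\<phi> (cplx H A))) \<and>
     (\<forall>A. cplx G \<circ> antisym_part (metric G) (\<phi> A) = antisym_part (metric G) (\<phi> A) \<circ> cplx G)"

definition semidirect ::
  "'g::real_vector pk_structure \<Rightarrow> 'h::real_vector pk_structure \<Rightarrow> ('h \<Rightarrow> 'g \<Rightarrow> 'g)
     \<Rightarrow> ('g \<times> 'h) pk_structure" where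
  "semidirect G H \<phi> =
     \<lparr>bracket = (\<lambda>(X, A) (Y, B). (bracket G X Y + \<phi> A Y - \<phi> B X, bracket H A B)),
      metric = (\<lambda>(X, A) (Y, B). metric G X Y + metric H A B),
      cplx = (\<lambda>(X, A). (cplx G X, cplx H A))\<rparr>"

text \<open>
  The Levi-Civita connection of \<open>semidirect G H \<phi>\<close> is
  \<open>(X, A), (Y, B) \<mapsto> (D X Y - \<phi>(B)\<^sup>s X + \<phi>(A)\<^sup>a Y, P X Y + D' A B)\<close>, where \<open>P X Y\<close> represents the
  functional \<open>C \<mapsto> g (\<phi>(C)\<^sup>s X) Y\<close>.
\<close>

theorem pseudo_kaehler_semidirect:
  fixes G :: "'g::real_vector pk_structure" and H :: "'h::real_vector pk_structure"
  assumes "pk_extension G H \<phi>"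
  shows "pseudo_kaehler (semidirect G H \<phi>)"
proof -
  let ?g = "metric G" and ?h = "metric H" and ?J = "cplx G" and ?K = "cplx H"
  let ?s = "\<lambda>A. sym_part ?g (\<phi> A)" and ?a = "\<lambda>A. antisym_part ?g (\<phi> A)"
  have G: "pseudo_kaehler G" and H: "pseudo_kaehler H"
    and act: "lie_action (bracket G) (bracket H) \<phi>"
    and s_cplx: "\<And>A x. ?J (?s A x) = ?s (?K A) x"
    and a_cplx: "\<And>A x. ?J (?a A x) = ?a A (?J x)"
    using assms by (auto simp: pk_extension_def fun_eq_iff)
  have finG: "\<exists>B. finite B \<and> span B = (UNIV :: 'g set)"
    and finH: "\<exists>B. finite B \<and> span B = (UNIV :: 'h set)"
    and gR: "pseudo_riemannian ?g" and hR: "pseudo_riemannian ?h"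
    and lieG: "lie_bracket (bracket G)" and lieH: "lie_bracket (bracket H)"
    and linJ: "linear ?J" and linK: "linear ?K"
    and JJ: "\<And>x. ?J (?J x) = - x" and KK: "\<And>x. ?K (?K x) = - x"
    and gJ: "\<And>x y. ?g (?J x) (?J y) = ?g x y" and hK: "\<And>x y. ?h (?K x) (?K y) = ?h x y"
    using G H by (auto simp: pseudo_kaehler_def)
  obtain D where D: "levi_civita G D" and D_J: "\<And>x y. D x (?J y) = ?J (D x y)"
    using G by (auto simp: pseudo_kaehler_def)
  obtain E where E: "levi_civita H E" and E_K: "\<And>x y. E x (?K y) = ?K (E x y)"
    using H by (auto simp: pseudo_kaehler_def)
  have gb: "bilinear ?g" and gsym: "\<And>u v. ?g u v = ?g v u"
    and gnd: "\<And>x. \<forall>y. ?g x y = 0 \<Longrightarrow> x = 0"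
    using gR by (auto simp: pseudo_riemannian_def)
  have hb: "bilinear ?h" and hsym: "\<And>u v. ?h u v = ?h v u"
    and hnd: "\<And>x. \<forall>y. ?h x y = 0 \<Longrightarrow> x = 0"
    using hR by (auto simp: pseudo_riemannian_def)
  have bG: "bilinear (bracket G)" and bH: "bilinear (bracket H)"
    using lieG lieH by (auto simp: lie_bracket_def)
  have Db: "bilinear D" and Eb: "bilinear E" using D E by (auto simp: levi_civita_def)
  have \<phi>_lin: "linear (\<phi> A)" and \<phi>_lin2: "linear (\<lambda>A. \<phi> A x)" for A x
    using act by (auto simp: lie_action_def derivation_def)
  note gbs = bilinear_ladd[OF gb] bilinear_radd[OF gb] bilinear_lmul[OF gb] bilinear_rmul[OF gb]
    bilinear_lsub[OF gb] bilinear_rsub[OF gb] bilinear_lneg[OF gb] bilinear_rneg[OF gb]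
  note hbs = bilinear_ladd[OF hb] bilinear_radd[OF hb] bilinear_lmul[OF hb] bilinear_rmul[OF hb]
    bilinear_lsub[OF hb] bilinear_rsub[OF hb] bilinear_lneg[OF hb] bilinear_rneg[OF hb]
  have g_eqI: "x = y" if "\<And>z. ?g x z = ?g y z" for x y
    using gnd[of "x - y"] that by (simp add: gbs)
  have h_eqI: "x = y" if "\<And>z. ?h x z = ?h y z" for x y
    using hnd[of "x - y"] that by (simp add: hbs)
  have adj: "?g (\<phi> A x) y = ?g x (g_adjoint ?g (\<phi> A) y)" for A x y
    by (rule g_adjoint[OF finG gR \<phi>_lin])
  have s_form: "?g (?s A x) y = (?g (\<phi> A x) y + ?g (\<phi> A y) x) / 2" for A x y
    using adj[of A y x] gsym[of y "g_adjoint ?g (\<phi> A) x"] by (simp add: sym_part_def gbs)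
  have a_form: "?g (?a A x) y = (?g (\<phi> A x) y - ?g (\<phi> A y) x) / 2" for A x y
    using adj[of A y x] gsym[of y "g_adjoint ?g (\<phi> A) x"] by (simp add: antisym_part_def gbs)
  have s_plus_a: "?s A x + ?a A x = \<phi> A x" for A x
    by (rule g_eqI) (simp add: gbs s_form a_form field_simps)
  have \<phi>s: "\<phi> A (x + y) = \<phi> A x + \<phi> A y" "\<phi> A (c *\<^sub>R x) = c *\<^sub>R \<phi> A x"
    "\<phi> (A + B) x = \<phi> A x + \<phi> B x" "\<phi> (c *\<^sub>R A) x = c *\<^sub>R \<phi> A x" for A B x y c
    using \<phi>_lin[of A] \<phi>_lin2[of x] by (auto simp: linear_iff)
  have s_lin: "?s A (x + y) = ?s A x + ?s A y" "?s A (c *\<^sub>R x) = c *\<^sub>R ?s A x"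
    "?s (A + B) x = ?s A x + ?s B x" "?s (c *\<^sub>R A) x = c *\<^sub>R ?s A x" for A B x y c
    by (rule g_eqI, simp add: gbs s_form \<phi>s field_simps)+
  have a_lin: "?a A (x + y) = ?a A x + ?a A y" "?a A (c *\<^sub>R x) = c *\<^sub>R ?a A x"
    "?a (A + B) x = ?a A x + ?a B x" "?a (c *\<^sub>R A) x = c *\<^sub>R ?a A x" for A B x y c
    by (rule g_eqI, simp add: gbs a_form \<phi>s field_simps)+
  have "\<exists>!v. \<forall>A. ?h v A = ?g (?s A x) y" for x y
    by (rule pseudo_riemannian_representation[OF finH hR], rule linearI)
      (simp_all add: s_lin gbs)
  then obtain P where P: "\<And>x y A. ?h (P x y) A = ?g (?s A x) y" by metis
  have P_lin: "P (x + x') y = P x y + P x' y" "P (c *\<^sub>R x) y = c *\<^sub>R P x y"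
    "P x (y + y') = P x y + P x y'" "P x (c *\<^sub>R y) = c *\<^sub>R P x y" for x x' y y' c
    by (rule h_eqI, simp add: hbs P s_lin gbs)+
  have P_sym: "P x y = P y x" for x y
    by (rule h_eqI) (simp add: P s_form)
  have K_skew: "?h (?K x) y = - ?h x (?K y)" for x y
    using hK[of x "?K y"] by (simp add: KK hbs)
  have J_skew: "?g (?J x) y = - ?g x (?J y)" for x y
    using gJ[of x "?J y"] by (simp add: JJ gbs)
  have P_cplx: "P x (?J y) = ?K (P x y)" for x y
    by (rule h_eqI) (simp add: K_skew P s_cplx[symmetric] J_skew)
  have s_anti: "?s A (?J x) = - ?J (?s A x)" for A x
  proof (rule g_eqI)
    fix z
    have ss: "?g (?s A u) v = ?g (?s A v) u" for A u v by (simp add: s_form)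
    have "?g (?s A (?J x)) z = ?g (?s A z) (?J x)" by (rule ss)
    also have "\<dots> = - ?g (?s (?K A) z) x" using J_skew[of "?s A z" x] by (simp add: s_cplx)
    also have "\<dots> = - ?g (?s (?K A) x) z" by (simp add: ss)
    finally show "?g (?s A (?J x)) z = ?g (- ?J (?s A x)) z" by (simp add: s_cplx gbs)
  qed
  define C where "C = (\<lambda>(X, A) (Y, B). (D X Y - ?s B X + ?a A Y, P X Y + E A B))"
  have C: "C (X, A) (Y, B) = (D X Y - ?s B X + ?a A Y, P X Y + E A B)" for X A Y B
    by (simp add: C_def)
  note Ds = bilinear_ladd[OF Db] bilinear_radd[OF Db] bilinear_lmul[OF Db] bilinear_rmul[OF Db]
  note Es = bilinear_ladd[OF Eb] bilinear_radd[OF Eb] bilinear_lmul[OF Eb] bilinear_rmul[OF Eb]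
  note bGs = bilinear_ladd[OF bG] bilinear_radd[OF bG] bilinear_lmul[OF bG] bilinear_rmul[OF bG]
    bilinear_lsub[OF bG] bilinear_rsub[OF bG]
  note bHs = bilinear_ladd[OF bH] bilinear_radd[OF bH] bilinear_lmul[OF bH] bilinear_rmul[OF bH]
  have Cb: "bilinear C"
    unfolding bilinear_def
    by (auto intro!: linearI simp: C Ds Es s_lin a_lin P_lin algebra_simps)
  let ?L = "semidirect G H \<phi>"
  have L: "bracket ?L (X, A) (Y, B) = (bracket G X Y + \<phi> A Y - \<phi> B X, bracket H A B)"
    "metric ?L (X, A) (Y, B) = ?g X Y + ?h A B"
    "cplx ?L (X, A) = (?J X, ?K A)" for X A Y B
    by (simp_all add: semidirect_def)
  have LC: "levi_civita ?L C"
    unfolding levi_civita_def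
  proof (intro conjI Cb, safe)
    fix X A Y B
    have 1: "D X Y - D Y X = bracket G X Y" and 2: "E A B - E B A = bracket H A B"
      using D E by (auto simp: levi_civita_def)
    show "C (X, A) (Y, B) - C (Y, B) (X, A) = bracket ?L (X, A) (Y, B)"
      using 1 2 P_sym[of X Y] by (simp add: C L s_plus_a[symmetric] algebra_simps)
  next
    fix X A Y B Z C'
    have 1: "?g (D X Y) Z + ?g Y (D X Z) = 0" and 2: "?h (E A B) C' + ?h B (E A C') = 0"
      using D E by (auto simp: levi_civita_def)
    have 3: "?h B (P X Z) = ?g (?s B X) Z" using hsym[of B] P by simp
    have 4: "?g Y (?s C' X) = ?g (?s C' X) Y" by (rule gsym)
    have 5: "?g (?a A Y) Z + ?g Y (?a A Z) = 0"
      by (simp add: gsym[of Y "?a A Z"] a_form field_simps)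
    show "metric ?L (C (X, A) (Y, B)) (Z, C') + metric ?L (Y, B) (C (X, A) (Z, C')) = 0"
      using 1 2 3 4 5 by (simp add: C L gbs hbs P)
  qed
  have Js: "?J (x + y) = ?J x + ?J y" "?J (x - y) = ?J x - ?J y" for x y
    using linJ by (auto simp: linear_add linear_diff)
  have Ks: "?K (x + y) = ?K x + ?K y" for x y
    using linK by (auto simp: linear_add)
  have par: "C u (cplx ?L v) = cplx ?L (C u v)" for u v
    by (cases u; cases v) (simp add: C L Js Ks D_J E_K a_cplx P_cplx s_cplx)
  obtain B1 B2 where "finite B1" "span B1 = (UNIV :: 'g set)" "finite B2" "span B2 = (UNIV :: 'h set)"
    using finG finH by auto
  then have fin: "finite (B1 \<times> {0} \<union> {0} \<times> B2)"
    "span (B1 \<times> {0} \<union> {0} \<times> B2) = (UNIV :: ('g \<times> 'h) set)"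
    by (simp_all add: span_Times_sing1 span_Times_sing2 span_Un set_eq_iff)
  have lie: "lie_bracket (bracket ?L)"
    unfolding lie_bracket_def
  proof (intro conjI)
    have "bilinear (bracket ?L)"
      unfolding bilinear_def
      by (auto intro!: linearI simp: L bGs bHs \<phi>s algebra_simps)
    then show "bilinear (bracket ?L)" .
    show "\<forall>x. bracket ?L x x = 0"
      using lieG lieH by (auto simp: L lie_bracket_def zero_prod_def)
    have der: "\<phi> A (bracket G x y) = bracket G (\<phi> A x) y + bracket G x (\<phi> A y)" for A x y
      using act by (auto simp: lie_action_def derivation_def)
    have com: "\<phi> (bracket H A B) x = \<phi> A (\<phi> B x) - \<phi> B (\<phi> A x)" for A B x
      using act by (auto simp: lie_action_def endo_commutator_def)
    have skew: "bracket G x y = - bracket G y x" for x y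
    proof -
      have "bracket G (x + y) (x + y) = 0" "bracket G x x = 0" "bracket G y y = 0"
        using lieG by (auto simp: lie_bracket_def)
      then show ?thesis by (simp add: bGs eq_neg_iff_add_eq_0 add.commute)
    qed
    have \<phi>_diff: "\<phi> A (x - y) = \<phi> A x - \<phi> A y" for A x y
      using \<phi>_lin[of A] by (rule linear_diff)
    show "\<forall>x y z. bracket ?L x (bracket ?L y z) + bracket ?L y (bracket ?L z x)
        + bracket ?L z (bracket ?L x y) = 0"
    proof (intro allI)
      fix x y z :: "'g \<times> 'h"
      obtain X A Y B Z C where xyz: "x = (X, A)" "y = (Y, B)" "z = (Z, C)"
        by (metis surj_pair)
      have 1: "bracket G X (bracket G Y Z) + bracket G Y (bracket G Z X) + bracket G Z (bracket G X Y) = 0"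
        using lieG by (auto simp: lie_bracket_def)
      have 2: "bracket H A (bracket H B C) + bracket H B (bracket H C A) + bracket H C (bracket H A B) = 0"
        using lieH by (auto simp: lie_bracket_def)
      have skews: "bracket G (\<phi> A Y) Z = - bracket G Z (\<phi> A Y)" "bracket G (\<phi> B Z) X = - bracket G X (\<phi> B Z)"
        "bracket G (\<phi> C X) Y = - bracket G Y (\<phi> C X)"
        by (rule skew)+
      show "bracket ?L x (bracket ?L y z) + bracket ?L y (bracket ?L z x)
        + bracket ?L z (bracket ?L x y) = 0"
        using 1 2 by (simp add: xyz L bGs \<phi>s \<phi>_diff der com skews zero_prod_def algebra_simps)
    qed
  qed
  have "pseudo_riemannian (metric ?L)"
    unfolding pseudo_riemannian_def
  proof (intro conjI)
    show "bilinear (metric ?L)"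
      unfolding bilinear_def by (auto intro!: linearI simp: L gbs hbs algebra_simps)
    show "\<forall>x y. metric ?L x y = metric ?L y x"
      using gsym hsym by (auto simp: L)
    show "\<forall>x. (\<forall>y. metric ?L x y = 0) \<longrightarrow> x = 0"
    proof (intro allI impI)
      fix x assume x: "\<forall>y. metric ?L x y = 0"
      obtain X A where xX: "x = (X, A)" by (cases x)
      have "?g X Y + ?h A 0 = 0" "?g X 0 + ?h A B = 0" for Y B
        using x[rule_format, of "(Y, 0)"] x[rule_format, of "(0, B)"] by (simp_all add: xX L)
      then have "\<forall>Y. ?g X Y = 0" "\<forall>B. ?h A B = 0"
        using bilinear_rzero[OF gb] bilinear_rzero[OF hb] by auto
      then show "x = 0" using gnd hnd by (simp add: xX zero_prod_def)
    qed
  qed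
  moreover have "linear (cplx ?L)"
    using linJ linK by (auto intro!: linearI simp: L linear_add linear_scale)
  ultimately show ?thesis
    unfolding pseudo_kaehler_def using fin lie LC par
    by (auto simp: L JJ KK gJ hK)
qed


section \<open>AW-relatedness\<close>

definition pk_isomorphism ::
  "'v::real_vector pk_structure \<Rightarrow> 'w::real_vector pk_structure \<Rightarrow> ('v \<Rightarrow> 'w) \<Rightarrow> bool" where
  "pk_isomorphism L L' f \<longleftrightarrow>
     linear f \<and> bij f \<and>
     (\<forall>x y. f (bracket L x y) = bracket L' (f x) (f y)) \<and>
     (\<forall>x y. metric L' (f x) (f y) = metric L x y) \<and>
     (\<forall>x. f (cplx L x) = cplx L' (f x))"

definition aw_related ::
  "'g::real_vector pk_structure \<Rightarrow> 'h::real_vector pk_structure \<Rightarrow> ('h \<Rightarrow> 'g \<Rightarrow> 'g) \<Rightarrow>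
   'k::real_vector pk_structure \<Rightarrow> 'l::real_vector pk_structure \<Rightarrow> ('l \<Rightarrow> 'k \<Rightarrow> 'k) \<Rightarrow> bool" where
  "aw_related G H \<phi> G' H' \<phi>' \<longleftrightarrow>
     pk_extension G H \<phi> \<and> pk_extension G' H' \<phi>' \<and>
     (\<exists>fg fh. pk_isomorphism G G' fg \<and> pk_isomorphism H H' fh \<and>
        (\<forall>A. sym_part (metric G') (\<lambda>x. (fg \<circ> \<phi> A \<circ> inv fg) x - \<phi>' (fh A) x) = (\<lambda>x. 0)) \<and>
        (\<forall>A A'. endo_commutator (fg \<circ> \<phi> A \<circ> inv fg) (\<phi>' A') = (\<lambda>x. 0)))"

text \<open>
  HOL cannot quantify existentially over types; since \<open>G'\<close> and \<open>H'\<close> are isomorphic to \<open>G\<close> and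
  \<open>H\<close> when the extensions are AW-related, it is no loss to take them on the same vector spaces.
\<close>

definition trivial_extension ::
  "'g::real_vector pk_structure \<Rightarrow> 'h::real_vector pk_structure \<Rightarrow> ('h \<Rightarrow> 'g \<Rightarrow> 'g) \<Rightarrow> bool" where
  "trivial_extension G H \<phi> \<longleftrightarrow>
     (\<exists>(G' :: 'g pk_structure) (H' :: 'h pk_structure). aw_related G H \<phi> G' H' (\<lambda>A x. 0))"


section \<open>The models\<close>

lemma vector_4 [simp]:
  "(vector [x, y, z, w] :: 'a::zero^4) $ 1 = x"
  "(vector [x, y, z, w] :: 'a::zero^4) $ 2 = y"
  "(vector [x, y, z, w] :: 'a::zero^4) $ 3 = z"
  "(vector [x, y, z, w] :: 'a::zero^4) $ 4 = w"
  unfolding vector_def by simp_all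

definition flat_plane :: "(real^2) pk_structure" where
  "flat_plane =
     \<lparr>bracket = (\<lambda>A B. 0),
      metric = (\<lambda>A B. A$1 * B$1 + A$2 * B$2),
      cplx = (\<lambda>A. vector [- A$2, A$1])\<rparr>"

definition plane_action :: "real^4^4 \<Rightarrow> real^4^4 \<Rightarrow> real^2 \<Rightarrow> real^4 \<Rightarrow> real^4" where
  "plane_action M1 M2 A x = (A$1 *\<^sub>R M1 + A$2 *\<^sub>R M2) *v x"

definition wedge :: "4 \<Rightarrow> 4 \<Rightarrow> real^4 \<Rightarrow> real^4 \<Rightarrow> real" where
  "wedge i j x y = x$i * y$j - x$j * y$i"

definition sym_prod :: "4 \<Rightarrow> 4 \<Rightarrow> real^4 \<Rightarrow> real^4 \<Rightarrow> real" where
  "sym_prod i j x y = x$i * y$j + x$j * y$i"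

definition abelian4 :: "(real^4) pk_structure" where
  "abelian4 =
     \<lparr>bracket = (\<lambda>x y. 0),
      metric = (\<lambda>x y. x$1 * y$1 - x$2 * y$2 + x$3 * y$3 - x$4 * y$4),
      cplx = (\<lambda>x. vector [- x$3, - x$4, x$1, x$2])\<rparr>"

definition abelian4_action1 :: "real \<Rightarrow> real^2 \<Rightarrow> real^4 \<Rightarrow> real^4" where
  "abelian4_action1 a = plane_action
     (a *\<^sub>R vector [vector [1,  2, -1,  0],
                   vector [0,  1,  0,  1],
                   vector [1,  0, -1,  0],
                   vector [0, -1,  2, -1]])
     (a *\<^sub>R vector [vector [ 0, 1,  2, 1],
                   vector [ 1, 0, -1, 0],
                   vector [ 0, 1,  0, 1],
                   vector [-1, 2,  1, 0]])"

definition abelian4_action2 :: "real \<Rightarrow> real \<Rightarrow> real \<Rightarrow> real^2 \<Rightarrow> real^4 \<Rightarrow> real^4" where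
  "abelian4_action2 a b c = plane_action
     (vector [vector [a,     - a + c, - b,     b],
              vector [a + c, - a,     - b,     b],
              vector [b,     - b,     - a,     a + c],
              vector [b,     - b,     - a + c, a]])
     (vector [vector [0,     0,       a - c, - a],
              vector [0,     0,       a,     - a - c],
              vector [a + c, - a,     0,     0],
              vector [a,     - a + c, 0,     0]])"

definition rh3 :: "(real^4) pk_structure" where
  "rh3 =
     \<lparr>bracket = (\<lambda>x y. vector [0, 0, wedge 1 2 x y, 0]),
      metric = (\<lambda>x y. sym_prod 1 3 x y + sym_prod 2 4 x y),
      cplx = (\<lambda>x. vector [- x$2, x$1, - x$4, x$3])\<rparr>"

definition rh3_action :: "real \<Rightarrow> real^2 \<Rightarrow> real^4 \<Rightarrow> real^4" where
  "rh3_action a = plane_action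
     (vector [vector [0,   0, 0, 0],
              vector [0,   0, 0, 0],
              vector [a,   0, 0, 0],
              vector [0, - a, 0, 0]])
     (vector [vector [0, 0, 0, 0],
              vector [0, 0, 0, 0],
              vector [0, a, 0, 0],
              vector [a, 0, 0, 0]])"

definition r2' :: "real \<Rightarrow> real \<Rightarrow> real \<Rightarrow> (real^4) pk_structure" where
  "r2' a12 a13 a14 =
     \<lparr>bracket = (\<lambda>x y. vector [0, 0, wedge 1 3 x y - wedge 2 4 x y, wedge 1 4 x y + wedge 2 3 x y]),
      metric = (\<lambda>x y. x \<bullet> (vector [vector [a12,   0,   - a14, a13],
                                      vector [0,     a12, a13,   a14],
                                      vector [- a14, a13, 0,     0],
                                      vector [a13,   a14, 0,     0]] *v y)),
      cplx = (\<lambda>x. vector [vector [ 0, 1, 0,  0],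
                           vector [-1, 0, 0,  0],
                           vector [ 0, 0, 0, -1],
                           vector [ 0, 0, 1,  0]] *v x)\<rparr>"

definition r2'_action :: "real \<Rightarrow> real^2 \<Rightarrow> real^4 \<Rightarrow> real^4" where
  "r2'_action a = plane_action
     (vector [vector [0, 0, 0, 0],
              vector [0, 0, 0, 0],
              vector [a, 0, 0, 0],
              vector [0, a, 0, 0]])
     (vector [vector [0,   0, 0, 0],
              vector [0,   0, 0, 0],
              vector [0, - a, 0, 0],
              vector [a,   0, 0, 0]])"

lemma cplx_on_basis:
  "cplx flat_plane (axis 1 1) = axis 2 1"
  "cplx abelian4 (axis 1 1) = axis 3 1" "cplx abelian4 (axis 2 1) = axis 4 1"
  "cplx rh3 (axis 1 1) = axis 2 1" "cplx rh3 (axis 3 1) = axis 4 1"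
  by (simp_all add: flat_plane_def abelian4_def rh3_def vec_eq_iff forall_2 forall_4 axis_def)

lemma bracket_on_basis:
  "bracket rh3 (axis 1 1) (axis 2 1) = axis 3 1"
  "bracket (r2' p q r) (axis 1 1) (axis 3 1) = axis 3 1"
  "bracket (r2' p q r) (axis 1 1) (axis 4 1) = axis 4 1"
  "bracket (r2' p q r) (axis 2 1) (axis 3 1) = axis 4 1"
  "bracket (r2' p q r) (axis 2 1) (axis 4 1) = - axis 3 1"
  by (simp_all add: rh3_def r2'_def wedge_def vec_eq_iff forall_4 axis_def)

end

theory Submission
  imports Defs
begin

text \<open>
  Let \<open>J\<close> act as multiplication by the imaginary unit. A four-dimensional pseudo-Kaehler Lie algebra
  is then a complex plane with the Hermitian form \<open>h(x, y) = g(x, y) + \<i> g(x, J y)\<close>. Identify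
  \<open>\<real>\<^sup>2\<close> with the complex numbers, let \<open>S\<close> be the symmetric part of \<open>\<phi>(1)\<close>, let \<open>T\<close> and \<open>T'\<close> be the
  antisymmetric parts of \<open>\<phi>(1)\<close> and \<open>\<phi>(\<i>)\<close>, and put \<open>X = T' - J T\<close>, whose adjoint is
  \<open>Y = - T' - J T\<close>. The conditions on an extension say that \<open>S\<close> is antilinear, that \<open>X\<close> is complex
  linear, and that \<open>\<phi>(a) = a S + (\<i> / 2) (cnj a X + a Y)\<close>. As the plane is abelian, \<open>\<phi>(1)\<close> and
  \<open>\<phi>(\<i>)\<close> commute; the antilinear and the linear part of this are \<open>X S + S Y = 0\<close> and
  \<open>X Y - Y X = - 4 S\<^sup>2\<close>.

  The second identity makes \<open>S\<^sup>2\<close> traceless. If \<open>M\<close> is the matrix of \<open>S\<close>, then \<open>S\<^sup>2\<close> has the matrix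
  \<open>M cnj M\<close>, with determinant \<open>\<bar>det M\<bar>\<^sup>2 \<ge> 0\<close>. So either \<open>S\<close> is injective and the eigenvalues of
  \<open>S\<^sup>2\<close> are \<open>\<i> \<delta>\<close> and \<open>- \<i> \<delta>\<close> for some \<open>\<delta> > 0\<close>, or \<open>S\<^sup>2 = 0\<close>. Both cases have an isotropic basis
  \<open>p\<close>, \<open>q = S p\<close> with \<open>h(p, q) = 1\<close>, and the two identities leave few possibilities for \<open>X\<close>
  (\<open>regular_form_exists\<close>, \<open>singular_form_exists\<close>). Here \<open>S \<noteq> 0\<close>, since the extension is trivial
  otherwise.

  In the injective case \<open>X\<close> is determined up to a phase, which a rotation of \<open>\<real>\<^sup>2\<close> removes. In the
  singular case \<open>X p = x p + y q\<close> and \<open>X q = 0\<close>. In the injective case, and in the singular case with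
  \<open>x \<noteq> 0\<close>, the fourth power of some \<open>\<phi>(a)\<close> is a nonzero scalar. A derivation with this property
  annihilates all brackets (\<open>derivation_fourth_power_abelian\<close>), so the Lie algebra is abelian, and up
  to an isomorphism and a rotation of the plane the extension belongs to one of the two abelian families.

  If \<open>x = 0\<close>, then some \<open>\<phi>(a)\<close> with \<open>\<bar>a\<bar> = 1\<close> equals \<open>a S\<close>. So \<open>a S\<close> is a derivation, and together
  with the integrability of \<open>J\<close>, the closedness of the Kaehler form and the Jacobi identity this
  reduces the bracket to two complex parameters \<open>v\<close> and \<open>\<alpha>\<close> (\<open>bracket_of_null_derivation\<close>). Then all \<open>b S\<close> are derivations and
  commute with \<open>\<phi>\<close>, hence \<open>\<phi>\<close> is AW-related to its symmetric part, and the cases \<open>\<alpha> \<noteq> 0\<close>,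
  \<open>\<alpha> = 0 \<noteq> v\<close> and \<open>\<alpha> = v = 0\<close> give \<open>r2'\<close>, \<open>rh3\<close> and the abelian algebra.
\<close>

section \<open>Pseudo-Hermitian planes\<close>

locale pseudo_hermitian =
  fixes g :: "'a::real_vector \<Rightarrow> 'a \<Rightarrow> real" and J :: "'a \<Rightarrow> 'a"
  assumes g: "pseudo_riemannian g"
    and linJ: "linear J"
    and JJ: "J (J x) = - x"
    and gJ: "g (J x) (J y) = g x y"
begin

definition cscale :: "complex \<Rightarrow> 'a \<Rightarrow> 'a"  (infixr "\<star>" 75)
  where "c \<star> x = Re c *\<^sub>R x + Im c *\<^sub>R J x"

definition herm :: "'a \<Rightarrow> 'a \<Rightarrow> complex"
  where "herm x y = Complex (g x y) (g x (J y))"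

lemma g_bilinear: "bilinear g" and g_sym: "g x y = g y x"
  using g by (auto simp: pseudo_riemannian_def)

lemmas g_simps = bilinear_ladd[OF g_bilinear] bilinear_radd[OF g_bilinear]
  bilinear_lmul[OF g_bilinear] bilinear_rmul[OF g_bilinear]
  bilinear_lsub[OF g_bilinear] bilinear_rsub[OF g_bilinear]
  bilinear_lneg[OF g_bilinear] bilinear_rneg[OF g_bilinear]
  bilinear_lzero[OF g_bilinear] bilinear_rzero[OF g_bilinear]

lemmas J_simps = linear_add[OF linJ] linear_scale[OF linJ] linear_diff[OF linJ] linear_neg[OF linJ]
  linear_0[OF linJ] JJ

lemma g_eqI: "(\<And>z. g x z = g y z) \<Longrightarrow> x = y"
proof -
  assume "\<And>z. g x z = g y z"
  then have "\<forall>z. g (x - y) z = 0" by (simp add: g_simps)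
  then have "x - y = 0" using g unfolding pseudo_riemannian_def by blast
  then show "x = y" by simp
qed

lemma g_J: "g (J x) y = - g x (J y)"
  using gJ[of x "J y"] by (simp add: JJ g_simps)

sublocale C: vector_space cscale
proof
  fix a b :: complex and x y :: 'a
  show "a \<star> (x + y) = a \<star> x + a \<star> y"
    by (simp add: cscale_def J_simps scaleR_add_right)
  show "(a + b) \<star> x = a \<star> x + b \<star> x"
    by (simp add: cscale_def scaleR_add_left)
  show "a \<star> b \<star> x = (a * b) \<star> x"
    by (simp add: cscale_def J_simps scaleR_add_left scaleR_diff_left scaleR_add_right scaleR_diff_right)
  show "1 \<star> x = x"
    by (simp add: cscale_def)
qed

lemma i_scale: "\<i> \<star> x = J x"
  by (simp add: cscale_def)

lemma of_real_scale: "of_real r \<star> x = r *\<^sub>R x"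
  by (simp add: cscale_def)

lemma scaleR_cscale: "r *\<^sub>R (c \<star> x) = (of_real r * c) \<star> x"
  by (simp add: cscale_def scaleR_add_right)

lemma J_cscale: "J (c \<star> x) = (\<i> * c) \<star> x"
  by (simp add: cscale_def J_simps)

lemma herm_add: "herm (x + y) z = herm x z + herm y z" "herm x (y + z) = herm x y + herm x z"
  by (simp_all add: herm_def g_simps J_simps complex_eq_iff)

lemma herm_scale: "herm (c \<star> x) y = c * herm x y" "herm x (c \<star> y) = cnj c * herm x y"
  by (simp_all add: herm_def cscale_def g_simps J_simps g_J complex_eq_iff)

lemma herm_commute: "herm y x = cnj (herm x y)"
  using g_sym[of x y] g_J[of y x] g_sym[of x "J y"] by (simp add: herm_def complex_eq_iff)

lemma herm_zero: "herm 0 y = 0" "herm x 0 = 0"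
  by (simp_all add: herm_def g_simps J_simps complex_eq_iff)

lemma g_herm: "g x y = Re (herm x y)"
  by (simp add: herm_def)

lemma herm_self: "herm x x = of_real (g x x)"
  using herm_commute[of x x] by (simp add: herm_def complex_eq_iff)

lemma herm_eqI: "(\<And>z. herm x z = herm y z) \<Longrightarrow> x = y"
  by (rule g_eqI) (simp add: g_herm)

text \<open>
  Bases over the complex numbers. The carrier is only known as a real vector space, so they are
  described by existence and uniqueness of coordinates.
\<close>

definition frame :: "'a \<Rightarrow> 'a \<Rightarrow> bool" where
  "frame p q \<longleftrightarrow> (\<forall>x. \<exists>z w. x = z \<star> p + w \<star> q) \<and> (\<forall>z w. z \<star> p + w \<star> q = 0 \<longrightarrow> z = 0 \<and> w = 0)"

lemma frame_expand: "frame p q \<Longrightarrow> \<exists>z w. x = z \<star> p + w \<star> q"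
  by (simp add: frame_def)

lemma frame_eq_iff:
  assumes "frame p q"
  shows "z \<star> p + w \<star> q = z' \<star> p + w' \<star> q \<longleftrightarrow> z = z' \<and> w = w'"
proof
  assume "z \<star> p + w \<star> q = z' \<star> p + w' \<star> q"
  then have "(z - z') \<star> p + (w - w') \<star> q = 0"
    by (metis C.scale_left_diff_distrib add_diff_add diff_self)
  then show "z = z' \<and> w = w'" using assms unfolding frame_def by force
qed simp

end

locale hermitian_plane = pseudo_hermitian +
  assumes dim4: "dim (UNIV :: 'a set) = 4"
begin

lemma finite_basis: "\<exists>B :: 'a set. finite B \<and> span B = UNIV \<and> card B = 4"
proof -
  obtain B :: "'a set" where B: "UNIV \<subseteq> span B" "card B = dim (UNIV :: 'a set)"
    using basis_exists[of "UNIV :: 'a set"] by metis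
  have "card B = 4" using B(2) dim4 by (rule trans)
  moreover from this have "finite B" by (intro card_ge_0_finite) simp
  ultimately show ?thesis using B(1) by blast
qed

text \<open>
  Two complex independent vectors \<open>p\<close>, \<open>q\<close> give four real independent vectors
  \<open>p\<close>, \<open>J p\<close>, \<open>q\<close>, \<open>J q\<close>, and these span a space of real dimension four.
\<close>

lemma frameI:
  assumes pq: "\<And>z w. z \<star> p + w \<star> q = 0 \<Longrightarrow> z = 0 \<and> w = 0"
  shows "frame p q"
proof -
  have comb: "a = 0 \<and> b = 0 \<and> c = 0 \<and> d = 0"
    if "a *\<^sub>R p + b *\<^sub>R J p + c *\<^sub>R q + d *\<^sub>R J q = 0" for a b c d
    using pq[of "Complex a b" "Complex c d"] that by (simp add: cscale_def complex_eq_iff add.assoc)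
  have ne: "p \<noteq> J p" "p \<noteq> q" "p \<noteq> J q" "J p \<noteq> q" "J p \<noteq> J q" "q \<noteq> J q"
    using comb[of 1 "-1" 0 0] comb[of 1 0 "-1" 0] comb[of 1 0 0 "-1"] comb[of 0 1 "-1" 0]
      comb[of 0 1 0 "-1"] comb[of 0 0 1 "-1"] by auto
  let ?I = "{p, J p, q, J q}"
  have card: "card ?I = 4" using ne by auto
  have indep: "independent ?I"
  proof (rule independent_if_scalars_zero)
    fix f x assume *: "(\<Sum>x\<in>?I. f x *\<^sub>R x) = 0" and "x \<in> ?I"
    from * have "f p *\<^sub>R p + f (J p) *\<^sub>R J p + f q *\<^sub>R q + f (J q) *\<^sub>R J q = 0"
      using ne by (simp add: add.assoc)
    from comb[OF this] show "f x = 0" using \<open>x \<in> ?I\<close> by blast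
  qed simp
  obtain B :: "'a set" where B: "finite B" "span B = UNIV" "card B = 4"
    using finite_basis by auto
  have "x \<in> span ?I" for x
  proof (rule ccontr)
    assume x: "x \<notin> span ?I"
    then have "independent (insert x ?I)" using indep by (simp add: independent_insert)
    then have "card (insert x ?I) \<le> 4"
      using independent_span_bound[OF B(1), of "insert x ?I"] unfolding B by blast
    moreover have "x \<notin> ?I" using x span_base[of x ?I] by metis
    ultimately show False using card by simp
  qed
  then have span: "\<exists>a b c d. x = a *\<^sub>R p + b *\<^sub>R J p + c *\<^sub>R q + d *\<^sub>R J q" for x
  proof -
    have "x \<in> span ?I" by fact
    then obtain a b c d where "x - a *\<^sub>R p - b *\<^sub>R J p - c *\<^sub>R q - d *\<^sub>R J q = 0"
      unfolding span_breakdown_eq span_empty by blast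
    then have "x = a *\<^sub>R p + b *\<^sub>R J p + c *\<^sub>R q + d *\<^sub>R J q" by (simp add: algebra_simps)
    then show ?thesis by blast
  qed
  have "\<exists>z w. x = z \<star> p + w \<star> q" for x
  proof -
    obtain a b c d where "x = a *\<^sub>R p + b *\<^sub>R J p + c *\<^sub>R q + d *\<^sub>R J q" using span by blast
    then have "x = Complex a b \<star> p + Complex c d \<star> q" by (simp add: cscale_def add.assoc)
    then show ?thesis by blast
  qed
  then show ?thesis using pq unfolding frame_def by blast
qed

lemma frame_exists:
  assumes "p \<noteq> 0" shows "\<exists>v. frame p v"
proof -
  obtain v where v: "v \<notin> range (\<lambda>z. z \<star> p)"
  proof -
    have "\<exists>v. v \<notin> range (\<lambda>z. z \<star> p)"
    proof (rule ccontr)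
      assume "\<not> ?thesis"
      then have "\<exists>z. v = z \<star> p" for v by blast
      moreover have "z \<star> p \<in> span {p, J p}" for z
        unfolding cscale_def by (intro span_add span_scale span_base) auto
      ultimately have "v \<in> span {p, J p}" for v by (metis (no_types))
      then have "dim (UNIV :: 'a set) \<le> card {p, J p}" by (intro dim_le_card) auto
      also have "\<dots> \<le> 2" by (simp add: card_insert_if)
      finally show False using dim4 by simp
    qed
    then show ?thesis using that by blast
  qed
  have "frame p v"
  proof (rule frameI)
    fix z w assume *: "z \<star> p + w \<star> v = 0"
    have "w = 0"
    proof (rule ccontr)
      assume "w \<noteq> 0"
      have "w \<star> v = (- z) \<star> p" using * by (simp add: eq_neg_iff_add_eq_0 add.commute)
      then have "(1 / w) \<star> w \<star> v = (1 / w) \<star> (- z) \<star> p" by simp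
      then have "v = (- z / w) \<star> p" using \<open>w \<noteq> 0\<close> by simp
      then show False using v by blast
    qed
    then show "z = 0 \<and> w = 0" using * assms by auto
  qed
  then show ?thesis by blast
qed

end

context pseudo_hermitian
begin

lemma diff_comb:
  "(z \<star> p + w \<star> q) - (z' \<star> p + w' \<star> q) = (z - z') \<star> p + (w - w') \<star> q"
  by (simp add: C.scale_left_diff_distrib)

lemma scale_comb: "c \<star> (z \<star> p + w \<star> q) = (c * z) \<star> p + (c * w) \<star> q"
  by (simp add: C.scale_right_distrib)

lemma add_comb: "(z \<star> p + w \<star> q) + (z' \<star> p + w' \<star> q) = (z + z') \<star> p + (w + w') \<star> q"
  by (simp add: C.scale_left_distrib)

definition hyperbolic :: "'a \<Rightarrow> 'a \<Rightarrow> bool" where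
  "hyperbolic p q \<longleftrightarrow> herm p p = 0 \<and> herm q q = 0 \<and> herm p q = 1"

lemma hyperbolic_herm:
  assumes "hyperbolic p q"
  shows "herm (z \<star> p + w \<star> q) (z' \<star> p + w' \<star> q) = z * cnj w' + w * cnj z'"
  using assms herm_commute[of q p] by (simp add: hyperbolic_def herm_add herm_scale)

end

section \<open>Normal forms of the symmetric part\<close>

lemma diff_add_add_cancel: "a + a = (a - b) + (a + (b :: 'a :: ab_group_add))"
  by (simp add: algebra_simps)

lemma add_diff_diff_cancel: "b + b = (a + b) - (a - (b :: 'a :: ab_group_add))"
  by (simp add: algebra_simps)

lemma (in hermitian_plane) nonzero_exists: "\<exists>u::'a. u \<noteq> 0"
proof (rule ccontr)
  assume "\<not> ?thesis"
  then have "(UNIV :: 'a set) \<subseteq> span {}" by auto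
  then have "dim (UNIV :: 'a set) \<le> card ({} :: 'a set)" by (intro dim_le_card) auto
  then show False using dim4 by simp
qed

lemma (in hermitian_plane) hyperbolic_frame:
  assumes "hyperbolic p q" shows "frame p q"
proof (rule frameI)
  fix z w assume *: "z \<star> p + w \<star> q = 0"
  have "herm (z \<star> p + w \<star> q) (0 \<star> p + 1 \<star> q) = z" "herm (z \<star> p + w \<star> q) (1 \<star> p + 0 \<star> q) = w"
    by (simp_all only: hyperbolic_herm[OF assms]) simp_all
  then show "z = 0 \<and> w = 0" unfolding * by (simp add: herm_zero)
qed

text \<open>
  The form pairs \<open>p\<close> with \<open>q\<close>, so taking adjoints conjugates the matrix and reflects it in the
  antidiagonal.
\<close>

lemma (in hermitian_plane) adjoint_hyperbolic:
  assumes pq: "hyperbolic p q"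
    and adj: "\<And>x y. herm (X x) y = herm x (Y y)"
    and X: "X p = a \<star> p + b \<star> q" "X q = c \<star> p + d \<star> q"
  shows "Y p = cnj d \<star> p + cnj b \<star> q" "Y q = cnj c \<star> p + cnj a \<star> q"
proof -
  have p: "p = 1 \<star> p + 0 \<star> q" and q: "q = 0 \<star> p + 1 \<star> q" by simp_all
  note H = hyperbolic_herm[OF pq]
  obtain e f where e: "Y p = e \<star> p + f \<star> q" using frame_expand[OF hyperbolic_frame[OF pq]] by blast
  obtain k l where k: "Y q = k \<star> p + l \<star> q" using frame_expand[OF hyperbolic_frame[OF pq]] by blast
  have "b = cnj f" using adj[of p p] unfolding X e using H[of a b 1 0] H[of 1 0 e f] by simp
  moreover have "d = cnj e" using adj[of q p] unfolding X e using H[of c d 1 0] H[of 0 1 e f] by simp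
  moreover have "a = cnj l" using adj[of p q] unfolding X k using H[of a b 0 1] H[of 1 0 k l] by simp
  moreover have "c = cnj k" using adj[of q q] unfolding X k using H[of c d 0 1] H[of 0 1 k l] by simp
  ultimately show "Y p = cnj d \<star> p + cnj b \<star> q" "Y q = cnj c \<star> p + cnj a \<star> q"
    using e k by simp_all
qed

text \<open>
  What an extension by the flat plane leaves behind on the complex plane: \<open>S\<close> is the symmetric part
  of \<open>\<phi>(1)\<close>, and \<open>X\<close> with its adjoint \<open>Y\<close> carries both antisymmetric parts. The last two assumptions
  are the antilinear and the linear part of the commutation of \<open>\<phi>(1)\<close> with \<open>\<phi>(\<i>)\<close>.
\<close>

locale hermitian_pair = hermitian_plane +
  fixes S X Y :: "'a \<Rightarrow> 'a"
  assumes S_add: "S (x + y) = S x + S y"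
    and S_scale: "S (c \<star> x) = cnj c \<star> S x"
    and S_sym: "herm (S x) y = herm (S y) x"
    and X_add: "X (x + y) = X x + X y"
    and X_scale: "X (c \<star> x) = c \<star> X x"
    and Y_add: "Y (x + y) = Y x + Y y"
    and Y_scale: "Y (c \<star> x) = c \<star> Y x"
    and adj: "herm (X x) y = herm x (Y y)"
    and XS: "X (S x) + S (Y x) = 0"
    and comm: "X (Y x) - Y (X x) = (- 4) \<star> S (S x)"
begin

lemma S_comb: "S (z \<star> p + w \<star> q) = cnj z \<star> S p + cnj w \<star> S q"
  by (simp add: S_add S_scale)

lemma S_zero: "S 0 = 0" and S_neg: "S (- x) = - S x" and S_diff: "S (x - y) = S x - S y"
  using S_scale[of 0 x] S_scale[of "- 1" x] S_add[of x "- y"] S_scale[of "- 1" y] by simp_all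

lemma X_comb: "X (z \<star> p + w \<star> q) = z \<star> X p + w \<star> X q"
  by (simp add: X_add X_scale)

lemma Y_comb: "Y (z \<star> p + w \<star> q) = z \<star> Y p + w \<star> Y q"
  by (simp add: Y_add Y_scale)

text \<open>
  The left-hand side is the complex trace of \<open>S\<^sup>2\<close>. It vanishes because \<open>- 4 S\<^sup>2\<close> is a commutator of
  complex linear maps.
\<close>

lemma trace_square:
  assumes uv: "frame u v"
    and S: "S u = a \<star> u + b \<star> v" "S v = c \<star> u + d \<star> v"
  shows "a * cnj a + c * cnj b + b * cnj c + d * cnj d = 0"
proof -
  obtain x1 x2 where x: "X u = x1 \<star> u + x2 \<star> v" using frame_expand[OF uv] by blast
  obtain x3 x4 where x': "X v = x3 \<star> u + x4 \<star> v" using frame_expand[OF uv] by blast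
  obtain y1 y2 where y: "Y u = y1 \<star> u + y2 \<star> v" using frame_expand[OF uv] by blast
  obtain y3 y4 where y': "Y v = y3 \<star> u + y4 \<star> v" using frame_expand[OF uv] by blast
  note ms = S x x' y y' X_comb Y_comb S_comb add_comb diff_comb scale_comb frame_eq_iff[OF uv]
  have 1: "(y1 * x1 + y2 * x3) - (x1 * y1 + x2 * y3) = - 4 * (cnj a * a + cnj b * c)"
    using comm[of u] by (simp only: ms)
  have 2: "(y3 * x2 + y4 * x4) - (x3 * y2 + x4 * y4) = - 4 * (cnj c * b + cnj d * d)"
    using comm[of v] by (simp only: ms)
  from 1 2 show ?thesis by algebra
qed

text \<open>
  The normal forms of \<open>(S, X, Y)\<close> for singular and for injective \<open>S\<close>. The number \<open>\<i> \<delta>\<close> is the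
  eigenvalue of \<open>S\<^sup>2\<close> on \<open>p\<close>.
\<close>

definition singular_form :: "'a \<Rightarrow> 'a \<Rightarrow> complex \<Rightarrow> complex \<Rightarrow> bool" where
  "singular_form p q x y \<longleftrightarrow> hyperbolic p q \<and> S p = q \<and> S q = 0 \<and>
     X p = x \<star> p + y \<star> q \<and> X q = 0 \<and> Y p = cnj y \<star> q \<and> Y q = cnj x \<star> q \<and> Re (cnj x * y) = 0"

definition regular_form :: "'a \<Rightarrow> 'a \<Rightarrow> complex \<Rightarrow> real \<Rightarrow> bool" where
  "regular_form p q y \<delta> \<longleftrightarrow> hyperbolic p q \<and> S p = q \<and> S q = (\<i> * of_real \<delta>) \<star> p \<and>
     X p = y \<star> q \<and> X q = (- \<i> * of_real \<delta> * y) \<star> p \<and>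
     Y p = cnj y \<star> q \<and> Y q = (\<i> * of_real \<delta> * cnj y) \<star> p \<and> cmod y ^ 2 = 2 \<and> \<delta> > 0"

text \<open>
  A kernel vector makes one column of the matrix of \<open>S\<close> vanish, and tracelessness of \<open>S\<^sup>2\<close> then kills
  a diagonal entry, so that \<open>S\<^sup>2 = 0\<close>. As \<open>S\<close> is symmetric, its image is isotropic. A preimage \<open>p\<close> of
  an image vector can be made isotropic by adding a multiple of the latter, which changes nothing in
  \<open>S p\<close>.
\<close>

lemma singular_form_exists:
  assumes k: "k \<noteq> 0" "S k = 0" and nz: "S x0 \<noteq> 0"
  shows "\<exists>p q x y. singular_form p q x y"
proof -
  obtain v where kv: "frame k v" using frame_exists[OF k(1)] by blast
  obtain c d where Sv: "S v = c \<star> k + d \<star> v" using frame_expand[OF kv] by blast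
  have "d * cnj d = 0"
    using trace_square[OF kv _ Sv, of 0 0] k(2) by simp
  then have "S v = c \<star> k" using Sv by simp
  then have SSv: "S (S v) = 0" by (simp add: S_scale k(2))
  define s where "s = S v"
  have Ss: "S s = 0" using SSv by (simp add: s_def)
  have nz_s: "s \<noteq> 0"
  proof
    assume "s = 0"
    obtain z w where "x0 = z \<star> k + w \<star> v" using frame_expand[OF kv] by blast
    then show False using nz k(2) \<open>s = 0\<close> by (simp add: S_comb s_def)
  qed
  have ss: "herm s s = 0"
    using S_sym[of v s] Ss by (simp add: s_def herm_zero)
  have sk: "herm s k = 0"
    using S_sym[of v k] k(2) by (simp add: s_def herm_zero)
  define \<kappa> where "\<kappa> = herm v s"
  have sv: "herm s v = cnj \<kappa>" using herm_commute[of s v] by (simp add: \<kappa>_def)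
  have "\<kappa> \<noteq> 0"
  proof
    assume "\<kappa> = 0"
    have "s = 0"
    proof (rule herm_eqI)
      fix x obtain z w where "x = z \<star> k + w \<star> v" using frame_expand[OF kv] by blast
      then show "herm s x = herm 0 x" using sk sv \<open>\<kappa> = 0\<close> by (simp add: herm_add herm_scale herm_zero)
    qed
    then show False using nz_s by simp
  qed
  define l where "l = 1 / csqrt \<kappa>"
  have l: "l * l * \<kappa> = 1" using \<open>\<kappa> \<noteq> 0\<close> power2_csqrt[of \<kappa>] by (simp add: l_def field_simps power2_eq_square)
  define p1 q where "p1 = l \<star> v" and "q = cnj l \<star> s"
  \<comment> \<open>Since \<open>h(p1, q) = 1\<close>, adding \<open>t q\<close> changes \<open>h(p1, p1)\<close> by \<open>2 t\<close>.\<close>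
  define t where "t = - (1/2) * herm p1 p1"
  define p where "p = p1 + t \<star> q"
  have qq: "herm q q = 0" by (simp add: q_def herm_scale ss)
  have p1q: "herm p1 q = 1" using l by (simp add: p1_def q_def herm_scale \<kappa>_def[symmetric] mult.assoc)
  have qp1: "herm q p1 = 1" using herm_commute[of q p1] p1q by simp
  have "cnj t = t" using herm_commute[of p1 p1] by (simp add: t_def)
  then have pq: "hyperbolic p q"
    by (simp add: hyperbolic_def p_def herm_add herm_scale qq p1q qp1) (simp add: t_def)
  have Sq: "S q = 0" by (simp add: q_def S_scale Ss)
  have Sp: "S p = q" by (simp add: p_def S_add S_scale Sq p1_def q_def s_def SSv)
  have fr: "frame p q" by (rule hyperbolic_frame[OF pq])
  obtain x y where Xp: "X p = x \<star> p + y \<star> q" using frame_expand[OF fr] by blast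
  obtain c d where Xq: "X q = c \<star> p + d \<star> q" using frame_expand[OF fr] by blast
  note Y = adjoint_hyperbolic[OF pq adj Xp Xq]
  have Sp': "S p = 0 \<star> p + 1 \<star> q" and Sq': "S q = 0 \<star> p + 0 \<star> q" using Sp Sq by simp_all
  note ms = Xp Xq Y S_comb Sp' Sq' X_comb Y_comb add_comb diff_comb scale_comb frame_eq_iff[OF fr]
    complex_cnj_cnj
  have XS0: "X (S x) + S (Y x) = 0 \<star> p + 0 \<star> q" for x using XS[of x] by simp
  have cd: "c = 0" "d = 0"
    using XS0[of p] unfolding ms by simp_all
  have "cnj x * y + x * cnj y = 0"
    using comm[of p] unfolding ms cd by simp algebra
  then have "Re (cnj x * y) = 0" by (simp add: complex_eq_iff)
  then have "singular_form p q x y"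
    unfolding singular_form_def using pq Sp Sq Xp Xq Y cd by simp
  then show ?thesis by blast
qed

text \<open>
  Cayley-Hamilton for the traceless map \<open>S\<^sup>2\<close>: its square is minus its determinant, and the
  determinant is \<open>\<bar>det M\<bar>\<^sup>2\<close> for the matrix \<open>M\<close> of \<open>S\<close>.
\<close>

lemma fourth_power:
  "\<exists>\<delta>::real. \<forall>x. S (S (S (S x))) = (- (of_real \<delta>)\<^sup>2) \<star> x"
proof -
  obtain u :: 'a where "u \<noteq> 0" using nonzero_exists by blast
  then obtain v where uv: "frame u v" using frame_exists by blast
  obtain a b where Su: "S u = a \<star> u + b \<star> v" using frame_expand[OF uv] by blast
  obtain c d where Sv: "S v = c \<star> u + d \<star> v" using frame_expand[OF uv] by blast
  define \<delta> where "\<delta> = cmod (a * d - b * c)"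
  have \<delta>: "(of_real \<delta>)\<^sup>2 = (a * d - b * c) * cnj (a * d - b * c)"
    by (simp only: \<delta>_def complex_norm_square of_real_power[symmetric])
  have tr: "a * cnj a + c * cnj b + b * cnj c + d * cnj d = 0" by (rule trace_square[OF uv Su Sv])
  have "S (S (S (S x))) = (- (of_real \<delta>)\<^sup>2) \<star> x" for x
  proof -
    obtain z w where x: "x = z \<star> u + w \<star> v" using frame_expand[OF uv] by blast
    show ?thesis
      unfolding x S_comb Su Sv add_comb scale_comb frame_eq_iff[OF uv] \<delta> complex_cnj_add complex_cnj_mult
        complex_cnj_diff complex_cnj_cnj
      using tr by algebra
  qed
  then show ?thesis by blast
qed

text \<open>
  An eigenvector \<open>p\<close> of \<open>S\<^sup>2\<close> for the eigenvalue \<open>\<i> \<delta>\<close> is isotropic, because \<open>S\<^sup>2\<close> is selfadjoint and the eigenvalue is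
  not real; \<open>S p\<close> is an eigenvector for \<open>- \<i> \<delta>\<close>. The commutator identity, evaluated at \<open>p\<close>, then
  fixes the modulus of the only free entry of \<open>X\<close>.
\<close>

lemma regular_form_exists:
  assumes inj: "\<And>x. S x = 0 \<Longrightarrow> x = 0"
  shows "\<exists>p q y \<delta>. regular_form p q y \<delta>"
proof -
  obtain \<delta>0 :: real where \<delta>0: "\<And>x. S (S (S (S x))) = (- (of_real \<delta>0)\<^sup>2) \<star> x" using fourth_power by blast
  define \<delta> where "\<delta> = \<bar>\<delta>0\<bar>"
  have S4: "S (S (S (S x))) = (- (of_real \<delta>)\<^sup>2) \<star> x" for x
    using \<delta>0[of x] by (simp add: \<delta>_def flip: of_real_power)
  obtain u :: 'a where u: "u \<noteq> 0" using nonzero_exists by blast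
  have "\<delta> \<noteq> 0"
  proof
    assume "\<delta> = 0"
    then have "S (S (S (S u))) = 0" using S4[of u] by simp
    then show False using inj u by blast
  qed
  then have pos: "\<delta> > 0" by (simp add: \<delta>_def)
  let ?d = "\<i> * of_real \<delta>"
  have "- (of_real \<delta>)\<^sup>2 = ?d * ?d" by (simp add: complex_eq_iff power2_eq_square)
  then have S4': "S (S (S (S x))) = (?d * ?d) \<star> x" for x using S4[of x] by simp
  define f where "f x = S (S x) + ?d \<star> x" for x
  have Sf: "S (S (f x)) = ?d \<star> f x" for x
    by (simp add: f_def S_add S_diff S_neg S_scale S4' C.scale_right_distrib)
  \<comment> \<open>If \<open>f\<close> vanished at \<open>u\<close> and at \<open>S u\<close>, then \<open>S\<close>, being antilinear, would carry the eigenvalue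
    \<open>- \<i> \<delta>\<close> of \<open>S\<^sup>2\<close> at \<open>u\<close> to its conjugate at \<open>S u\<close>, where \<open>f\<close> gives \<open>- \<i> \<delta>\<close> again.\<close>
  have "f u \<noteq> 0 \<or> f (S u) \<noteq> 0"
  proof (rule ccontr)
    assume "\<not> ?thesis"
    then have "S (f u) = 0" "f (S u) = 0" by (auto simp: S_zero)
    then have "S (S (S u)) - ?d \<star> S u = 0" "S (S (S u)) + ?d \<star> S u = 0"
      by (simp_all add: f_def S_add S_scale)
    moreover have "(?d + ?d) \<star> S u = (S (S (S u)) + ?d \<star> S u) - (S (S (S u)) - ?d \<star> S u)"
      unfolding C.scale_left_distrib by (rule add_diff_diff_cancel)
    ultimately have "(?d + ?d) \<star> S u = 0" by (simp only: diff_self)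
    then show False using pos inj u by auto
  qed
  then obtain p0 where p0: "p0 \<noteq> 0" "S (S p0) = ?d \<star> p0" using Sf by blast
  define q0 where "q0 = S p0"
  have Sq0: "S q0 = ?d \<star> p0" by (simp add: q0_def p0)
  have q0: "q0 \<noteq> 0" using inj[of p0] p0(1) by (auto simp: q0_def)
  have fr0: "frame p0 q0"
  proof (rule frameI)
    fix z w assume *: "z \<star> p0 + w \<star> q0 = 0"
    then have "S (S (z \<star> p0 + w \<star> q0)) = S (S 0)" by simp
    then have "(z * ?d) \<star> p0 - (w * ?d) \<star> q0 = 0"
      by (simp add: S_add S_scale Sq0 q0_def[symmetric] S_zero mult.commute)
    moreover have "(z * ?d) \<star> p0 + (w * ?d) \<star> q0 = 0"
      using arg_cong[OF *, of "\<lambda>x. ?d \<star> x"] by (simp add: C.scale_right_distrib mult.commute)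
    moreover have "(z * ?d + z * ?d) \<star> p0
        = ((z * ?d) \<star> p0 - (w * ?d) \<star> q0) + ((z * ?d) \<star> p0 + (w * ?d) \<star> q0)"
      unfolding C.scale_left_distrib by (rule diff_add_add_cancel)
    ultimately have "(z * ?d + z * ?d) \<star> p0 = 0" by (simp only: add_0_left)
    then have "z = 0" using p0 pos by auto
    then show "z = 0 \<and> w = 0" using * q0 by simp
  qed
  have "herm q0 q0 = ?d * herm p0 p0"
    using S_sym[of "S p0" p0] by (simp add: q0_def p0 herm_scale)
  then have pp0: "herm p0 p0 = 0" and qq0: "herm q0 q0 = 0"
    using pos by (auto simp: herm_self complex_eq_iff)
  define \<kappa> where "\<kappa> = herm p0 q0"
  have "\<kappa> \<noteq> 0"
  proof
    assume "\<kappa> = 0"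
    have "p0 = 0"
    proof (rule herm_eqI)
      fix x obtain z w where "x = z \<star> p0 + w \<star> q0" using frame_expand[OF fr0] by blast
      then show "herm p0 x = herm 0 x"
        using pp0 \<open>\<kappa> = 0\<close> by (simp add: herm_add herm_scale herm_zero \<kappa>_def)
    qed
    then show False using p0 by simp
  qed
  define l where "l = 1 / csqrt \<kappa>"
  have l: "l * l * \<kappa> = 1" using \<open>\<kappa> \<noteq> 0\<close> power2_csqrt[of \<kappa>] by (simp add: l_def field_simps power2_eq_square)
  define p q where "p = l \<star> p0" and "q = cnj l \<star> q0"
  have pq: "hyperbolic p q"
    using l by (simp add: hyperbolic_def p_def q_def herm_scale pp0 qq0 \<kappa>_def[symmetric] mult.assoc)
  have Sp: "S p = q" by (simp add: p_def q_def S_scale q0_def)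
  have Sq: "S q = ?d \<star> p" by (simp add: p_def q_def S_scale Sq0 mult.commute)
  have fr: "frame p q" by (rule hyperbolic_frame[OF pq])
  obtain x y where Xp: "X p = x \<star> p + y \<star> q" using frame_expand[OF fr] by blast
  obtain c d where Xq: "X q = c \<star> p + d \<star> q" using frame_expand[OF fr] by blast
  note Y = adjoint_hyperbolic[OF pq adj Xp Xq]
  have zero: "(0 :: 'a) = 0 \<star> p + 0 \<star> q" by simp
  have Sq': "S q = ?d \<star> p + 0 \<star> q" and Sp': "S p = 0 \<star> p + 1 \<star> q" using Sp Sq by simp_all
  note ms = Xp Xq Y S_comb Sp' Sq' X_comb Y_comb add_comb diff_comb scale_comb frame_eq_iff[OF fr]
    complex_cnj_cnj
  have XS0: "X (S x) + S (Y x) = 0 \<star> p + 0 \<star> q" for x using XS[of x] by simp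
  have 1: "c + ?d * y = 0 \<and> d + d = 0"
    using XS0[of p] unfolding ms by (simp add: mult.commute)
  have 2: "x = 0"
    using XS0[of q] pos unfolding ms by simp
  have c: "c = - ?d * y" and d: "d = 0" using 1 by (simp_all add: eq_neg_iff_add_eq_0)
  have "c * cnj y - y * cnj c = - 4 * ?d"
    using comm[of p] unfolding ms 2 d by (simp add: mult.commute)
  then have "?d * (2 * (y * cnj y)) = ?d * 4"
    unfolding c by (simp add: algebra_simps)
  then have "y * cnj y = 2" using pos by simp
  then have "cmod y ^ 2 = 2" using complex_norm_square[of y] by (metis of_real_eq_iff of_real_numeral)
  then have "regular_form p q y \<delta>"
    unfolding regular_form_def using pq Sp Sq Xp Xq Y c d 2 pos by simp
  then show ?thesis by blast
qed

end

section \<open>Brackets with a special derivation\<close>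

lemma circulant_relations_trivial:
  fixes a b c d :: "'a::real_vector"
  assumes 0: "a + 4 *\<^sub>R b + 6 *\<^sub>R c + 4 *\<^sub>R d = 0"
    and 1: "4 *\<^sub>R a + b + 4 *\<^sub>R c + 6 *\<^sub>R d = 0"
    and 2: "6 *\<^sub>R a + 4 *\<^sub>R b + c + 4 *\<^sub>R d = 0"
    and 3: "4 *\<^sub>R a + 6 *\<^sub>R b + 4 *\<^sub>R c + d = 0"
  shows "a = 0"
proof -
  have n: "6 *\<^sub>R v = 5 *\<^sub>R v + v" "8 *\<^sub>R v = 4 *\<^sub>R v + 4 *\<^sub>R v" "7 *\<^sub>R v = 6 *\<^sub>R v + v"
    for v :: 'a
    using scaleR_add_left[of 5 1 v] scaleR_add_left[of 4 4 v] scaleR_add_left[of 6 1 v] by simp_all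
  have "4 *\<^sub>R a + b + 4 *\<^sub>R c + (5 *\<^sub>R d + d) = 4 *\<^sub>R a + (5 *\<^sub>R b + b) + 4 *\<^sub>R c + d"
    using 1 3 unfolding n(1) by simp
  then have bd: "b = d" by (simp add: algebra_simps)
  have "a + 4 *\<^sub>R b + (5 *\<^sub>R c + c) + 4 *\<^sub>R d = (5 *\<^sub>R a + a) + 4 *\<^sub>R b + c + 4 *\<^sub>R d"
    using 0 2 unfolding n(1) by simp
  then have ac: "a = c" by (simp add: algebra_simps)
  have x: "7 *\<^sub>R a + 8 *\<^sub>R b = 0" using 0 unfolding ac bd n(2,3) by (simp add: add_ac)
  have y: "8 *\<^sub>R a + 7 *\<^sub>R b = 0" using 1 unfolding ac bd n(2,3) by (simp add: add_ac)
  have "15 *\<^sub>R a = 8 *\<^sub>R (8 *\<^sub>R a + 7 *\<^sub>R b) - 7 *\<^sub>R (7 *\<^sub>R a + 8 *\<^sub>R b)"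
    by (simp add: scaleR_add_right scaleR_left_diff_distrib[symmetric])
  then show ?thesis unfolding x y by simp
qed

text \<open>
  Expanding \<open>f\<^sup>4 [u, v]\<close> by the Leibniz rule gives one linear relation between the brackets
  \<open>[f\<^sup>i u, f\<^sup>j v]\<close> with \<open>i + j\<close> divisible by four. Moving along the orbit of \<open>(u, v)\<close> yields four relations whose
  coefficients form an invertible circulant matrix. In terms of eigenvalues: no two fourth roots of
  \<open>c\<close> add up to another one.
\<close>

lemma derivation_fourth_power_abelian:
  assumes bil: "bilinear br" and f: "derivation br f"
    and f4: "\<And>x. f (f (f (f x))) = c *\<^sub>R x" and c: "c \<noteq> 0"
  shows "br x y = 0"
proof -
  have lin: "linear f" and der: "\<And>x y. f (br x y) = br (f x) y + br x (f y)"
    using f by (auto simp: derivation_def)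
  note bs = bilinear_lmul[OF bil] bilinear_rmul[OF bil]
  have rel: "c *\<^sub>R br u v + 4 *\<^sub>R br (f u) (f (f (f v))) + 6 *\<^sub>R br (f (f u)) (f (f v))
      + 4 *\<^sub>R br (f (f (f u))) (f v) = 0" for u v
  proof -
    have n: "4 *\<^sub>R v = v + v + v + v" "6 *\<^sub>R v = v + v + v + v + v + v" for v :: 'a
      using scaleR_add_left[of 2 2 v] scaleR_add_left[of 4 2 v] by (simp_all add: scaleR_2 add.assoc)
    have "f (f (f (f (br u v)))) = c *\<^sub>R br u v + (c *\<^sub>R br u v + 4 *\<^sub>R br (f u) (f (f (f v)))
      + 6 *\<^sub>R br (f (f u)) (f (f v)) + 4 *\<^sub>R br (f (f (f u))) (f v))"
      by (simp add: der linear_add[OF lin] f4 bs n del: f4) (simp add: f4 bs add_ac)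
    then show ?thesis unfolding f4 by (simp add: add.assoc)
  qed
  have scale: "v = 0" if "c *\<^sub>R v = 0" for v :: 'a using that c by simp
  let ?a = "c *\<^sub>R br x y" and ?b = "br (f x) (f (f (f y)))" and ?c = "br (f (f x)) (f (f y))"
    and ?d = "br (f (f (f x))) (f y)"
  have "?a = 0"
  proof (rule circulant_relations_trivial[of ?a ?b ?c ?d])
    show "?a + 4 *\<^sub>R ?b + 6 *\<^sub>R ?c + 4 *\<^sub>R ?d = 0" by (rule rel)
    show "4 *\<^sub>R ?a + ?b + 4 *\<^sub>R ?c + 6 *\<^sub>R ?d = 0"
      by (rule scale) (use rel[of "f x" "f (f (f y))"] in
        \<open>simp add: f4 bs linear_scale[OF lin] scaleR_add_right mult_ac add_ac\<close>)
    show "6 *\<^sub>R ?a + 4 *\<^sub>R ?b + ?c + 4 *\<^sub>R ?d = 0"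
      by (rule scale) (use rel[of "f (f x)" "f (f y)"] in
        \<open>simp add: f4 bs linear_scale[OF lin] scaleR_add_right mult_ac add_ac\<close>)
    show "4 *\<^sub>R ?a + 6 *\<^sub>R ?b + 4 *\<^sub>R ?c + ?d = 0"
      by (rule scale) (use rel[of "f (f (f x))" "f y"] in
        \<open>simp add: f4 bs linear_scale[OF lin] scaleR_add_right mult_ac add_ac\<close>)
  qed
  then show ?thesis using c by simp
qed

locale kaehler_plane =
  fixes G :: "'g::real_vector pk_structure"
  assumes pk: "pseudo_kaehler G"
    and dim_G: "dim (UNIV :: 'g set) = 4"

sublocale kaehler_plane \<subseteq> hermitian_plane "metric G" "cplx G"
  by (intro hermitian_plane.intro pseudo_hermitian.intro hermitian_plane_axioms.intro)
    (use pk dim_G in \<open>auto simp: pseudo_kaehler_def\<close>)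

context kaehler_plane
begin

abbreviation cscale_G  (infixr "\<star>" 75) where "cscale_G \<equiv> cscale"

abbreviation "br \<equiv> bracket G"

lemma br_bilinear: "bilinear br" and br_self: "br x x = 0"
  and jacobi: "br x (br y z) + br y (br z x) + br z (br x y) = 0"
  using pk by (auto simp: pseudo_kaehler_def lie_bracket_def)

lemmas br_simps = bilinear_ladd[OF br_bilinear] bilinear_radd[OF br_bilinear]
  bilinear_lmul[OF br_bilinear] bilinear_rmul[OF br_bilinear]
  bilinear_lneg[OF br_bilinear] bilinear_rneg[OF br_bilinear]
  bilinear_lzero[OF br_bilinear] bilinear_rzero[OF br_bilinear]

lemma br_skew: "br x y = - br y x"
  using br_self[of "x + y"] br_self[of x] br_self[of y] by (simp add: br_simps eq_neg_iff_add_eq_0 add.commute)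

text \<open>
  The two classical consequences of \<open>J\<close> being parallel: integrability of \<open>J\<close> and closedness of the
  Kaehler form.
\<close>

lemma nijenhuis: "br (cplx G x) (cplx G y) - br x y = cplx G (br (cplx G x) y + br x (cplx G y))"
proof -
  obtain D where D: "levi_civita G D" and par: "\<And>x y. D x (cplx G y) = cplx G (D x y)"
    using pk by (auto simp: pseudo_kaehler_def)
  have "br x y = D x y - D y x" for x y using D by (simp add: levi_civita_def)
  then show ?thesis by (simp add: par J_simps)
qed

lemma omega_closed:
  "metric G (cplx G (br x y)) z + metric G (cplx G (br y z)) x + metric G (cplx G (br z x)) y = 0"
proof -
  obtain D where D: "levi_civita G D" and par: "\<And>x y. D x (cplx G y) = cplx G (D x y)"
    using pk by (auto simp: pseudo_kaehler_def)
  have br: "br x y = D x y - D y x" for x y using D by (simp add: levi_civita_def)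
  have "metric G (cplx G (D u v)) t = metric G (cplx G (D u t)) v" for u v t
  proof -
    have "metric G (D u v) (cplx G t) + metric G v (D u (cplx G t)) = 0"
      using D by (simp add: levi_civita_def)
    then show ?thesis using g_J[of "D u v" t] g_sym[of v "cplx G (D u t)"] by (simp add: par)
  qed
  from this[of x y z] this[of y z x] this[of z x y] show ?thesis
    by (simp add: br J_simps g_simps)
qed

text \<open>
  Let \<open>Q\<close> be the complex line of \<open>q\<close>, which is both the kernel and the image of \<open>F\<close>. From \<open>F\<^sup>2 = 0\<close> it follows that \<open>Q\<close> is
  an abelian ideal, so the bracket is given by the action of \<open>p\<close> and \<open>\<i> p\<close> on \<open>Q\<close>, as
  real linear maps \<open>c \<mapsto> \<alpha> c + \<gamma> cnj c\<close> and \<open>c \<mapsto> \<beta> c + \<beta>' cnj c\<close>, and by \<open>[p, \<i> p] = w p + v q\<close>. The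
  Leibniz rule for \<open>F\<close> and the Kaehler conditions are linear and express \<open>\<beta>\<close>, \<open>\<beta>'\<close> and \<open>w\<close> by \<open>\<alpha>\<close>
  and \<open>\<gamma>\<close>. The Jacobi identity gives two different values of \<open>2 \<alpha> + \<gamma> + cnj \<gamma>\<close> unless \<open>\<gamma> = 0\<close>.
\<close>

lemma bracket_of_null_derivation:
  assumes pq: "hyperbolic p q"
    and F: "derivation br F"
    and Fpq: "\<And>z w. F (z \<star> p + w \<star> q) = cnj z \<star> q"
  shows "\<exists>\<alpha> v. \<forall>z1 w1 z2 w2. br (z1 \<star> p + w1 \<star> q) (z2 \<star> p + w2 \<star> q)
      = (of_real (Im (cnj z1 * z2)) * v + \<alpha> * (cnj z1 * w2 - cnj z2 * w1)) \<star> q"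
proof -
  have lin: "linear F" and der: "\<And>x y. F (br x y) = br (F x) y + br x (F y)"
    using F by (auto simp: derivation_def)
  have fr: "frame p q" by (rule hyperbolic_frame[OF pq])
  have Fp: "F (z \<star> p) = cnj z \<star> q" and Fq: "F (w \<star> q) = 0" for z w
    using Fpq[of z 0] Fpq[of 0 w] by simp_all
  have FF: "F (F x) = 0" for x
    using frame_expand[OF fr, of x] by (auto simp: Fpq Fq)
  have QQ: "br (w \<star> q) (w' \<star> q) = 0" for w w'
  proof -
    have "0 = F (F (br (cnj w \<star> p) (cnj w' \<star> p)))" by (simp only: FF)
    also have "\<dots> = br (w \<star> q) (w' \<star> q) + br (w \<star> q) (w' \<star> q)"
      by (simp add: der linear_add[OF lin] Fp Fq br_simps)
    finally have "(2::real) *\<^sub>R br (w \<star> q) (w' \<star> q) = 0" by (simp add: scaleR_2)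
    then show ?thesis by simp
  qed
  have VQ: "\<exists>c. br x (w \<star> q) = c \<star> q" for x w
  proof -
    have "\<exists>c. F x = c \<star> q" using frame_expand[OF fr, of x] by (auto simp: Fpq)
    then have F0: "F (br x (w \<star> q)) = 0" by (auto simp: der Fq QQ br_simps)
    obtain z c where e: "br x (w \<star> q) = z \<star> p + c \<star> q" using frame_expand[OF fr] by blast
    have "0 \<star> p + cnj z \<star> q = 0 \<star> p + 0 \<star> q" using F0 unfolding e Fpq by simp
    then have "z = 0" unfolding frame_eq_iff[OF fr] by simp
    then show ?thesis using e by auto
  qed
  obtain A1 A2 B1 B2 where A1: "br p (1 \<star> q) = A1 \<star> q" and A2: "br p (\<i> \<star> q) = A2 \<star> q"
    and B1: "br (\<i> \<star> p) (1 \<star> q) = B1 \<star> q" and B2: "br (\<i> \<star> p) (\<i> \<star> q) = B2 \<star> q"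
    using VQ by metis
  obtain w v where wv: "br p (\<i> \<star> p) = w \<star> p + v \<star> q" using frame_expand[OF fr] by blast
  define \<alpha> \<gamma> \<beta> \<beta>' where defs: "\<alpha> = (A1 - \<i> * A2) / 2" "\<gamma> = (A1 + \<i> * A2) / 2"
    "\<beta> = (B1 - \<i> * B2) / 2" "\<beta>' = (B1 + \<i> * B2) / 2"
  have real_parts: "c \<star> x = Re c *\<^sub>R (1 \<star> x) + Im c *\<^sub>R (\<i> \<star> x)" for c x
    by (simp add: cscale_def)
  have brp: "br p (c \<star> q) = (\<alpha> * c + \<gamma> * cnj c) \<star> q" for c
  proof -
    have "br p (c \<star> q) = (of_real (Re c) * A1 + of_real (Im c) * A2) \<star> q"
      by (subst real_parts[of c], simp only: br_simps A1 A2, simp only: scaleR_cscale, simp only: C.scale_left_distrib)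
    also have "of_real (Re c) * A1 + of_real (Im c) * A2 = \<alpha> * c + \<gamma> * cnj c"
      by (simp add: defs complex_eq_iff field_simps)
    finally show ?thesis .
  qed
  have bri: "br (\<i> \<star> p) (c \<star> q) = (\<beta> * c + \<beta>' * cnj c) \<star> q" for c
  proof -
    have "br (\<i> \<star> p) (c \<star> q) = (of_real (Re c) * B1 + of_real (Im c) * B2) \<star> q"
      by (subst real_parts[of c], simp only: br_simps B1 B2, simp only: scaleR_cscale, simp only: C.scale_left_distrib)
    also have "of_real (Re c) * B1 + of_real (Im c) * B2 = \<beta> * c + \<beta>' * cnj c"
      by (simp add: defs complex_eq_iff field_simps)
    finally show ?thesis .
  qed
  have brzq: "br (z \<star> p) (c \<star> q)
      = (of_real (Re z) * (\<alpha> * c + \<gamma> * cnj c) + of_real (Im z) * (\<beta> * c + \<beta>' * cnj c)) \<star> q" for z c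
    by (subst real_parts[of z], simp only: br_simps C.scale_one brp bri, simp only: scaleR_cscale, simp only: C.scale_left_distrib)
  have qeq: "c = d" if "c \<star> q = d \<star> q" for c d
    using that frame_eq_iff[OF fr, of 0 c 0 d] by simp
  have b': "\<beta>' = \<i> * \<gamma>"
  proof -
    have "(B2 - A1) \<star> q = (\<i> * (B1 + A2)) \<star> q"
      using nijenhuis[of p "1 \<star> q"] A1 A2 B1 B2
      by (simp add: i_scale[symmetric] C.scale_left_diff_distrib C.scale_left_distrib C.scale_right_distrib distrib_left)
    then have "B2 - A1 = \<i> * (B1 + A2)" by (rule qeq)
    then show ?thesis by (simp add: defs field_simps complex_eq_iff)
  qed
  have cw: "cnj w = - (\<beta> + \<beta>') - \<i> * (\<alpha> - \<gamma>)"
  proof -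
    have "F (br p (\<i> \<star> p)) = br (1 \<star> q) (\<i> \<star> p) + br p (cnj \<i> \<star> q)"
      using Fp[of 1] Fp[of \<i>] by (simp add: der)
    moreover have "br (1 \<star> q) (\<i> \<star> p) = (- (\<beta> + \<beta>')) \<star> q"
      using br_skew[of "1 \<star> q" "\<i> \<star> p"] bri[of 1]
      by (simp only: C.scale_minus_left mult_1_right complex_cnj_one)
    ultimately have "cnj w \<star> q = (- (\<beta> + \<beta>') + (\<alpha> * cnj \<i> + \<gamma> * cnj (cnj \<i>))) \<star> q"
      unfolding wv Fpq brp C.scale_left_distrib by simp
    then have "cnj w = - (\<beta> + \<beta>') + (\<alpha> * cnj \<i> + \<gamma> * cnj (cnj \<i>))" by (rule qeq)
    then show ?thesis by (simp add: algebra_simps)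
  qed
  have h: "metric G (a \<star> p + b \<star> q) (c \<star> p + d \<star> q) = Re (a * cnj d + b * cnj c)" for a b c d
    by (simp only: g_herm hyperbolic_herm[OF pq])
  have om: "Re (\<i> * w * cnj c) + Re (\<i> * (\<beta> * c + \<beta>' * cnj c)) - Re (\<alpha> * c + \<gamma> * cnj c) = 0" for c
  proof -
    have 1: "metric G (cplx G (br p (\<i> \<star> p))) (c \<star> q) = Re (\<i> * w * cnj c)"
      using h[of "\<i> * w" "\<i> * v" 0 c] unfolding wv J_simps(1) J_cscale by simp
    have 2: "metric G (cplx G (br (\<i> \<star> p) (c \<star> q))) p = Re (\<i> * (\<beta> * c + \<beta>' * cnj c))"
      using h[of 0 "\<i> * (\<beta> * c + \<beta>' * cnj c)" 1 0] unfolding bri J_cscale by simp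
    have 3: "metric G (cplx G (br (c \<star> q) p)) (\<i> \<star> p) = - Re (\<alpha> * c + \<gamma> * cnj c)"
      using h[of 0 "\<i> * - (\<alpha> * c + \<gamma> * cnj c)" \<i> 0]
      unfolding br_skew[of "c \<star> q" p] brp C.scale_minus_left[symmetric] J_cscale by simp
    show ?thesis using omega_closed[of p "\<i> \<star> p" "c \<star> q"] unfolding 1 2 3 by simp
  qed
  have w: "w = - \<i> * \<gamma>" and b: "\<beta> = - \<i> * (\<alpha> + cnj \<gamma>)"
    using cw om[of 1] om[of \<i>] unfolding b' by (simp_all add: complex_eq_iff)
  \<comment> \<open>A name for one half keeps the Jacobi identities free of divisions.\<close>
  define hf :: complex where "hf = 1 / 2"
  have Rw: "of_real (Re w) = - \<i> * hf * (\<gamma> - cnj \<gamma>)" and Iw: "of_real (Im w) = - hf * (\<gamma> + cnj \<gamma>)"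
    by (simp_all add: w hf_def complex_eq_iff)
  have jac: "\<alpha> * (\<beta> * c + \<beta>' * cnj c) + \<gamma> * cnj (\<beta> * c + \<beta>' * cnj c)
      - \<beta> * (\<alpha> * c + \<gamma> * cnj c) - \<beta>' * cnj (\<alpha> * c + \<gamma> * cnj c)
      - (- \<i> * hf * (\<gamma> - cnj \<gamma>) * (\<alpha> * c + \<gamma> * cnj c)
          + - hf * (\<gamma> + cnj \<gamma>) * (\<beta> * c + \<beta>' * cnj c)) = 0" (is "?lhs = 0") for c
  proof -
    let ?e = "\<alpha> * c + \<gamma> * cnj c" and ?f = "\<beta> * c + \<beta>' * cnj c"
    let ?r = "- \<i> * hf * (\<gamma> - cnj \<gamma>) * ?e + - hf * (\<gamma> + cnj \<gamma>) * ?f"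
    have 1: "br p (br (\<i> \<star> p) (c \<star> q)) = (\<alpha> * ?f + \<gamma> * cnj ?f) \<star> q"
      unfolding bri brp ..
    have "br (c \<star> q) p = (- ?e) \<star> q"
      unfolding br_skew[of "c \<star> q" p] brp C.scale_minus_left ..
    then have 2: "br (\<i> \<star> p) (br (c \<star> q) p) = (\<beta> * (- ?e) + \<beta>' * cnj (- ?e)) \<star> q"
      by (simp only: bri)
    have 3: "br (c \<star> q) (br p (\<i> \<star> p)) = (- ?r) \<star> q"
      unfolding br_skew[of "c \<star> q" "br p (\<i> \<star> p)"] unfolding wv br_simps brzq QQ Rw Iw C.scale_minus_left by simp
    have "(\<alpha> * ?f + \<gamma> * cnj ?f + (\<beta> * (- ?e) + \<beta>' * cnj (- ?e)) + - ?r) \<star> q = 0 \<star> q"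
      using jacobi[of p "\<i> \<star> p" "c \<star> q"] unfolding 1 2 3 C.scale_left_distrib[symmetric] by simp
    from qeq[OF this] show ?thesis by (simp add: algebra_simps)
  qed
  define \<gamma>' \<alpha>' where conj: "\<gamma>' = cnj \<gamma>" "\<alpha>' = cnj \<alpha>"
  have ih: "\<i> * \<i> = -1" "2 * hf = 1" by (simp_all add: hf_def)
  have cnj': "cnj \<gamma>' = \<gamma>" "cnj \<alpha>' = \<alpha>" by (simp_all add: conj)
  note cnjs = cnj' complex_cnj_add complex_cnj_mult complex_cnj_minus complex_cnj_cnj complex_cnj_i complex_cnj_one
    conj[symmetric]
  note jac' = jac[unfolded b b' cnjs]
  \<comment> \<open>The antilinear and the linear part in \<open>c\<close> of the Jacobi identity.\<close>
  have anti: "\<gamma> * (\<gamma> + \<gamma>' + 2 * \<alpha> + \<gamma>) = 0"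
    using jac'[of 1] jac'[of \<i>] ih unfolding cnjs by algebra
  have lin': "\<gamma>' * (2 * \<alpha> + \<gamma> + \<gamma>' + 4 * \<gamma>) = 0"
    using jac'[of 1] jac'[of \<i>] ih unfolding cnjs by algebra
  have "\<gamma> = 0"
  proof (rule ccontr)
    assume "\<gamma> \<noteq> 0"
    then have "\<gamma> + \<gamma>' + 2 * \<alpha> + \<gamma> = 0" "2 * \<alpha> + \<gamma> + \<gamma>' + 4 * \<gamma> = 0"
      using anti lin' by (auto simp: conj)
    then have "3 * \<gamma> = 0" by algebra
    then show False using \<open>\<gamma> \<noteq> 0\<close> by simp
  qed
  then have w0: "w = 0" and b0: "\<beta>' = 0" "\<beta> = - \<i> * \<alpha>" using w b b' by simp_all
  have zq: "br (z \<star> p) (c \<star> q) = (cnj z * \<alpha> * c) \<star> q" for z c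
  proof -
    have "cnj z = of_real (Re z) - \<i> * of_real (Im z)" by (simp add: complex_eq_iff)
    then have "of_real (Re z) * (\<alpha> * c + 0 * cnj c) + of_real (Im z) * (- \<i> * \<alpha> * c + 0 * cnj c)
        = cnj z * \<alpha> * c" by algebra
    then show ?thesis unfolding brzq b0 \<open>\<gamma> = 0\<close> by (simp only:)
  qed
  have pp: "br (z \<star> p) (z' \<star> p) = (of_real (Im (cnj z * z')) * v) \<star> q" for z z'
  proof -
    have 1: "br (\<i> \<star> p) p = (- v) \<star> q" "br p (\<i> \<star> p) = v \<star> q"
      using br_skew[of "\<i> \<star> p" p] wv w0 by simp_all
    have "br (z \<star> p) (z' \<star> p) = (of_real (Im z') * (of_real (Re z) * v)
        + of_real (Re z') * (of_real (Im z) * - v)) \<star> q"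
      by (subst real_parts[of z], subst real_parts[of z'],
          simp only: br_simps C.scale_one br_self scaleR_zero_right add_0_left add_0_right 1,
          simp only: scaleR_cscale C.scale_left_distrib)
        (simp only: mult.left_commute add.commute)
    moreover have "of_real (Im z') * (of_real (Re z) * v) + of_real (Re z') * (of_real (Im z) * - v)
        = of_real (Im (cnj z * z')) * v" by (simp add: algebra_simps)
    ultimately show ?thesis by (simp only:)
  qed
  have qz: "br (c \<star> q) (z \<star> p) = (- (cnj z * \<alpha> * c)) \<star> q" for z c
    unfolding br_skew[of "c \<star> q" "z \<star> p"] zq C.scale_minus_left ..
  have "br (z1 \<star> p + w1 \<star> q) (z2 \<star> p + w2 \<star> q)
      = (of_real (Im (cnj z1 * z2)) * v + \<alpha> * (cnj z1 * w2 - cnj z2 * w1)) \<star> q" for z1 w1 z2 w2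
  proof -
    have "br (z1 \<star> p + w1 \<star> q) (z2 \<star> p + w2 \<star> q)
        = (of_real (Im (cnj z1 * z2)) * v + cnj z1 * \<alpha> * w2 + - (cnj z2 * \<alpha> * w1)) \<star> q"
      unfolding br_simps pp zq qz QQ C.scale_left_distrib by simp
    then show ?thesis by (simp add: algebra_simps)
  qed
  then show ?thesis by blast
qed

end

section \<open>Transport of extensions\<close>

lemma sym_part_form:
  fixes g :: "'v::real_vector \<Rightarrow> 'v \<Rightarrow> real"
  assumes fin: "\<exists>B. finite B \<and> span B = (UNIV :: 'v set)" and g: "pseudo_riemannian g" and f: "linear f"
  shows "g (sym_part g f x) y = (g (f x) y + g (f y) x) / 2"
    and "g (antisym_part g f x) y = (g (f x) y - g (f y) x) / 2"
proof -
  have b: "bilinear g" and s: "\<And>u v. g u v = g v u" using g by (auto simp: pseudo_riemannian_def)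
  have "g (g_adjoint g f x) y = g (f y) x"
    using g_adjoint[OF fin g f, of y x] s by simp
  then show "g (sym_part g f x) y = (g (f x) y + g (f y) x) / 2"
    "g (antisym_part g f x) y = (g (f x) y - g (f y) x) / 2"
    by (simp_all add: sym_part_def antisym_part_def bilinear_ladd[OF b] bilinear_lmul[OF b]
        bilinear_lsub[OF b] field_simps)
qed

lemma pseudo_riemannian_eqI:
  assumes "pseudo_riemannian g" "\<And>z. g x z = g y z" shows "x = y"
proof -
  have b: "bilinear g" using assms by (simp add: pseudo_riemannian_def)
  have "\<forall>z. g (x - y) z = 0" using assms(2) by (simp add: bilinear_lsub[OF b])
  then have "x - y = 0" using assms(1) unfolding pseudo_riemannian_def by blast
  then show ?thesis by simp
qed

lemma pk_isomorphism_inv: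
  assumes "pk_isomorphism L L' f" shows "pk_isomorphism L' L (inv f)"
proof -
  have lin: "linear f" and bij: "bij f" and
    f: "\<And>x y. f (bracket L x y) = bracket L' (f x) (f y)"
      "\<And>x y. metric L' (f x) (f y) = metric L x y" "\<And>x. f (cplx L x) = cplx L' (f x)"
    using assms by (auto simp: pk_isomorphism_def)
  have fi: "f (inv f x) = x" for x using bij by (simp add: bij_is_surj surj_f_inv_f)
  have if': "inv f (f x) = x" for x using bij by (simp add: bij_is_inj inv_f_f)
  have "linear (inv f)"
    by (rule linearI) (metis fi if' linear_add[OF lin], metis fi if' linear_scale[OF lin])
  moreover have "bij (inv f)" using bij by (rule bij_imp_bij_inv)
  moreover have "inv f (bracket L' x y) = bracket L (inv f x) (inv f y)" for x y
    using f(1)[of "inv f x" "inv f y"] unfolding fi by (metis if')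
  moreover have "metric L (inv f x) (inv f y) = metric L' x y" for x y
    using f(2)[of "inv f x" "inv f y"] unfolding fi by simp
  moreover have "inv f (cplx L' x) = cplx L (inv f x)" for x
    using f(3)[of "inv f x"] unfolding fi by (metis if')
  ultimately show ?thesis by (simp add: pk_isomorphism_def)
qed

lemma pseudo_kaehler_transport:
  fixes L :: "'v::real_vector pk_structure" and L' :: "'w::real_vector pk_structure"
  assumes iso: "pk_isomorphism L' L f" and L: "pseudo_kaehler L"
  shows "pseudo_kaehler L'"
proof -
  let ?k = "inv f"
  have lin: "linear f" and bij: "bij f" and
    f: "\<And>x y. f (bracket L' x y) = bracket L (f x) (f y)"
      "\<And>x y. metric L (f x) (f y) = metric L' x y" "\<And>x. f (cplx L' x) = cplx L (f x)"
    using iso by (auto simp: pk_isomorphism_def)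
  have linK: "linear ?k" using pk_isomorphism_inv[OF iso] by (simp add: pk_isomorphism_def)
  have fi: "f (?k x) = x" for x using bij by (simp add: bij_is_surj surj_f_inv_f)
  have if': "?k (f x) = x" for x using bij by (simp add: bij_is_inj inv_f_f)
  have eqI: "x = y" if "f x = f y" for x y using that if' by metis
  have f0: "f x = 0 \<longleftrightarrow> x = 0" for x using eqI[of x 0] linear_0[OF lin] by auto
  note fl = linear_add[OF lin] linear_scale[OF lin] linear_diff[OF lin] linear_neg[OF lin] linear_0[OF lin]
  obtain B :: "'v set" where B: "finite B" "span B = UNIV" using L by (auto simp: pseudo_kaehler_def)
  have "span (?k ` B) = ?k ` span B" by (rule linear_span_image[OF linK])
  then have fin: "finite (?k ` B)" "span (?k ` B) = UNIV"
    using B bij_imp_bij_inv[OF bij] by (simp_all add: bij_is_surj)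
  have lb: "bilinear (bracket L)" and lj: "\<And>x. bracket L x x = 0"
      "\<And>x y z. bracket L x (bracket L y z) + bracket L y (bracket L z x) + bracket L z (bracket L x y) = 0"
    using L by (auto simp: pseudo_kaehler_def lie_bracket_def)
  have mb: "bilinear (metric L)" and ms: "\<And>x y. metric L x y = metric L y x"
    and mn: "\<And>x. \<forall>y. metric L x y = 0 \<Longrightarrow> x = 0"
    using L by (auto simp: pseudo_kaehler_def pseudo_riemannian_def)
  have J: "linear (cplx L)" "\<And>x. cplx L (cplx L x) = - x"
    "\<And>x y. metric L (cplx L x) (cplx L y) = metric L x y"
    using L by (auto simp: pseudo_kaehler_def)
  obtain D where D: "bilinear D" "\<And>x y. D x y - D y x = bracket L x y"
    "\<And>x y z. metric L (D x y) z + metric L y (D x z) = 0" "\<And>x y. D x (cplx L y) = cplx L (D x y)"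
    using L by (auto simp: pseudo_kaehler_def levi_civita_def)
  note bs = bilinear_ladd[OF lb] bilinear_radd[OF lb] bilinear_lmul[OF lb] bilinear_rmul[OF lb]
  note gs = bilinear_ladd[OF mb] bilinear_radd[OF mb] bilinear_lmul[OF mb] bilinear_rmul[OF mb]
  note Ds = bilinear_ladd[OF D(1)] bilinear_radd[OF D(1)] bilinear_lmul[OF D(1)] bilinear_rmul[OF D(1)]
  have "bilinear (bracket L')"
    unfolding bilinear_def by (auto intro!: linearI eqI simp: f fl bs)
  moreover have "bracket L' x x = 0" for x using f0 by (metis f(1) lj(1))
  moreover have "bracket L' x (bracket L' y z) + bracket L' y (bracket L' z x) + bracket L' z (bracket L' x y) = 0"
    for x y z by (rule eqI) (simp add: f fl lj)
  moreover have "bilinear (metric L')"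
    unfolding bilinear_def by (auto intro!: linearI simp: f(2)[symmetric] fl gs)
  moreover have "metric L' x y = metric L' y x" for x y using ms by (simp flip: f(2))
  moreover have "x = 0" if "\<forall>y. metric L' x y = 0" for x
  proof -
    have "metric L (f x) y = 0" for y using that f(2)[of x "?k y"] fi by simp
    then show ?thesis using mn f0 by blast
  qed
  moreover have "linear (cplx L')"
    by (rule linearI; rule eqI) (simp_all add: f fl linear_add[OF J(1)] linear_scale[OF J(1)])
  moreover have "cplx L' (cplx L' x) = - x" for x by (rule eqI) (simp add: f fl J)
  moreover have "metric L' (cplx L' x) (cplx L' y) = metric L' x y" for x y
    by (simp add: f(2)[symmetric] f(3) J(3))
  moreover have "levi_civita L' (\<lambda>x y. ?k (D (f x) (f y)))"
    unfolding levi_civita_def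
  proof (intro conjI allI)
    show "bilinear (\<lambda>x y. ?k (D (f x) (f y)))"
      unfolding bilinear_def by (auto intro!: linearI eqI simp: fl fi Ds)
    show "?k (D (f x) (f y)) - ?k (D (f y) (f x)) = bracket L' x y" for x y
      by (rule eqI) (simp add: fl fi f D)
    show "metric L' (?k (D (f x) (f y))) z + metric L' y (?k (D (f x) (f z))) = 0" for x y z
      by (simp add: f(2)[symmetric] fi D(3))
  qed
  moreover have "?k (D (f x) (f (cplx L' y))) = cplx L' (?k (D (f x) (f y)))" for x y
    by (rule eqI) (simp add: fi f D(4))
  ultimately show ?thesis
    unfolding pseudo_kaehler_def lie_bracket_def pseudo_riemannian_def using fin by blast
qed

lemma sym_part_transport:
  fixes g :: "'v::real_vector \<Rightarrow> 'v \<Rightarrow> real" and g' :: "'w::real_vector \<Rightarrow> 'w \<Rightarrow> real"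
  assumes fin: "\<exists>B. finite B \<and> span B = (UNIV :: 'v set)" and g: "pseudo_riemannian g" and f: "linear f"
    and fin': "\<exists>B. finite B \<and> span B = (UNIV :: 'w set)" and g': "pseudo_riemannian g'" and f': "linear f'"
    and F: "surj F" and iso: "\<And>x y. g (F x) (F y) = g' x y" and eq: "\<And>x. F (f' x) = f (F x)"
  shows "F (sym_part g' f' x) = sym_part g f (F x)" "F (antisym_part g' f' x) = antisym_part g f (F x)"
proof -
  have *: "u = v" if "\<And>z. g u (F z) = g v (F z)" for u v
    using pseudo_riemannian_eqI[OF g] that F by (metis surjD)
  show "F (sym_part g' f' x) = sym_part g f (F x)" "F (antisym_part g' f' x) = antisym_part g f (F x)"
    by (rule *, simp add: iso sym_part_form[OF fin g f] sym_part_form[OF fin' g' f'] eq[symmetric])+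
qed

text \<open>
  The Levi-Civita connection and the symmetric and antisymmetric parts are determined by the metric,
  so an isometric isomorphism carries them over.
\<close>

lemma pk_extension_transport:
  fixes G :: "'g::real_vector pk_structure" and H :: "'h::real_vector pk_structure"
    and G' :: "'k::real_vector pk_structure" and H' :: "'l::real_vector pk_structure"
  assumes ext: "pk_extension G H \<phi>" and F: "pk_isomorphism G' G F" and R: "pk_isomorphism H' H R"
    and eq: "\<And>A x. F (\<phi>' A x) = \<phi> (R A) (F x)"
  shows "pk_extension G' H' \<phi>'"
proof -
  have G: "pseudo_kaehler G" and H: "pseudo_kaehler H" using ext by (auto simp: pk_extension_def)
  have G': "pseudo_kaehler G'" by (rule pseudo_kaehler_transport[OF F G])
  have H': "pseudo_kaehler H'" by (rule pseudo_kaehler_transport[OF R H])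
  have linF: "linear F" and bij: "bij F" and
    f: "\<And>x y. F (bracket G' x y) = bracket G (F x) (F y)"
      "\<And>x y. metric G (F x) (F y) = metric G' x y" "\<And>x. F (cplx G' x) = cplx G (F x)"
    using F by (auto simp: pk_isomorphism_def)
  have linR: "linear R" and
    r: "\<And>x y. R (bracket H' x y) = bracket H (R x) (R y)" "\<And>x. R (cplx H' x) = cplx H (R x)"
    using R by (auto simp: pk_isomorphism_def)
  have inj: "x = y" if "F x = F y" for x y using that bij by (simp add: bij_def inj_eq)
  note fl = linear_add[OF linF] linear_scale[OF linF] linear_diff[OF linF]
  note rl = linear_add[OF linR] linear_scale[OF linR]
  have lin: "linear (\<phi> A)" and der: "\<And>x y. \<phi> A (bracket G x y) = bracket G (\<phi> A x) y + bracket G x (\<phi> A y)"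
    and linA: "linear (\<lambda>A. \<phi> A x)"
    and com: "\<phi> (bracket H A B) x = endo_commutator (\<phi> A) (\<phi> B) x"
    and s: "\<And>x. cplx G (sym_part (metric G) (\<phi> A) x) = sym_part (metric G) (\<phi> (cplx H A)) x"
    and a: "\<And>x. cplx G (antisym_part (metric G) (\<phi> A) x) = antisym_part (metric G) (\<phi> A) (cplx G x)"
    for A B x using ext by (auto simp: pk_extension_def lie_action_def derivation_def fun_eq_iff)
  have lin': "linear (\<phi>' A)" for A
    by (rule linearI; rule inj) (simp_all add: eq fl linear_add[OF lin] linear_scale[OF lin])
  have "linear (\<lambda>A. \<phi>' A x)" for x
    by (rule linearI; rule inj) (simp_all add: eq fl rl linear_add[OF linA] linear_scale[OF linA])
  moreover have "derivation (bracket G') (\<phi>' A)" for A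
    unfolding derivation_def using lin' by (auto intro!: inj simp: eq fl f der)
  moreover have "\<phi>' (bracket H' A B) = endo_commutator (\<phi>' A) (\<phi>' B)" for A B
    by (rule HOL.ext, rule inj) (simp add: endo_commutator_def fl eq r com)
  ultimately have act: "lie_action (bracket G') (bracket H') \<phi>'" by (simp add: lie_action_def)
  have fin: "\<exists>B. finite B \<and> span B = (UNIV :: 'g set)" and g: "pseudo_riemannian (metric G)"
    using G by (auto simp: pseudo_kaehler_def)
  have fin': "\<exists>B. finite B \<and> span B = (UNIV :: 'k set)" and g': "pseudo_riemannian (metric G')"
    using G' by (auto simp: pseudo_kaehler_def)
  have tr: "F (sym_part (metric G') (\<phi>' A) x) = sym_part (metric G) (\<phi> (R A)) (F x)"
    "F (antisym_part (metric G') (\<phi>' A) x) = antisym_part (metric G) (\<phi> (R A)) (F x)" for A x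
    by (rule sym_part_transport[where F = F and f = "\<phi> (R A)" and f' = "\<phi>' A"];
        use fin g lin fin' g' lin' bij_is_surj[OF bij] f(2) eq in blast)+
  have "cplx G' \<circ> sym_part (metric G') (\<phi>' A) = sym_part (metric G') (\<phi>' (cplx H' A))" for A
    by (rule HOL.ext, rule inj) (simp add: f tr s r)
  moreover have "cplx G' \<circ> antisym_part (metric G') (\<phi>' A) = antisym_part (metric G') (\<phi>' A) \<circ> cplx G'" for A
    by (rule HOL.ext, rule inj) (simp add: f tr a)
  ultimately show ?thesis using G' H' act by (simp add: pk_extension_def)
qed

text \<open>
  AW-relatedness in two steps: \<open>\<phi>\<close> is first changed into an action \<open>\<psi>\<close> on the same algebra with the
  same symmetric part that commutes with \<open>\<phi>\<close>, and \<open>\<psi>\<close> is then moved to another model. Note that \<open>F\<close>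
  and \<open>R\<close> point from the model to the given extension, which is the convenient direction for
  coordinates.
\<close>

lemma aw_relatedI:
  fixes G :: "'g::real_vector pk_structure" and H :: "'h::real_vector pk_structure"
    and G' :: "'k::real_vector pk_structure" and H' :: "'l::real_vector pk_structure"
  assumes ext: "pk_extension G H \<phi>" and ext0: "pk_extension G H \<psi>"
    and sym: "\<And>A. sym_part (metric G) (\<psi> A) = sym_part (metric G) (\<phi> A)"
    and com: "\<And>A B x. \<phi> A (\<psi> B x) = \<psi> B (\<phi> A x)"
    and F: "pk_isomorphism G' G F" and R: "pk_isomorphism H' H R"
    and eq: "\<And>A x. F (\<phi>' A x) = \<psi> (R A) (F x)"
  shows "aw_related G H \<phi> G' H' \<phi>'"
proof -
  have ext': "pk_extension G' H' \<phi>'" by (rule pk_extension_transport[where F = F and R = R and \<phi> = \<psi>, OF ext0 F R]) (rule eq)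
  have iF: "pk_isomorphism G G' (inv F)" and iR: "pk_isomorphism H H' (inv R)"
    using F R by (auto intro: pk_isomorphism_inv)
  have bij: "bij F" and linI: "linear (inv F)" and linF: "linear F"
    using F iF by (auto simp: pk_isomorphism_def)
  have fi: "F (inv F x) = x" and if': "inv F (F y) = y" for x y
    using bij_is_surj[OF bij] bij_is_inj[OF bij] by (simp_all add: surj_f_inv_f inv_f_f)
  have "metric G (F x) (F y) = metric G' x y" for x y using F by (simp add: pk_isomorphism_def)
  then have met: "metric G' (inv F x) y = metric G x (F y)" for x y using fi by metis
  have ri: "R (inv R x) = x" for x
    using R bij_is_surj[of R] surj_f_inv_f[of R x] by (simp add: pk_isomorphism_def)
  have phi': "\<phi>' A x = inv F (\<psi> (R A) (F x))" for A x
    using if' by (metis eq)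
  have ii: "inv (inv F) = F" using bij by (rule inv_inv_eq)
  have lin: "linear (\<phi> A)" "linear (\<psi> A)" for A
    using ext ext0 by (auto simp: pk_extension_def lie_action_def derivation_def)
  have fin: "\<exists>B. finite B \<and> span B = (UNIV :: 'g set)" and g: "pseudo_riemannian (metric G)"
    using ext by (auto simp: pk_extension_def pseudo_kaehler_def)
  have fin': "\<exists>B. finite B \<and> span B = (UNIV :: 'k set)" and g': "pseudo_riemannian (metric G')"
    using ext' by (auto simp: pk_extension_def pseudo_kaehler_def)
  have gb: "bilinear (metric G)" "bilinear (metric G')" using g g' by (auto simp: pseudo_riemannian_def)
  have symeq: "metric G (\<phi> A x) y + metric G (\<phi> A y) x = metric G (\<psi> A x) y + metric G (\<psi> A y) x" for A x y
    using arg_cong[OF sym[of A], of "\<lambda>f. metric G (f x) y"]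
    by (simp add: sym_part_form[OF fin g lin(1)] sym_part_form[OF fin g lin(2)])
  have "sym_part (metric G') (\<lambda>x. (inv F \<circ> \<phi> A \<circ> inv (inv F)) x - \<phi>' (inv R A) x) = (\<lambda>x. 0)" for A
  proof (rule HOL.ext, rule pseudo_riemannian_eqI[OF g'])
    fix x z
    let ?f = "\<lambda>x. inv F (\<phi> A (F x)) - inv F (\<psi> A (F x))"
    have "linear ?f"
      by (intro linear_compose_sub linear_compose[OF linF, unfolded o_def] linear_compose[OF _ linI, unfolded o_def] lin)
    from sym_part_form(1)[OF fin' g' this, of x z]
    show "metric G' (sym_part (metric G') (\<lambda>x. (inv F \<circ> \<phi> A \<circ> inv (inv F)) x - \<phi>' (inv R A) x) x) z = metric G' 0 z"
      using symeq[of A "F x" "F z"]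
      by (simp add: ii phi' ri bilinear_lsub[OF gb(2)] bilinear_lzero[OF gb(2)] met)
  qed
  moreover have "endo_commutator (inv F \<circ> \<phi> A \<circ> inv (inv F)) (\<phi>' A') = (\<lambda>x. 0)" for A A'
    by (rule HOL.ext) (simp add: endo_commutator_def ii phi' fi com)
  ultimately show ?thesis
    unfolding aw_related_def using ext ext' iF iR by blast
qed

section \<open>Extensions by the flat plane\<close>

definition turn :: "complex \<Rightarrow> real^2 \<Rightarrow> real^2" where
  "turn \<zeta> A = vector [Re (\<zeta> * Complex (A$1) (A$2)), Im (\<zeta> * Complex (A$1) (A$2))]"

lemma turn_turn: "turn \<zeta> (turn \<xi> A) = turn (\<zeta> * \<xi>) A"
  by (simp add: turn_def vec_eq_iff forall_2 algebra_simps)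

lemma turn_one: "turn 1 A = A"
  by (simp add: turn_def vec_eq_iff forall_2)

lemma turn_isomorphism:
  assumes "cmod \<zeta> = 1" shows "pk_isomorphism flat_plane flat_plane (turn \<zeta>)"
proof -
  have 1: "\<zeta> * cnj \<zeta> = 1" "cnj \<zeta> * \<zeta> = 1"
    using complex_norm_square[of \<zeta>] assms by (simp_all add: mult.commute)
  then have r: "Re \<zeta> * Re \<zeta> + Im \<zeta> * Im \<zeta> = 1" by (simp add: complex_eq_iff)
  have "linear (turn \<zeta>)"
    by (rule linearI) (simp_all add: turn_def vec_eq_iff forall_2 algebra_simps)
  moreover have "bij (turn \<zeta>)"
    by (rule o_bij[of "turn (cnj \<zeta>)"]) (simp_all add: fun_eq_iff turn_turn 1 turn_one)
  moreover have "metric flat_plane (turn \<zeta> A) (turn \<zeta> B) = metric flat_plane A B" for A B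
  proof -
    have "metric flat_plane (turn \<zeta> A) (turn \<zeta> B)
        = (Re \<zeta> * Re \<zeta> + Im \<zeta> * Im \<zeta>) * (A$1 * B$1 + A$2 * B$2)"
      by (simp add: turn_def flat_plane_def algebra_simps)
    then show ?thesis unfolding r by (simp add: flat_plane_def)
  qed
  ultimately show ?thesis
    by (simp add: pk_isomorphism_def) (simp add: flat_plane_def turn_def vec_eq_iff forall_2 algebra_simps)
qed

locale flat_extension = kaehler_plane G for G :: "'g::real_vector pk_structure" +
  fixes \<phi> :: "real^2 \<Rightarrow> 'g \<Rightarrow> 'g"
  assumes ext: "pk_extension G flat_plane \<phi>"
begin

definition act :: "complex \<Rightarrow> 'g \<Rightarrow> 'g" where "act a = \<phi> (vector [Re a, Im a])"

lemma phi_turn: "\<phi> (turn \<zeta> A) = act (\<zeta> * Complex (A$1) (A$2))"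
  by (simp add: act_def turn_def)

lemma phi_act: "\<phi> A = act (Complex (A$1) (A$2))"
  using phi_turn[of 1 A] by (simp add: turn_one)

abbreviation "sp a \<equiv> sym_part (metric G) (act a)"
abbreviation "ap a \<equiv> antisym_part (metric G) (act a)"

lemma fin: "\<exists>B. finite B \<and> span B = (UNIV :: 'g set)"
  using pk by (simp add: pseudo_kaehler_def)

lemma act_derivation: "derivation br (act a)"
  using ext by (simp add: pk_extension_def lie_action_def act_def)

lemma act_linear: "linear (act a)"
  using act_derivation by (simp add: derivation_def)

lemmas sp_form = sym_part_form(1)[OF fin g act_linear] and ap_form = sym_part_form(2)[OF fin g act_linear]

lemma act_left: "act a x = Re a *\<^sub>R act 1 x + Im a *\<^sub>R act \<i> x"
proof -
  have l: "linear (\<lambda>A. \<phi> A x)" using ext by (simp add: pk_extension_def lie_action_def)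
  have "vector [Re a, Im a] = Re a *\<^sub>R (vector [1, 0] :: real^2) + Im a *\<^sub>R vector [0, 1]"
    by (simp add: vec_eq_iff forall_2)
  then show ?thesis by (simp add: act_def linear_add[OF l] linear_scale[OF l])
qed

lemma act_commute: "act a (act b x) = act b (act a x)"
proof -
  have l: "linear (\<lambda>A. \<phi> A x)" for x using ext by (simp add: pk_extension_def lie_action_def)
  have "\<phi> (bracket flat_plane A B) x = endo_commutator (\<phi> A) (\<phi> B) x" for A B
    using ext by (simp add: pk_extension_def lie_action_def)
  then show ?thesis
    using linear_0[OF l] by (simp add: act_def flat_plane_def endo_commutator_def)
qed

lemma sp_cplx: "cplx G (sp 1 x) = sp \<i> x" and ap_cplx: "cplx G (ap a x) = ap a (cplx G x)"
proof -
  have 1: "cplx G (sym_part (metric G) (\<phi> A) x) = sym_part (metric G) (\<phi> (cplx flat_plane A)) x"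
    and 2: "cplx G (antisym_part (metric G) (\<phi> A) x) = antisym_part (metric G) (\<phi> A) (cplx G x)" for A x
    using ext by (auto simp: pk_extension_def fun_eq_iff)
  show "cplx G (sp 1 x) = sp \<i> x"
    using 1[of "vector [1, 0]" x] by (simp add: act_def flat_plane_def)
  show "cplx G (ap a x) = ap a (cplx G x)" by (simp add: act_def 2)
qed

lemma act_split: "act a x = sp a x + ap a x"
  by (rule g_eqI) (simp add: g_simps sp_form ap_form field_simps)

lemma sp_add: "sp a (x + y) = sp a x + sp a y" and sp_scaleR: "sp a (r *\<^sub>R x) = r *\<^sub>R sp a x"
  and ap_add: "ap a (x + y) = ap a x + ap a y" and ap_scaleR: "ap a (r *\<^sub>R x) = r *\<^sub>R ap a x"
  by (rule g_eqI, simp add: g_simps sp_form ap_form linear_add[OF act_linear] linear_scale[OF act_linear]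
      field_simps)+

lemma sp_sym: "metric G (sp a x) y = metric G (sp a y) x"
  and ap_skew: "metric G (ap a x) y = - metric G (ap a y) x"
  by (simp_all add: sp_form ap_form add.commute minus_divide_left)

lemma sp_left: "sp a x = Re a *\<^sub>R sp 1 x + Im a *\<^sub>R sp \<i> x"
  by (rule g_eqI) (simp add: g_simps sp_form act_left[of a] field_simps)

definition "S = sp 1"
definition "X x = ap \<i> x - cplx G (ap 1 x)"
definition "Y x = - ap \<i> x - cplx G (ap 1 x)"

lemma sp_S: "sp a x = a \<star> S x"
  by (simp add: S_def sp_left[of a] sp_cplx[symmetric] cscale_def)

text \<open>
  Both \<open>S\<close> and \<open>J S\<close>, which is the symmetric part of \<open>\<phi>(\<i>)\<close>, are symmetric, while \<open>J\<close> is
  antisymmetric; this forces \<open>S\<close> to anticommute with \<open>J\<close>.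
\<close>

lemma S_J: "S (cplx G x) = - cplx G (S x)"
proof (rule g_eqI)
  fix z
  have "metric G (S (cplx G x)) z = metric G (S z) (cplx G x)" by (simp add: S_def sp_sym[of 1 z])
  also have "\<dots> = - metric G (sp \<i> z) x"
    using g_J[of "S z" x] by (simp add: S_def sp_cplx)
  also have "\<dots> = metric G (- cplx G (S x)) z"
    by (simp add: sp_sym[of \<i> z] S_def sp_cplx g_simps)
  finally show "metric G (S (cplx G x)) z = metric G (- cplx G (S x)) z" .
qed

lemma S_plus: "S (x + y) = S x + S y" and S_minus: "S (- x) = - S x" and S_sub: "S (x - y) = S x - S y"
  using sp_add[of 1 x y] sp_scaleR[of 1 "- 1" x] sp_add[of 1 x "- y"] sp_scaleR[of 1 "- 1" y]
  by (simp_all add: S_def)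

lemma ap_minus: "ap a (- x) = - ap a x" and ap_sub: "ap a (x - y) = ap a x - ap a y"
  using ap_scaleR[of a "- 1" x] ap_add[of a x "- y"] ap_scaleR[of a "- 1" y] by simp_all

text \<open>
  In the commutator of \<open>\<phi>(1) = S + T\<close> and \<open>\<phi>(\<i>) = J S + T'\<close> the part \<open>L\<close> commutes with \<open>J\<close> and the part
  \<open>A\<close> anticommutes with it. So both vanish.
\<close>

lemma commutator_parts:
  "ap \<i> (S x) - S (ap \<i> x) = cplx G (ap 1 (S x)) - cplx G (S (ap 1 x))"
  "ap 1 (ap \<i> x) - ap \<i> (ap 1 x) = 2 *\<^sub>R cplx G (S (S x))"
proof -
  define L where "L x = ap 1 (ap \<i> x) - ap \<i> (ap 1 x) - 2 *\<^sub>R cplx G (S (S x))" for x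
  define A where "A x = S (ap \<i> x) + cplx G (ap 1 (S x)) - cplx G (S (ap 1 x)) - ap \<i> (S x)" for x
  note rules = S_plus S_sub S_minus ap_add ap_minus ap_sub S_J ap_cplx[symmetric] J_simps scaleR_2
  have LA: "L x + A x = 0" for x
  proof -
    have "act 1 (act \<i> x) - act \<i> (act 1 x) = 0" by (simp add: act_commute)
    moreover have "act 1 y = S y + ap 1 y" "act \<i> y = cplx G (S y) + ap \<i> y" for y
      by (simp_all add: act_split S_def sp_cplx)
    ultimately have "(S (cplx G (S x) + ap \<i> x) + ap 1 (cplx G (S x) + ap \<i> x))
        - (cplx G (S (S x + ap 1 x)) + ap \<i> (S x + ap 1 x)) = 0" by simp
    then show ?thesis unfolding L_def A_def rules by (simp add: algebra_simps)
  qed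
  have "L (cplx G x) = cplx G (L x)" "A (cplx G x) = - cplx G (A x)"
    unfolding L_def A_def rules by (simp_all add: algebra_simps)
  then have "cplx G (L x) - cplx G (A x) = 0" using LA[of "cplx G x"] by simp
  then have "cplx G (cplx G (L x - A x)) = cplx G 0" by (simp add: J_simps)
  then have "L x = A x" by (simp add: J_simps)
  then have "2 *\<^sub>R A x = 0" using LA[of x] by (simp add: scaleR_2)
  then have 0: "A x = 0" "L x = 0" using \<open>L x = A x\<close> by simp_all
  show "ap \<i> (S x) - S (ap \<i> x) = cplx G (ap 1 (S x)) - cplx G (S (ap 1 x))"
    using 0(1) by (simp add: A_def algebra_simps)
  show "ap 1 (ap \<i> x) - ap \<i> (ap 1 x) = 2 *\<^sub>R cplx G (S (S x))"
    using 0(2) by (simp add: L_def)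
qed

end

sublocale flat_extension \<subseteq> pair: hermitian_pair "metric G" "cplx G" S X Y
proof
  fix x y :: 'g and c :: complex
  note rules = ap_add ap_minus ap_sub ap_scaleR ap_cplx[symmetric] J_simps
  show "S (x + y) = S x + S y" by (rule S_plus)
  have "S (r *\<^sub>R x) = r *\<^sub>R S x" for r x by (simp add: S_def sp_scaleR)
  then show "S (c \<star> x) = cnj c \<star> S x" by (simp add: cscale_def S_plus S_J)
  show "herm (S x) y = herm (S y) x"
    using sp_sym[of 1 x y] sp_sym[of 1 x "cplx G y"] g_J[of "S y" x] S_J[of y]
    by (simp add: herm_def S_def[symmetric] g_simps)
  show "X (x + y) = X x + X y" "Y (x + y) = Y x + Y y"
    by (simp_all add: X_def Y_def rules algebra_simps)
  show "X (c \<star> x) = c \<star> X x" "Y (c \<star> x) = c \<star> Y x"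
    by (simp_all add: X_def Y_def cscale_def rules algebra_simps)
  have g1: "metric G (X x) y = metric G x (Y y)" for x y
  proof -
    have "metric G (X x) y = metric G (ap \<i> x) y + metric G (ap 1 x) (cplx G y)"
      using g_J[of "ap 1 x" y] by (simp add: X_def g_simps)
    also have "\<dots> = - metric G (ap \<i> y) x - metric G (cplx G (ap 1 y)) x"
      using ap_skew[of \<i> x y] ap_skew[of 1 x "cplx G y"] by (simp add: ap_cplx)
    also have "\<dots> = metric G x (Y y)"
      using g_sym[of x "Y y"] by (simp add: Y_def g_simps)
    finally show ?thesis .
  qed
  have "Y (cplx G y) = cplx G (Y y)" by (simp add: Y_def rules)
  then show "herm (X x) y = herm x (Y y)" by (simp add: herm_def g1)
  show "X (S x) + S (Y x) = 0"
    using commutator_parts(1)[of x] by (simp add: X_def Y_def S_sub S_minus S_J algebra_simps)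
  have "X (Y x) - Y (X x) = 2 *\<^sub>R cplx G (ap 1 (ap \<i> x) - ap \<i> (ap 1 x))"
    by (simp add: X_def Y_def rules scaleR_2 algebra_simps)
  also have "\<dots> = (- 4) \<star> S (S x)"
    unfolding commutator_parts(2) by (simp add: J_simps cscale_def)
  finally show "X (Y x) - Y (X x) = (- 4) \<star> S (S x)" .
qed

context flat_extension
begin

lemma act_eq: "act a x = a \<star> S x + (\<i> / 2) \<star> (cnj a \<star> X x + a \<star> Y x)"
proof -
  have "ap a x = Re a *\<^sub>R ap 1 x + Im a *\<^sub>R ap \<i> x"
    by (rule g_eqI) (simp add: g_simps ap_form act_left[of a] field_simps)
  also have "\<dots> = (\<i> / 2) \<star> (cnj a \<star> X x + a \<star> Y x)"
  proof -
    let ?u = "Re a *\<^sub>R ap 1 x + Im a *\<^sub>R ap \<i> x"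
    have "cnj a \<star> X x + a \<star> Y x = - cplx G (?u + ?u)"
      by (simp add: X_def Y_def cscale_def J_simps algebra_simps)
    moreover have "(\<i> / 2) \<star> - cplx G (?u + ?u) = (1 / 2) *\<^sub>R (?u + ?u)"
      unfolding cscale_def by (simp add: linear_neg[OF linJ] JJ)
    ultimately show ?thesis by (simp only: scaleR_half_double)
  qed
  finally show ?thesis by (simp add: act_split[of a x] sp_S)
qed

lemma trivial_if_S_zero:
  assumes "\<And>x. S x = 0" shows "trivial_extension G flat_plane \<phi>"
proof -
  have fin': "linear (\<lambda>x::'g. 0::'g)" by (rule linearI) simp_all
  have 0: "sym_part (metric G) (\<lambda>x. 0) x = 0" "antisym_part (metric G) (\<lambda>x. 0) x = 0" for x
    by (rule g_eqI, simp add: sym_part_form[OF fin g fin'] g_simps)+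
  have parts0: "sym_part (metric G) (\<lambda>x. 0) = (\<lambda>x. 0)" "antisym_part (metric G) (\<lambda>x. 0) = (\<lambda>x. 0)"
    using 0 by auto
  have "pk_extension G flat_plane (\<lambda>A x. 0)"
    using ext unfolding pk_extension_def lie_action_def derivation_def
    by (auto simp: parts0 endo_commutator_def fin' br_simps fun_eq_iff J_simps linear_zero)
  then have "aw_related G flat_plane \<phi> G flat_plane (\<lambda>A x. 0)"
  proof (rule aw_relatedI[where F = id and R = id, OF ext])
    show "sym_part (metric G) (\<lambda>x. 0) = sym_part (metric G) (\<phi> A)" for A
      by (rule HOL.ext) (simp add: 0 phi_act sp_S assms)
    show "\<phi> A 0 = 0" for A using linear_0[OF act_linear] by (simp add: phi_act)
  qed (auto simp: pk_isomorphism_def linear_id)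
  then show ?thesis unfolding trivial_extension_def by blast
qed

text \<open>
  For all \<open>a\<close> and \<open>b\<close> the maps \<open>a S\<close> and \<open>b S\<close> have the products \<open>a cnj b S\<^sup>2\<close> and \<open>b cnj a S\<^sup>2\<close>, which is why
  \<open>S\<^sup>2 = 0\<close> makes them commute.
\<close>

lemma symmetric_extension:
  assumes der: "\<And>a. derivation br (\<lambda>x. a \<star> S x)" and S2: "\<And>x. S (S x) = 0"
  shows "pk_extension G flat_plane (\<lambda>A. sym_part (metric G) (\<phi> A))"
    and "sym_part (metric G) (sym_part (metric G) (\<phi> A)) = sym_part (metric G) (\<phi> A)"
proof -
  have eq: "sym_part (metric G) (\<phi> A) = (\<lambda>x. Complex (A$1) (A$2) \<star> S x)" for A
    by (rule HOL.ext) (simp add: phi_act sp_S)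
  have lin: "linear (\<lambda>x. a \<star> S x)" for a using der by (simp add: derivation_def)
  have sym: "metric G (a \<star> S x) y = metric G (a \<star> S y) x" for a x y
    using sp_sym[of a x y] by (simp add: sp_S)
  have s: "sym_part (metric G) (\<lambda>x. a \<star> S x) = (\<lambda>x. a \<star> S x)" for a
  proof (intro HOL.ext g_eqI)
    show "metric G (sym_part (metric G) (\<lambda>x. a \<star> S x) x) z = metric G (a \<star> S x) z" for x z
      using sym[of a x z] by (simp add: sym_part_form[OF fin g lin])
  qed
  have a: "antisym_part (metric G) (\<lambda>x. a \<star> S x) = (\<lambda>x. 0)" for a
  proof (intro HOL.ext g_eqI)
    show "metric G (antisym_part (metric G) (\<lambda>x. a \<star> S x) x) z = metric G 0 z" for x z
      using sym[of a x z] by (simp add: sym_part_form[OF fin g lin] g_simps)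
  qed
  show "sym_part (metric G) (sym_part (metric G) (\<phi> A)) = sym_part (metric G) (\<phi> A)"
    unfolding eq s ..
  show "pk_extension G flat_plane (\<lambda>A. sym_part (metric G) (\<phi> A))"
    using ext unfolding pk_extension_def lie_action_def eq s a
    by (auto simp: der fun_eq_iff J_simps endo_commutator_def pair.S_scale S2 J_cscale flat_plane_def Complex_eq_0
        intro!: linearI) (simp_all add: cscale_def algebra_simps)
qed

end

section \<open>The action in normal form\<close>

lemma (in kaehler_plane) coordinate_isomorphism:
  fixes Z W :: "real^4 \<Rightarrow> complex"
  assumes fr: "frame p q" and Z: "linear Z" and W: "linear W"
    and onto: "\<And>z w. \<exists>x. Z x = z \<and> W x = w" and ker: "\<And>x. Z x = 0 \<Longrightarrow> W x = 0 \<Longrightarrow> x = 0"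
    and br: "\<And>x y. br (Z x \<star> p + W x \<star> q) (Z y \<star> p + W y \<star> q)
        = Z (bracket G' x y) \<star> p + W (bracket G' x y) \<star> q"
    and met: "\<And>x y. metric G (Z x \<star> p + W x \<star> q) (Z y \<star> p + W y \<star> q) = metric G' x y"
    and J: "\<And>x. Z (cplx G' x) = \<i> * Z x" "\<And>x. W (cplx G' x) = \<i> * W x"
  shows "pk_isomorphism G' G (\<lambda>x. Z x \<star> p + W x \<star> q)"
proof -
  let ?F = "\<lambda>x. Z x \<star> p + W x \<star> q"
  have lin: "linear ?F"
  proof (rule linearI)
    show "?F (x + y) = ?F x + ?F y" for x y
      by (simp add: linear_add[OF Z] linear_add[OF W] add_comb)
    show "?F (r *\<^sub>R x) = r *\<^sub>R ?F x" for r x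
      by (simp add: linear_scale[OF Z] linear_scale[OF W] scaleR_add_right scaleR_cscale scaleR_conv_of_real[where 'a = complex])
  qed
  have "inj ?F"
    unfolding linear_injective_0[OF lin]
  proof (intro allI impI)
    fix x assume "?F x = 0"
    then have "Z x = 0 \<and> W x = 0" using fr unfolding frame_def by blast
    then show "x = 0" using ker by blast
  qed
  moreover have "surj ?F"
    unfolding surj_def
  proof
    fix u obtain z w where u: "u = z \<star> p + w \<star> q" using frame_expand[OF fr] by blast
    obtain x where "Z x = z" "W x = w" using onto by blast
    then show "\<exists>x. u = ?F x" using u by blast
  qed
  ultimately have "bij ?F" by (simp add: bij_def)
  then show ?thesis
    using lin by (simp add: pk_isomorphism_def br met J J_simps J_cscale)
qed

context flat_extension
begin

lemma act_comb: "act a (z \<star> p + w \<star> q)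
    = (a * cnj z) \<star> S p + (a * cnj w) \<star> S q
      + ((\<i> / 2 * cnj a * z) \<star> X p + (\<i> / 2 * cnj a * w) \<star> X q)
      + ((\<i> / 2 * a * z) \<star> Y p + (\<i> / 2 * a * w) \<star> Y q)"
  by (simp add: act_eq pair.S_comb pair.X_comb pair.Y_comb C.scale_right_distrib mult_ac add_ac)

lemma singular_act:
  assumes "pair.singular_form p q x y"
  shows "act a (z \<star> p + w \<star> q) = (\<i> / 2 * cnj a * x * z) \<star> p
    + (a * cnj z + \<i> / 2 * (cnj a * y + a * cnj y) * z + \<i> / 2 * a * cnj x * w) \<star> q"
  using assms unfolding pair.singular_form_def act_comb
  by (simp add: C.scale_right_distrib C.scale_left_distrib distrib_left distrib_right mult_ac add_ac)

lemma regular_act: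
  assumes "pair.regular_form p q y \<delta>"
  shows "act a (z \<star> p + w \<star> q)
    = (\<i> * of_real \<delta> * a * cnj w + of_real \<delta> / 2 * (cnj a * y - a * cnj y) * w) \<star> p
      + (a * cnj z + \<i> / 2 * (cnj a * y + a * cnj y) * z) \<star> q"
proof -
  have "(\<i> / 2 * cnj a * w) * (- \<i> * of_real \<delta> * y) = of_real \<delta> / 2 * cnj a * y * w"
    "(\<i> / 2 * a * w) * (\<i> * of_real \<delta> * cnj y) = - (of_real \<delta> / 2 * a * cnj y * w)"
    by (simp_all add: field_simps)
  then show ?thesis
    using assms unfolding pair.regular_form_def act_comb
    by (simp add: C.scale_right_distrib C.scale_left_distrib C.scale_left_diff_distrib
        distrib_left distrib_right left_diff_distrib right_diff_distrib mult_ac add_ac)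
qed

lemma abelian_if_fourth_power:
  assumes "\<And>u. act a (act a (act a (act a u))) = r *\<^sub>R u" "r \<noteq> 0"
  shows "br u v = 0"
  by (rule derivation_fourth_power_abelian[OF br_bilinear act_derivation assms])

text \<open>
  The map \<open>\<phi>(x)\<close> is \<open>\<i> k / 2 + x S\<close> with \<open>k = \<bar>x\<bar>\<^sup>2\<close>. The two summands anticommute and \<open>S\<^sup>2 = 0\<close>, so its square is the scalar
  \<open>- k\<^sup>2 / 4\<close>.
\<close>

lemma singular_abelian:
  assumes sf: "pair.singular_form p q x y" and x: "x \<noteq> 0"
  shows "br u v = 0"
proof (rule abelian_if_fourth_power)
  have fr: "frame p q" using sf hyperbolic_frame by (auto simp: pair.singular_form_def)
  have "Re (cnj x * y) = 0" using sf by (simp add: pair.singular_form_def)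
  then have xy: "cnj x * y + x * cnj y = 0" by (simp add: complex_eq_iff)
  define k where "k = x * cnj x"
  have k: "cnj k = k" by (simp add: k_def mult.commute)
  have a: "act x (z \<star> p + w \<star> q) = (\<i> / 2 * k * z) \<star> p + (x * cnj z + \<i> / 2 * k * w) \<star> q" for z w
    unfolding singular_act[OF sf] xy by (simp add: k_def mult_ac)
  have two: "act x (act x u) = (- (k * k / 4)) \<star> u" for u
  proof -
    obtain z w where u: "u = z \<star> p + w \<star> q" using frame_expand[OF fr] by blast
    show ?thesis
      unfolding u a scale_comb frame_eq_iff[OF fr] by (simp add: k field_simps)
  qed
  have kr: "k = of_real (cmod x ^ 2)" by (simp only: k_def complex_norm_square)
  show "act x (act x (act x (act x u))) = (cmod x ^ 8 / 16) *\<^sub>R u" for u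
    unfolding two C.scale_scale unfolding kr of_real_scale[symmetric] by (simp add: field_simps flip: power_add)
  show "cmod x ^ 8 / 16 \<noteq> 0" using x by simp
qed

text \<open>
  Here \<open>\<phi>(y)\<close> interchanges the lines of \<open>p\<close> and \<open>q\<close>, and its fourth power is \<open>4 \<delta>\<^sup>2\<close> because
  \<open>\<bar>y\<bar>\<^sup>2 = 2\<close>.
\<close>

lemma regular_abelian:
  assumes rf: "pair.regular_form p q y \<delta>"
  shows "br u v = 0"
proof (rule abelian_if_fourth_power)
  have fr: "frame p q" and pos: "\<delta> > 0" and y: "cmod y ^ 2 = 2"
    using rf hyperbolic_frame by (auto simp: pair.regular_form_def)
  have yy: "y * cnj y = 2" using complex_norm_square[of y] y by simp
  then have yy': "cnj y * y = 2" by (simp add: mult.commute)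
  define d where "d = complex_of_real \<delta>"
  have d: "cnj d = d" by (simp add: d_def)
  have a: "act y (z \<star> p + w \<star> q) = (\<i> * d * y * cnj w) \<star> p + (y * cnj z + 2 * \<i> * z) \<star> q" for z w
    unfolding regular_act[OF rf] yy yy' by (simp add: d_def)
  have ii: "\<i> * \<i> = -1" by simp
  show "act y (act y (act y (act y u))) = (4 * \<delta> ^ 2) *\<^sub>R u" for u
  proof -
    obtain z w where u: "u = z \<star> p + w \<star> q" using frame_expand[OF fr] by blast
    have r: "(4 * \<delta> ^ 2) *\<^sub>R u = (4 * d * d) \<star> u" for u
      by (simp add: of_real_scale[symmetric] d_def power2_eq_square)
    show ?thesis
      unfolding u a r scale_comb frame_eq_iff[OF fr] complex_cnj_mult complex_cnj_add complex_cnj_cnj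
        complex_cnj_i complex_cnj_numeral complex_cnj_minus d
      using ii yy by (intro conjI; algebra)
  qed
  show "4 * \<delta> ^ 2 \<noteq> 0" using pos by simp
qed

lemma hyperbolic_turn:
  assumes "hyperbolic p q" and "cmod l = 1" shows "hyperbolic (l \<star> p) (l \<star> q)"
proof -
  have "l * cnj l = 1" using complex_norm_square[of l] assms(2) by simp
  then show ?thesis using assms(1) by (simp add: hyperbolic_def herm_scale mult.commute)
qed

text \<open>
  A rotation of the plane by \<open>l\<^sup>2\<close> multiplies \<open>x\<close> and \<open>y\<close> by the conjugate of \<open>l\<^sup>2\<close>, if the basis is multiplied by \<open>l\<close> at
  the same time in order to preserve \<open>S p = q\<close>.
\<close>

lemma singular_act_turn:
  assumes sf: "pair.singular_form p q x y" and l: "cmod l = 1"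
    and x': "x' = cnj (l * l) * x" and y': "y' = cnj (l * l) * y"
  shows "act (l * l * a) (z \<star> (l \<star> p) + w \<star> (l \<star> q)) = (\<i> / 2 * cnj a * x' * z) \<star> (l \<star> p)
    + (a * cnj z + \<i> / 2 * (cnj a * y' + a * cnj y') * z + \<i> / 2 * a * cnj x' * w) \<star> (l \<star> q)"
proof -
  have fr: "frame p q" using sf hyperbolic_frame by (auto simp: pair.singular_form_def)
  have ll: "l * cnj l = 1" using complex_norm_square[of l] l by simp
  show ?thesis
    unfolding C.scale_scale singular_act[OF sf] frame_eq_iff[OF fr] x' y' complex_cnj_mult complex_cnj_cnj
  proof
    have "l * l * a * (cnj z * cnj l) = (l * cnj l) * (a * cnj z * l)" by (simp only: mult_ac)
    then have e: "l * l * a * (cnj z * cnj l) = a * cnj z * l" unfolding ll by simp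
    show "l * l * a * (cnj z * cnj l) + \<i> / 2 * (cnj l * cnj l * cnj a * y + l * l * a * cnj y) * (z * l)
        + \<i> / 2 * (l * l * a) * cnj x * (w * l)
      = (a * cnj z + \<i> / 2 * (cnj a * (cnj l * cnj l * y) + a * (l * l * cnj y)) * z
        + \<i> / 2 * a * (l * l * cnj x) * w) * l"
      unfolding e by (simp only: distrib_left distrib_right mult_ac add_ac)
  qed (simp only: mult_ac)
qed

end

section \<open>Matching with the models\<close>

lemma linear_complexI:
  fixes Z :: "'a::real_vector \<Rightarrow> complex"
  assumes "\<And>x y. Z (x + y) = Z x + Z y" "\<And>r x. Z (r *\<^sub>R x) = of_real r * Z x"
  shows "linear Z"
  by (rule linearI) (simp_all add: assms scaleR_conv_of_real)

lemma abelian4_action1_components: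
  "abelian4_action1 a A x $ 1 = a * ((x$1 + 2 * x$2 - x$3) * A$1 + (x$2 + 2 * x$3 + x$4) * A$2)"
  "abelian4_action1 a A x $ 2 = a * ((x$2 + x$4) * A$1 + (x$1 - x$3) * A$2)"
  "abelian4_action1 a A x $ 3 = a * ((x$1 - x$3) * A$1 + (x$2 + x$4) * A$2)"
  "abelian4_action1 a A x $ 4 = a * ((- x$2 + 2 * x$3 - x$4) * A$1 + (- x$1 + 2 * x$2 + x$3) * A$2)"
  by (simp_all add: abelian4_action1_def plane_action_def matrix_vector_mult_def sum_4 algebra_simps)

lemma abelian4_action2_components:
  "abelian4_action2 a b c A x $ 1
    = (a * x$1 + (c - a) * x$2 - b * x$3 + b * x$4) * A$1 + ((a - c) * x$3 - a * x$4) * A$2"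
  "abelian4_action2 a b c A x $ 2
    = ((a + c) * x$1 - a * x$2 - b * x$3 + b * x$4) * A$1 + (a * x$3 - (a + c) * x$4) * A$2"
  "abelian4_action2 a b c A x $ 3
    = (b * x$1 - b * x$2 - a * x$3 + (a + c) * x$4) * A$1 + ((a + c) * x$1 - a * x$2) * A$2"
  "abelian4_action2 a b c A x $ 4
    = (b * x$1 - b * x$2 + (c - a) * x$3 + a * x$4) * A$1 + (a * x$1 + (c - a) * x$2) * A$2"
  by (simp_all add: abelian4_action2_def plane_action_def matrix_vector_mult_def sum_4 algebra_simps)

lemma rh3_action_components:
  "rh3_action a A x $ 1 = 0" "rh3_action a A x $ 2 = 0"
  "rh3_action a A x $ 3 = a * (A$1 * x$1 + A$2 * x$2)"
  "rh3_action a A x $ 4 = a * (A$2 * x$1 - A$1 * x$2)"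
  by (simp_all add: rh3_action_def plane_action_def matrix_vector_mult_def sum_4 algebra_simps)

lemma r2'_action_components:
  "r2'_action a A x $ 1 = 0" "r2'_action a A x $ 2 = 0"
  "r2'_action a A x $ 3 = a * (A$1 * x$1 - A$2 * x$2)"
  "r2'_action a A x $ 4 = a * (A$2 * x$1 + A$1 * x$2)"
  by (simp_all add: r2'_action_def plane_action_def matrix_vector_mult_def sum_4 algebra_simps)

lemma r2'_metric:
  "metric (r2' a12 a13 a14) x y = a12 * (x$1 * y$1 + x$2 * y$2)
    + a13 * (x$1 * y$4 + x$4 * y$1 + x$2 * y$3 + x$3 * y$2)
    + a14 * (x$2 * y$4 + x$4 * y$2 - x$1 * y$3 - x$3 * y$1)"
  by (simp add: r2'_def inner_vec_def matrix_vector_mult_def sum_4 algebra_simps)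

lemma r2'_cplx:
  "cplx (r2' a12 a13 a14) x $ 1 = x$2" "cplx (r2' a12 a13 a14) x $ 2 = - x$1"
  "cplx (r2' a12 a13 a14) x $ 3 = - x$4" "cplx (r2' a12 a13 a14) x $ 4 = x$3"
  by (simp_all add: r2'_def matrix_vector_mult_def sum_4)

definition z1 :: "real^4 \<Rightarrow> complex" where "z1 x = Complex (x$1) (x$3)"
definition z2 :: "real^4 \<Rightarrow> complex" where "z2 x = Complex (x$2) (x$4)"

context flat_extension
begin

text \<open>
  The coordinates come from \<open>e\<^sub>1 = p + q / 2\<close> and \<open>e\<^sub>2 = q / 2 - p\<close>, that is \<open>p = (e\<^sub>1 - e\<^sub>2) / 2\<close> and
  \<open>q = e\<^sub>1 + e\<^sub>2\<close>, with \<open>e\<^sub>3 = \<i> e\<^sub>1\<close> and \<open>e\<^sub>4 = \<i> e\<^sub>2\<close>.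
\<close>

lemma abelian4_singular:
  assumes fr: "hyperbolic p q" and ab: "\<And>u v. br u v = 0"
  shows "pk_isomorphism abelian4 G (\<lambda>x. (z1 x - z2 x) \<star> p + ((z1 x + z2 x) / 2) \<star> q)"
proof (rule coordinate_isomorphism[where Z = "\<lambda>x. z1 x - z2 x" and W = "\<lambda>x. (z1 x + z2 x) / 2"])
  show "frame p q" by (rule hyperbolic_frame[OF fr])
  show "linear (\<lambda>x. z1 x - z2 x)" "linear (\<lambda>x. (z1 x + z2 x) / 2)"
    by (rule linear_complexI; simp add: z1_def z2_def complex_eq_iff field_simps)+
  show "\<exists>x. z1 x - z2 x = z \<and> (z1 x + z2 x) / 2 = w" for z w
    by (rule exI[of _ "vector [Re (w + z / 2), Re (w - z / 2), Im (w + z / 2), Im (w - z / 2)]"])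
      (simp add: z1_def z2_def complex_eq_iff)
  show "x = 0" if "z1 x - z2 x = 0" "(z1 x + z2 x) / 2 = 0" for x
    using that by (simp add: z1_def z2_def complex_eq_iff vec_eq_iff forall_4)
  show "br ((z1 x - z2 x) \<star> p + ((z1 x + z2 x) / 2) \<star> q) ((z1 y - z2 y) \<star> p + ((z1 y + z2 y) / 2) \<star> q)
    = (z1 (bracket abelian4 x y) - z2 (bracket abelian4 x y)) \<star> p
      + ((z1 (bracket abelian4 x y) + z2 (bracket abelian4 x y)) / 2) \<star> q" for x y
    by (simp add: ab abelian4_def z1_def z2_def Complex_eq_0)
  show "metric G ((z1 x - z2 x) \<star> p + ((z1 x + z2 x) / 2) \<star> q) ((z1 y - z2 y) \<star> p + ((z1 y + z2 y) / 2) \<star> q)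
    = metric abelian4 x y" for x y
    unfolding g_herm hyperbolic_herm[OF fr]
    by (simp add: abelian4_def z1_def z2_def field_simps)
  show "z1 (cplx abelian4 x) - z2 (cplx abelian4 x) = \<i> * (z1 x - z2 x)"
    "(z1 (cplx abelian4 x) + z2 (cplx abelian4 x)) / 2 = \<i> * ((z1 x + z2 x) / 2)" for x
    by (simp_all add: abelian4_def z1_def z2_def complex_eq_iff)
qed

text \<open>
  The second abelian family with \<open>a = 1\<close> is the singular normal form with \<open>x = 2 \<i> c\<close> and \<open>y = b\<close>.
\<close>

lemma abelian4_action2_coordinates:
  fixes a :: complex
  assumes "a = Complex (A$1) (A$2)"
  shows "z1 (abelian4_action2 1 b c A x) - z2 (abelian4_action2 1 b c A x)
      = \<i> / 2 * cnj a * (2 * \<i> * of_real c) * (z1 x - z2 x)"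
    and "(z1 (abelian4_action2 1 b c A x) + z2 (abelian4_action2 1 b c A x)) / 2
      = a * cnj (z1 x - z2 x)
        + \<i> / 2 * (cnj a * of_real b + a * cnj (of_real b)) * (z1 x - z2 x)
        + \<i> / 2 * a * cnj (2 * \<i> * of_real c) * ((z1 x + z2 x) / 2)"
  by (simp_all add: assms z1_def z2_def abelian4_action2_components complex_eq_iff field_simps)

text \<open>
  A rotation turns \<open>x\<close> into \<open>2 \<i> c\<close> with \<open>c > 0\<close>. The condition \<open>Re (cnj x y) = 0\<close> is invariant under
  rotations, so \<open>y\<close> becomes real.
\<close>

lemma singular_nonzero_model:
  assumes sf: "pair.singular_form p q x y" and x: "x \<noteq> 0"
  shows "\<exists>b c. c \<noteq> 0 \<and> aw_related G flat_plane \<phi> abelian4 flat_plane (abelian4_action2 1 b c)"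
proof -
  define c where "c = cmod x / 2"
  define l where "l = csqrt (x / (2 * \<i> * of_real c))"
  have ll: "l * l = x / (2 * \<i> * of_real c)"
    unfolding l_def using power2_csqrt[of "x / (2 * \<i> * of_real c)"] by (simp only: power2_eq_square)
  have c: "c > 0" using x by (simp add: c_def)
  have "cmod (l * l) = 1" unfolding ll using x by (simp add: norm_divide norm_mult c_def)
  then have l: "cmod l = 1" unfolding norm_mult by (metis abs_norm_cancel abs_square_eq_1 power2_eq_square)
  have l1: "cnj (l * l) * (l * l) = 1"
    using complex_norm_square[of "l * l"] \<open>cmod (l * l) = 1\<close> by (simp add: mult.commute)
  have "x = (l * l) * (2 * \<i> * of_real c)" using c ll by simp
  then have x': "2 * \<i> * of_real c = cnj (l * l) * x"
    using l1 by (simp add: mult.assoc[symmetric])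
  have "Re (cnj x * y) = 0" using sf by (simp add: pair.singular_form_def)
  define y' where "y' = cnj (l * l) * y"
  have "cnj (2 * \<i> * of_real c) * y' = cnj x * y"
    unfolding x' y'_def complex_cnj_mult complex_cnj_cnj using l1 by (simp add: algebra_simps)
  then have "Re (cnj (2 * \<i> * of_real c) * y') = 0" using \<open>Re (cnj x * y) = 0\<close> by simp
  then have "Im y' = 0" using c by simp
  then have y'r: "y' = of_real (Re y')" by (simp add: complex_eq_iff)
  have hyp: "hyperbolic (l \<star> p) (l \<star> q)"
    using sf l hyperbolic_turn by (simp add: pair.singular_form_def)
  note F = abelian4_singular[OF hyp singular_abelian[OF sf x]]
  have "aw_related G flat_plane \<phi> abelian4 flat_plane (abelian4_action2 1 (Re y') c)"
  proof (rule aw_relatedI[OF ext ext _ _ F turn_isomorphism[OF \<open>cmod (l * l) = 1\<close>]])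
    show "\<phi> A (\<phi> B u) = \<phi> B (\<phi> A u)" for A B u by (simp add: phi_act act_commute)
    fix A x0
    note 1 = abelian4_action2_coordinates[OF refl, of "Re y'" c A x0]
    show "(z1 (abelian4_action2 1 (Re y') c A x0) - z2 (abelian4_action2 1 (Re y') c A x0)) \<star> (l \<star> p)
        + ((z1 (abelian4_action2 1 (Re y') c A x0) + z2 (abelian4_action2 1 (Re y') c A x0)) / 2) \<star> (l \<star> q)
      = \<phi> (turn (l * l) A) ((z1 x0 - z2 x0) \<star> (l \<star> p) + ((z1 x0 + z2 x0) / 2) \<star> (l \<star> q))"
      unfolding phi_turn singular_act_turn[OF sf l x' y'_def] 1 y'r[symmetric] by (rule refl)
  qed simp
  moreover have "c \<noteq> 0" using c by simp
  ultimately show ?thesis by blast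
qed

text \<open>
  The singular normal form with \<open>x = 0\<close>, in a basis rescaled by a phase so that \<open>\<phi>(cnj u)\<close> is
  \<open>z p + w q \<mapsto> cnj z q\<close>; the phase \<open>u\<close> is what remains of \<open>S\<close>. The numbers \<open>v\<close> and \<open>\<alpha>\<close> describe the bracket.
\<close>

definition null_data :: "'g \<Rightarrow> 'g \<Rightarrow> complex \<Rightarrow> complex \<Rightarrow> complex \<Rightarrow> bool" where
  "null_data p q u v \<alpha> \<longleftrightarrow> hyperbolic p q \<and> cmod u = 1 \<and>
     (\<forall>z w. S (z \<star> p + w \<star> q) = (u * cnj z) \<star> q) \<and>
     (\<forall>a x. S (act a x) = 0) \<and> (\<forall>a w. act a (w \<star> q) = 0) \<and>
     (\<forall>z1 w1 z2 w2. br (z1 \<star> p + w1 \<star> q) (z2 \<star> p + w2 \<star> q)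
        = (of_real (Im (cnj z1 * z2)) * v + \<alpha> * (cnj z1 * w2 - cnj z2 * w1)) \<star> q)"

text \<open>
  For a phase \<open>a\<close> with \<open>Re (cnj a y) = 0\<close> the map \<open>\<phi>(a)\<close> is \<open>a S\<close>. In the basis \<open>l p\<close>, \<open>l q\<close> with
  \<open>l\<^sup>2 = a\<close> it becomes \<open>z p + w q \<mapsto> cnj z q\<close>, a derivation that determines the bracket.
\<close>

lemma singular_zero_null_data:
  assumes sf: "pair.singular_form p q 0 y"
  shows "\<exists>p q u v \<alpha>. null_data p q u v \<alpha>"
proof -
  \<comment> \<open>The square of \<open>l\<close> is the phase \<open>a\<close>: orthogonal to \<open>y\<close>, and arbitrary if \<open>y = 0\<close>.\<close>
  define l where "l = csqrt (if y = 0 then 1 else \<i> * y / of_real (cmod y))"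
  have ll: "l * l = (if y = 0 then 1 else \<i> * y / of_real (cmod y))"
    unfolding l_def using power2_csqrt by (simp only: power2_eq_square)
  have l2: "cmod (l * l) = 1" unfolding ll by (simp add: norm_divide norm_mult)
  then have l: "cmod l = 1" unfolding norm_mult by (metis abs_norm_cancel abs_square_eq_1 power2_eq_square)
  have l1: "cnj l * l = 1" "l * cnj l = 1" using complex_norm_square[of l] l by (simp_all add: mult.commute)
  define y' where "y' = cnj (l * l) * y"
  have "y' + cnj y' = 0"
    unfolding y'_def ll by (simp add: field_simps)
  let ?p = "l \<star> p" and ?q = "l \<star> q"
  have hyp: "hyperbolic ?p ?q"
    using sf l hyperbolic_turn by (simp add: pair.singular_form_def)
  have fr: "frame ?p ?q" by (rule hyperbolic_frame[OF hyp])
  have x': "0 = cnj (l * l) * 0" by simp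
  note act' = singular_act_turn[OF sf l x' y'_def]
  have F: "act (l * l * 1) (z \<star> ?p + w \<star> ?q) = cnj z \<star> ?q" for z w
    unfolding act' using \<open>y' + cnj y' = 0\<close> by simp
  obtain \<alpha> v where br: "\<And>z1 w1 z2 w2. br (z1 \<star> ?p + w1 \<star> ?q) (z2 \<star> ?p + w2 \<star> ?q)
      = (of_real (Im (cnj z1 * z2)) * v + \<alpha> * (cnj z1 * w2 - cnj z2 * w1)) \<star> ?q"
    using bracket_of_null_derivation[OF hyp act_derivation F] by blast
  have S: "S p = q" "S q = 0" using sf by (auto simp: pair.singular_form_def)
  have "S (z \<star> ?p + w \<star> ?q) = (cnj (l * l) * cnj z) \<star> ?q" for z w
  proof -
    have "cnj z * cnj l = cnj l * cnj l * cnj z * l"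
      using l1 by (simp add: mult_ac)
    then show ?thesis by (simp add: pair.S_comb pair.S_scale S)
  qed
  moreover have act0: "\<exists>t. act a (z \<star> ?p + w \<star> ?q) = t \<star> ?q" "act a (w \<star> ?q) = 0" for a z w
    using singular_act[OF sf, of a "z * l" "w * l"] singular_act[OF sf, of a 0 "w * l"]
    by auto (metis C.scale_scale l1(1) mult.right_neutral mult.assoc)
  moreover have "S (act a x) = 0" for a x
  proof -
    obtain z w where "x = z \<star> ?p + w \<star> ?q" using frame_expand[OF fr] by blast
    then obtain t where "act a x = t \<star> ?q" using act0(1) by blast
    then show ?thesis by (simp add: pair.S_scale S)
  qed
  moreover have "cmod (cnj (l * l)) = 1" using l2 by (simp only: complex_mod_cnj)
  ultimately have "null_data ?p ?q (cnj (l * l)) v \<alpha>"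
    unfolding null_data_def using hyp br by blast
  then show ?thesis by blast
qed

text \<open>
  The bracket formula shows that every \<open>a S\<close> is a derivation. It commutes with \<open>\<phi>\<close>, since both
  composites vanish, so \<open>\<phi>\<close> may be replaced by its symmetric part.
\<close>

lemma null_data_aw_related:
  assumes nd: "null_data p q u v \<alpha>" and \<zeta>: "cmod \<zeta> = 1"
    and F: "pk_isomorphism G' G (\<lambda>x. Z x \<star> p + W x \<star> q)"
    and eq: "\<And>A x. Z (\<phi>' A x) = 0" "\<And>A x. W (\<phi>' A x) = \<zeta> * Complex (A$1) (A$2) * u * cnj (Z x)"
  shows "aw_related G flat_plane \<phi> G' flat_plane \<phi>'"
proof -
  have hyp: "hyperbolic p q" and S: "S (z \<star> p + w \<star> q) = (u * cnj z) \<star> q"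
    and S0: "S (act a x) = 0" and act0: "act a (w \<star> q) = 0"
    and br: "br (z1 \<star> p + w1 \<star> q) (z2 \<star> p + w2 \<star> q)
        = (of_real (Im (cnj z1 * z2)) * v + \<alpha> * (cnj z1 * w2 - cnj z2 * w1)) \<star> q"
    for z w a x z1 w1 z2 w2 using nd unfolding null_data_def by blast+
  have fr: "frame p q" by (rule hyperbolic_frame[OF hyp])
  have Sq: "S (w \<star> q) = 0" for w using S[of 0 w] by simp
  have brq: "br (w \<star> q) (z' \<star> p + w' \<star> q) = (- \<alpha> * cnj z' * w) \<star> q"
    "br (z' \<star> p + w' \<star> q) (w \<star> q) = (\<alpha> * cnj z' * w) \<star> q" for z' w w'
    using br[of 0 w z' w'] br[of z' w' 0 w] by (simp_all add: mult.assoc)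
  have der: "derivation br (\<lambda>x. a \<star> S x)" for a
    unfolding derivation_def
  proof (intro conjI allI)
    show "linear (\<lambda>x. a \<star> S x)"
      by (rule linearI) (simp_all add: S_def sp_add sp_scaleR cscale_def J_simps algebra_simps)
    fix x y
    obtain z w z' w' where xy: "x = z \<star> p + w \<star> q" "y = z' \<star> p + w' \<star> q"
      using frame_expand[OF fr] by meson
    have "(- \<alpha> * cnj z' * (a * (u * cnj z)) + \<alpha> * cnj z * (a * (u * cnj z'))) = 0"
      by (simp add: algebra_simps)
    then have "(- \<alpha> * cnj z' * (a * (u * cnj z)) + \<alpha> * cnj z * (a * (u * cnj z'))) \<star> q = 0" by (simp only: C.scale_zero_left)
    then show "a \<star> S (br x y) = br (a \<star> S x) y + br x (a \<star> S y)"
      unfolding xy br S Sq C.scale_scale brq by (simp only: C.scale_left_distrib C.scale_zero_right)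
  qed
  have SS: "S (S x) = 0" for x
    using frame_expand[OF fr, of x] by (auto simp: S Sq)
  note ext0 = symmetric_extension[OF der SS]
  have psi: "sym_part (metric G) (\<phi> A) x = Complex (A$1) (A$2) \<star> S x" for A x
    by (simp add: phi_act sp_S)
  show ?thesis
  proof (rule aw_relatedI[OF ext ext0 _ F turn_isomorphism[OF \<zeta>]])
    show "\<phi> A (sym_part (metric G) (\<phi> B) x) = sym_part (metric G) (\<phi> B) (\<phi> A x)" for A B x
    proof -
      obtain z w where x: "x = z \<star> p + w \<star> q" using frame_expand[OF fr] by blast
      have "\<phi> A (sym_part (metric G) (\<phi> B) x) = 0"
        unfolding psi x S C.scale_scale by (simp add: phi_act act0)
      then show ?thesis by (simp add: psi) (simp add: phi_act S0)
    qed
    show "Z (\<phi>' A x) \<star> p + W (\<phi>' A x) \<star> q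
      = sym_part (metric G) (\<phi> (turn \<zeta> A)) (Z x \<star> p + W x \<star> q)" for A x
      by (simp add: phi_turn sp_S S eq mult.assoc)
  qed
qed

end

lemma Im_cnj_mult_scaled:
  "complex_of_real (Im (cnj (l * a) * (l * b))) = cnj l * l * of_real (Im (cnj a * b))"
proof -
  have "cnj (l * a) * (l * b) = of_real ((cmod l)\<^sup>2) * (cnj a * b)"
    unfolding complex_norm_square by (simp add: mult_ac)
  then have "Im (cnj (l * a) * (l * b)) = (cmod l)\<^sup>2 * Im (cnj a * b)"
    by (simp only: Im_complex_of_real Re_complex_of_real times_complex.sel mult_zero_left add_0_right)
  then show ?thesis
    by (simp only: of_real_mult complex_norm_square mult_ac)
qed

context flat_extension
begin

lemma null_data_abelian_model:
  assumes nd: "null_data p q u 0 0"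
  shows "aw_related G flat_plane \<phi> abelian4 flat_plane (abelian4_action2 1 0 0)"
proof (rule null_data_aw_related[OF nd])
  have hyp: "hyperbolic p q" and u: "cmod u = 1" using nd by (auto simp: null_data_def)
  have fr: "frame p q" by (rule hyperbolic_frame[OF hyp])
  show "cmod (cnj u) = 1" using u by simp
  have "br x y = 0" for x y
    using nd frame_expand[OF fr, of x] frame_expand[OF fr, of y] unfolding null_data_def by auto
  then show "pk_isomorphism abelian4 G (\<lambda>x. (z1 x - z2 x) \<star> p + ((z1 x + z2 x) / 2) \<star> q)"
    by (rule abelian4_singular[OF hyp])
  have uu: "cnj u * u = 1" using complex_norm_square[of u] u by (simp add: mult.commute)
  fix A x
  note 1 = abelian4_action2_coordinates[OF refl, of 0 0 A x]
  show "z1 (abelian4_action2 1 0 0 A x) - z2 (abelian4_action2 1 0 0 A x) = 0"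
    using 1(1) by simp
  show "(z1 (abelian4_action2 1 0 0 A x) + z2 (abelian4_action2 1 0 0 A x)) / 2
      = cnj u * Complex (A$1) (A$2) * u * cnj (z1 x - z2 x)"
    using 1(2) uu by (simp add: mult_ac)
qed

text \<open>
  Take \<open>e\<^sub>1 = l p\<close> and \<open>e\<^sub>3 = [e\<^sub>1, \<i> e\<^sub>1] = \<bar>l\<bar>\<^sup>2 v q\<close>. The metric requires \<open>h(e\<^sub>1, e\<^sub>3) = 1\<close>, which
  determines \<open>l\<close>, and a rotation by \<open>\<zeta>\<close> makes \<open>S e\<^sub>1\<close> a positive multiple of \<open>e\<^sub>3\<close>.
\<close>

lemma null_data_rh3_model:
  assumes nd: "null_data p q u v 0" and v: "v \<noteq> 0"
  shows "\<exists>a>0. aw_related G flat_plane \<phi> rh3 flat_plane (rh3_action a)"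
proof -
  have hyp: "hyperbolic p q" and u: "cmod u = 1" using nd by (auto simp: null_data_def)
  have br: "br (z \<star> p + w \<star> q) (z' \<star> p + w' \<star> q) = (of_real (Im (cnj z * z')) * v) \<star> q" for z w z' w'
    using nd unfolding null_data_def by simp
  define r where "r = root 3 (1 / cmod v)"
  have r: "r > 0" using v by (simp add: r_def)
  have r3: "r * r * r * cmod v = 1"
    using v real_root_pow_pos2[of 3 "1 / cmod v"] by (simp add: r_def power3_eq_cube)
  define l where "l = of_real (r / cmod v) * v"
  define k where "k = of_real (r * r) * v"
  define \<zeta> where "\<zeta> = cnj u * v / cnj v"
  have vv: "v * cnj v = of_real (cmod v) * of_real (cmod v)"
    using complex_norm_square[of v] by (simp add: power2_eq_square)
  have "cmod \<zeta> = 1" using u v by (simp add: \<zeta>_def norm_divide norm_mult)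
  \<comment> \<open>In the basis \<open>p\<close>, \<open>q\<close> the vectors are \<open>e\<^sub>1 = l p\<close> and \<open>e\<^sub>3 = k q\<close>.\<close>
  have lk: "l * cnj k = 1"
  proof -
    have "l * cnj k = of_real (r * r * r / cmod v) * (v * cnj v)" by (simp add: l_def k_def)
    also have "\<dots> = of_real (r * r * r * cmod v)" unfolding vv using v by simp
    finally show ?thesis unfolding r3 by simp
  qed
  then have kl: "k * cnj l = 1" by (metis complex_cnj_cnj complex_cnj_mult complex_cnj_one mult.commute)
  have llv: "cnj l * l * v = k"
  proof -
    have "cnj l * l * v = of_real (r * r / (cmod v * cmod v)) * (v * cnj v) * v" by (simp add: l_def mult_ac)
    then show ?thesis unfolding vv using v by (simp add: k_def)
  qed
  have zk: "\<zeta> * u * cnj l = of_real (r * r) * k"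
  proof -
    have uu: "cnj u * u = 1" using complex_norm_square[of u] u by (simp add: mult.commute)
    have "\<zeta> * u * cnj l = (cnj u * u) * of_real (r / cmod v) * v" using v by (simp add: \<zeta>_def l_def)
    also have "\<dots> = of_real (r * r * r * cmod v) * of_real (r / cmod v) * v" unfolding r3 uu by simp
    also have "\<dots> = of_real (r * r) * k" using v by (simp add: k_def)
    finally show ?thesis .
  qed
  have l0: "l \<noteq> 0" "k \<noteq> 0" using lk by auto
  define e f where "e x = Complex (x$1) (x$2)" and "f x = Complex (x$3) (x$4)" for x :: "real^4"
  have iso: "pk_isomorphism rh3 G (\<lambda>x. (l * e x) \<star> p + (k * f x) \<star> q)"
  proof (rule coordinate_isomorphism[where Z = "\<lambda>x. l * e x" and W = "\<lambda>x. k * f x"])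
    show "frame p q" by (rule hyperbolic_frame[OF hyp])
    show "linear (\<lambda>x. l * e x)" "linear (\<lambda>x. k * f x)"
      by (rule linear_complexI; simp add: e_def f_def complex_eq_iff algebra_simps)+
    show "\<exists>x. l * e x = z \<and> k * f x = w" for z w
      by (rule exI[of _ "vector [Re (z / l), Im (z / l), Re (w / k), Im (w / k)]"])
        (simp add: e_def f_def l0)
    show "x = 0" if "l * e x = 0" "k * f x = 0" for x
    proof -
      have "e x = 0" "f x = 0" using that l0 by auto
      then show ?thesis by (simp add: e_def f_def complex_eq_iff vec_eq_iff forall_4)
    qed
    show "br ((l * e x) \<star> p + (k * f x) \<star> q) ((l * e y) \<star> p + (k * f y) \<star> q)
      = (l * e (bracket rh3 x y)) \<star> p + (k * f (bracket rh3 x y)) \<star> q" for x y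
    proof -
      have "of_real (Im (cnj (l * e x) * (l * e y))) * v
          = (cnj l * l * v) * of_real (Im (cnj (e x) * e y))"
        unfolding Im_cnj_mult_scaled by (simp only: mult_ac)
      also have "\<dots> = k * f (bracket rh3 x y)"
        unfolding llv by (simp add: e_def f_def rh3_def wedge_def complex_eq_iff)
      finally have 1: "of_real (Im (cnj (l * e x) * (l * e y))) * v = k * f (bracket rh3 x y)" .
      have 2: "e (bracket rh3 x y) = 0" by (simp add: e_def rh3_def Complex_eq_0)
      show ?thesis unfolding br 1 2 by simp
    qed
    show "metric G ((l * e x) \<star> p + (k * f x) \<star> q) ((l * e y) \<star> p + (k * f y) \<star> q) = metric rh3 x y" for x y
    proof -
      have "l * e x * cnj (k * f y) + k * f x * cnj (l * e y)
          = (l * cnj k) * (e x * cnj (f y)) + (k * cnj l) * (f x * cnj (e y))" by (simp add: mult_ac)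
      then show ?thesis
        unfolding g_herm hyperbolic_herm[OF hyp] lk kl
        by (simp add: rh3_def sym_prod_def e_def f_def)
    qed
    show "l * e (cplx rh3 x) = \<i> * (l * e x)" "k * f (cplx rh3 x) = \<i> * (k * f x)" for x
      by (simp_all add: rh3_def e_def f_def complex_eq_iff)
  qed
  have "aw_related G flat_plane \<phi> rh3 flat_plane (rh3_action (r * r))"
  proof (rule null_data_aw_related[OF nd \<open>cmod \<zeta> = 1\<close> iso])
    fix A x
    show "l * e (rh3_action (r * r) A x) = 0" by (simp add: e_def rh3_action_components Complex_eq_0)
    have "f (rh3_action (r * r) A x) = of_real (r * r) * Complex (A$1) (A$2) * cnj (e x)"
      by (simp add: e_def f_def rh3_action_components complex_eq_iff algebra_simps)
    then have "k * f (rh3_action (r * r) A x) = (of_real (r * r) * k) * Complex (A$1) (A$2) * cnj (e x)"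
      by simp
    also have "\<dots> = \<zeta> * Complex (A$1) (A$2) * u * cnj (l * e x)"
      unfolding zk[symmetric] by simp
    finally show "k * f (rh3_action (r * r) A x) = \<zeta> * Complex (A$1) (A$2) * u * cnj (l * e x)" .
  qed
  moreover have "r * r > 0" using r by simp
  ultimately show ?thesis by blast
qed

text \<open>
  Adding a multiple of \<open>q\<close> to \<open>p\<close> achieves \<open>[p, \<i> p] = 0\<close>. After rescaling, \<open>e\<^sub>1\<close> acts as the identity on
  the line of \<open>q\<close>, and \<open>e\<^sub>2 = - \<i> e\<^sub>1\<close> as multiplication by the imaginary unit, because the action is antilinear in the first
  argument. With \<open>e\<^sub>3 = S e\<^sub>1\<close> the action has \<open>a = 1\<close>, and the parameters of the metric are read off.
\<close>

lemma null_data_r2'_model: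
  assumes nd: "null_data p q u v \<alpha>" and \<alpha>: "\<alpha> \<noteq> 0"
  shows "\<exists>a12 a13 a14. a13^2 + a14^2 \<noteq> 0 \<and>
    aw_related G flat_plane \<phi> (r2' a12 a13 a14) flat_plane (r2'_action 1)"
proof -
  have hyp: "hyperbolic p q" and u: "cmod u = 1" using nd by (auto simp: null_data_def)
  have br: "br (z \<star> p + w \<star> q) (z' \<star> p + w' \<star> q)
      = (of_real (Im (cnj z * z')) * v + \<alpha> * (cnj z * w' - cnj z' * w)) \<star> q" for z w z' w'
    using nd unfolding null_data_def by simp
  \<comment> \<open>In the basis \<open>p\<close>, \<open>q\<close> the vectors are \<open>e\<^sub>1 = l p + t q\<close> and \<open>e\<^sub>3 = k q\<close>.\<close>
  define l where "l = 1 / cnj \<alpha>"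
  define k where "k = u / \<alpha>"
  define t where "t = \<i> * v / (2 * \<alpha>) * l"
  have l0: "l \<noteq> 0" "k \<noteq> 0" using \<alpha> u by (auto simp: l_def k_def)
  define m where "m = l * cnj k"
  have m0: "m \<noteq> 0" using l0 by (simp add: m_def)
  define n where "n = 2 * Re (l * cnj t)"
  define e f where "e x = Complex (x$1) (- x$2)" and "f x = Complex (x$3) (x$4)" for x :: "real^4"
  let ?L = "r2' n (Im m) (- Re m)"
  have iso: "pk_isomorphism ?L G (\<lambda>x. (l * e x) \<star> p + (t * e x + k * f x) \<star> q)"
  proof (rule coordinate_isomorphism[where Z = "\<lambda>x. l * e x" and W = "\<lambda>x. t * e x + k * f x"])
    show "frame p q" by (rule hyperbolic_frame[OF hyp])
    show "linear (\<lambda>x. l * e x)" "linear (\<lambda>x. t * e x + k * f x)"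
      by (rule linear_complexI; simp add: e_def f_def complex_eq_iff algebra_simps)+
    show "\<exists>x. l * e x = z \<and> t * e x + k * f x = w" for z w
      by (rule exI[of _ "vector [Re (z / l), - Im (z / l), Re ((w - t * (z / l)) / k), Im ((w - t * (z / l)) / k)]"])
        (simp add: e_def f_def l0)
    show "x = 0" if "l * e x = 0" "t * e x + k * f x = 0" for x
    proof -
      have "e x = 0" "f x = 0" using that l0 by auto
      then show ?thesis by (simp add: e_def f_def complex_eq_iff vec_eq_iff forall_4)
    qed
    show "br ((l * e x) \<star> p + (t * e x + k * f x) \<star> q) ((l * e y) \<star> p + (t * e y + k * f y) \<star> q)
      = (l * e (bracket ?L x y)) \<star> p + (t * e (bracket ?L x y) + k * f (bracket ?L x y)) \<star> q" for x y
    proof -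
      have al: "\<alpha> * cnj l = 1" using \<alpha> by (simp add: l_def)
      have 1: "of_real (Im (cnj (l * e x) * (l * e y))) * v
          = (l * cnj l * v) * of_real (Im (cnj (e x) * e y))"
        unfolding Im_cnj_mult_scaled by (simp only: mult_ac)
      have 2: "\<alpha> * (cnj (l * e x) * (t * e y + k * f y) - cnj (l * e y) * (t * e x + k * f x))
          = t * (cnj (e x) * e y - cnj (e y) * e x) + k * (cnj (e x) * f y - cnj (e y) * f x)"
      proof -
        have "\<alpha> * (cnj (l * e x) * (t * e y + k * f y) - cnj (l * e y) * (t * e x + k * f x))
          = (\<alpha> * cnj l) * (t * (cnj (e x) * e y - cnj (e y) * e x) + k * (cnj (e x) * f y - cnj (e y) * f x))"
          by (simp add: algebra_simps)
        then show ?thesis unfolding al by simp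
      qed
      have 3: "cnj (e x) * e y - cnj (e y) * e x = 2 * \<i> * of_real (Im (cnj (e x) * e y))"
        by (simp add: complex_eq_iff)
      have 4: "t * (2 * \<i>) = - (l * cnj l * v)"
        using \<alpha> by (simp add: t_def l_def field_simps)
      have 5: "cnj (e x) * f y - cnj (e y) * f x = f (bracket ?L x y)"
        by (simp add: e_def f_def r2'_def wedge_def complex_eq_iff)
      have 6: "e (bracket ?L x y) = 0" by (simp add: e_def r2'_def Complex_eq_0)
      have "of_real (Im (cnj (l * e x) * (l * e y))) * v
          + \<alpha> * (cnj (l * e x) * (t * e y + k * f y) - cnj (l * e y) * (t * e x + k * f x))
          = k * f (bracket ?L x y)"
        unfolding 1 2 3 5 using 4 by algebra
      then show ?thesis unfolding br 6 by simp
    qed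
    show "metric G ((l * e x) \<star> p + (t * e x + k * f x) \<star> q) ((l * e y) \<star> p + (t * e y + k * f y) \<star> q)
      = metric ?L x y" for x y
    proof -
      have "l * e x * cnj (t * e y + k * f y) + (t * e x + k * f x) * cnj (l * e y)
          = (l * cnj t + cnj (l * cnj t)) * (e x * cnj (e y)) + m * (e x * cnj (f y)) + cnj m * (f x * cnj (e y))"
        by (simp add: m_def algebra_simps)
      moreover have "l * cnj t + cnj (l * cnj t) = of_real n" by (simp add: n_def complex_eq_iff)
      ultimately have h: "l * e x * cnj (t * e y + k * f y) + (t * e x + k * f x) * cnj (l * e y)
          = of_real n * (e x * cnj (e y)) + m * (e x * cnj (f y)) + cnj m * (f x * cnj (e y))" by simp
      show ?thesis
        unfolding g_herm hyperbolic_herm[OF hyp] h r2'_metric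
        by (simp add: e_def f_def algebra_simps)
    qed
    show "l * e (cplx ?L x) = \<i> * (l * e x)"
      "t * e (cplx ?L x) + k * f (cplx ?L x) = \<i> * (t * e x + k * f x)" for x
      by (simp_all add: r2'_cplx e_def f_def complex_eq_iff algebra_simps)
  qed
  have "aw_related G flat_plane \<phi> ?L flat_plane (r2'_action 1)"
  proof (rule null_data_aw_related[OF nd _ iso, of 1])
    fix A x
    have e0: "e (r2'_action 1 A x) = 0" by (simp add: e_def r2'_action_components Complex_eq_0)
    then show "l * e (r2'_action 1 A x) = 0" by simp
    have "f (r2'_action 1 A x) = Complex (A$1) (A$2) * cnj (e x)"
      by (simp add: e_def f_def r2'_action_components complex_eq_iff algebra_simps)
    then show "t * e (r2'_action 1 A x) + k * f (r2'_action 1 A x) = 1 * Complex (A$1) (A$2) * u * cnj (l * e x)"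
      unfolding e0 by (simp add: k_def l_def)
  qed simp
  moreover have "(Im m)^2 + (- Re m)^2 \<noteq> 0"
    using m0 by (simp add: complex_eq_iff sum_power2_eq_zero_iff add.commute) auto
  ultimately show ?thesis by blast
qed

text \<open>
  In the model, \<open>p = e\<^sub>1 + \<i> e\<^sub>2\<close> is the eigenvector of \<open>S\<^sup>2\<close> for \<open>2 \<i> a\<^sup>2\<close>, with
  \<open>q = S p = a (1 - \<i>) (e\<^sub>1 - \<i> e\<^sub>2)\<close>, \<open>h(p, q) = 2 a (1 + \<i>)\<close> and \<open>X p = (1 + \<i>) q\<close>. The normal
  form has \<open>h(p\<^sub>0, q\<^sub>0) = 1\<close> and \<open>X p\<^sub>0 = y q\<^sub>0\<close>. Multiplying \<open>p\<^sub>0\<close> by \<open>l\<close> and rotating by \<open>\<zeta>\<close> turns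
  these two numbers into \<open>l\<^sup>2 cnj \<zeta>\<close> and \<open>cnj \<zeta>\<^sup>2 y l / cnj l\<close>. Equating them with those of the model
  gives \<open>\<zeta> = y / sqrt 2\<close> and \<open>l\<^sup>2 = 2 a (1 + \<i>) \<zeta>\<close>.
\<close>

lemma regular_model:
  assumes rf: "pair.regular_form p0 q0 y \<delta>"
  shows "\<exists>a>0. aw_related G flat_plane \<phi> abelian4 flat_plane (abelian4_action1 a)"
proof -
  have hyp0: "hyperbolic p0 q0" and pos: "\<delta> > 0" and y: "cmod y ^ 2 = 2"
    using rf by (auto simp: pair.regular_form_def)
  define a where "a = sqrt (\<delta> / 2)"
  have a: "a > 0" using pos by (simp add: a_def)
  have \<delta>: "\<delta> = 2 * a * a" using pos by (simp add: a_def mult.assoc)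
  define s where "s = complex_of_real (sqrt 2)"
  have ss: "s * s = 2" "cnj s = s" "s \<noteq> 0"
    by (simp_all add: s_def flip: of_real_mult)
  have cy: "cmod y = sqrt 2" using y by (metis norm_ge_zero real_sqrt_unique)
  define \<zeta> where "\<zeta> = y / s"
  have y\<zeta>: "y = \<zeta> * s" using ss by (simp add: \<zeta>_def)
  have \<zeta>: "cmod \<zeta> = 1" using cy by (simp add: \<zeta>_def s_def norm_divide)
  have zz: "\<zeta> * cnj \<zeta> = 1" using complex_norm_square[of \<zeta>] \<zeta> by simp
  define l where "l = csqrt (2 * of_real a * (1 + \<i>) * \<zeta>)"
  have ll: "l * l = 2 * of_real a * (1 + \<i>) * \<zeta>"
    unfolding l_def using power2_csqrt[of "2 * of_real a * (1 + \<i>) * \<zeta>"] by (simp only: power2_eq_square)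
  have l0: "l \<noteq> 0"
  proof
    assume "l = 0"
    then have "2 * of_real a * (1 + \<i>) * \<zeta> = 0" using ll by simp
    moreover have "\<zeta> \<noteq> 0" using \<zeta> by auto
    moreover have "1 + \<i> \<noteq> 0" by (simp add: complex_eq_iff)
    ultimately show False using a by simp
  qed
  have "cmod (l * l) = cmod (2 * of_real a * (1 + \<i>) * \<zeta>)" by (simp only: ll)
  also have "\<dots> = 2 * a * sqrt 2" using a \<zeta> by (simp add: norm_mult) (simp add: cmod_def)
  finally have "cmod l ^ 2 = 2 * a * sqrt 2" by (simp add: norm_mult power2_eq_square)
  then have lcl: "l * cnj l = 2 * of_real a * s"
    using complex_norm_square[of l] by (simp add: s_def)
  have e1: "s * (\<zeta> * cnj l) = (1 - \<i>) * l"
  proof -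
    have "l * (s * (\<zeta> * cnj l)) = s * s * 2 * of_real a * \<zeta>" using lcl by algebra
    also have "\<dots> = (1 - \<i>) * (l * l)" unfolding ll ss by (simp add: algebra_simps)
    finally have "l * (s * (\<zeta> * cnj l)) = l * ((1 - \<i>) * l)" by (simp add: mult_ac)
    then show ?thesis using l0 by simp
  qed
  have e2: "s * l = (1 + \<i>) * (\<zeta> * cnj l)"
  proof -
    have "(1 + \<i>) * (s * (\<zeta> * cnj l)) = 2 * l" unfolding e1 by (simp add: algebra_simps)
    then have "s * ((1 + \<i>) * (\<zeta> * cnj l)) = s * (s * l)"
      unfolding mult.assoc[symmetric] ss(1) by (simp add: mult_ac)
    then show ?thesis using ss(3) by simp
  qed
  define p where "p = l \<star> p0"
  define q where "q = (\<zeta> * cnj l) \<star> q0"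
  have z0: "\<zeta> * cnj l \<noteq> 0" using l0 \<zeta> by auto
  have fr0: "frame p0 q0" by (rule hyperbolic_frame[OF hyp0])
  have zpq: "z \<star> p + w \<star> q = (z * l) \<star> p0 + (w * (\<zeta> * cnj l)) \<star> q0" for z w
    by (simp add: p_def q_def)
  have fr: "frame p q"
  proof (rule frameI)
    fix z w assume "z \<star> p + w \<star> q = 0"
    then have "z * l = 0 \<and> w * (\<zeta> * cnj l) = 0" using fr0 unfolding zpq frame_def by blast
    then show "z = 0 \<and> w = 0" using l0 z0 by auto
  qed
  have herm: "herm (z \<star> p + w \<star> q) (z' \<star> p + w' \<star> q)
      = 2 * of_real a * (1 + \<i>) * z * cnj w' + 2 * of_real a * (1 - \<i>) * w * cnj z'" for z w z' w'
  proof -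
    have "l * cnj (\<zeta> * cnj l) = (l * l) * cnj \<zeta>" by (simp add: mult_ac)
    also have "\<dots> = 2 * of_real a * (1 + \<i>) * (\<zeta> * cnj \<zeta>)" unfolding ll by (simp add: mult_ac)
    finally have 1: "l * cnj (\<zeta> * cnj l) = 2 * of_real a * (1 + \<i>)" unfolding zz by simp
    have 2: "(\<zeta> * cnj l) * cnj l = 2 * of_real a * (1 - \<i>)"
      using arg_cong[OF 1, of cnj] by (simp add: mult_ac)
    have "herm (z \<star> p + w \<star> q) (z' \<star> p + w' \<star> q)
      = (l * cnj (\<zeta> * cnj l)) * (z * cnj w') + ((\<zeta> * cnj l) * cnj l) * (w * cnj z')"
      unfolding zpq hyperbolic_herm[OF hyp0] by (simp add: mult_ac)
    then show ?thesis unfolding 1 2 by (simp add: mult_ac)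
  qed
  \<comment> \<open>The relations \<open>e1\<close> and \<open>e2\<close> compare the phases of \<open>l\<close> and \<open>\<zeta> cnj l\<close>, the scalings of \<open>p\<close> and \<open>q\<close>.\<close>
  have act: "act (\<zeta> * b) (z \<star> p + w \<star> q)
      = (\<i> * of_real \<delta> * b * cnj w + of_real \<delta> / 2 * (1 - \<i>) * (cnj b - b) * w) \<star> p
        + (b * cnj z + \<i> / 2 * (1 + \<i>) * (cnj b + b) * z) \<star> q" for b z w
  proof -
    have 1: "cnj (\<zeta> * b) * y = s * cnj b" "(\<zeta> * b) * cnj y = s * b"
      using zz unfolding y\<zeta> complex_cnj_mult ss(2) by (simp_all add: mult_ac)
    have 2: "\<i> * of_real \<delta> * (\<zeta> * b) * cnj (w * (\<zeta> * cnj l))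
        + of_real \<delta> / 2 * (s * cnj b - s * b) * (w * (\<zeta> * cnj l))
      = (\<i> * of_real \<delta> * b * cnj w + of_real \<delta> / 2 * (1 - \<i>) * (cnj b - b) * w) * l"
    proof -
      have m1: "\<i> * of_real \<delta> * (\<zeta> * b) * cnj (w * (\<zeta> * cnj l))
          = \<i> * of_real \<delta> * b * cnj w * l * (\<zeta> * cnj \<zeta>)" by (simp add: mult_ac)
      have m2: "of_real \<delta> / 2 * (s * cnj b - s * b) * (w * (\<zeta> * cnj l))
          = of_real \<delta> / 2 * (cnj b - b) * w * (s * (\<zeta> * cnj l))"
        by (simp add: algebra_simps)
      show ?thesis unfolding m1 m2 zz e1 by (simp add: algebra_simps)
    qed
    have 3: "(\<zeta> * b) * cnj (z * l) + \<i> / 2 * (s * cnj b + s * b) * (z * l)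
      = (b * cnj z + \<i> / 2 * (1 + \<i>) * (cnj b + b) * z) * (\<zeta> * cnj l)"
    proof -
      have m1: "\<i> / 2 * (s * cnj b + s * b) * (z * l) = \<i> / 2 * (cnj b + b) * z * (s * l)"
        by (simp add: algebra_simps)
      show ?thesis unfolding m1 e2 by (simp add: algebra_simps)
    qed
    show ?thesis unfolding zpq regular_act[OF rf] 1 2 3 ..
  qed
  define k where "k = 2 * of_real a * (1 - \<i>)"
  have k0: "k \<noteq> 0" using a by (simp add: k_def complex_eq_iff)
  let ?Z = "\<lambda>x. (z1 x - \<i> * z2 x) / 2" and ?W = "\<lambda>x. (z1 x + \<i> * z2 x) / k"
  have iso: "pk_isomorphism abelian4 G (\<lambda>x. ?Z x \<star> p + ?W x \<star> q)"
  proof (rule coordinate_isomorphism[where Z = ?Z and W = ?W, OF fr])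
    have lin: "linear z1" "linear z2"
      by (rule linear_complexI; simp add: z1_def z2_def complex_eq_iff)+
    show "linear ?Z" "linear ?W"
      by (rule linear_complexI; simp add: linear_add[OF lin(1)] linear_add[OF lin(2)] linear_scale[OF lin(1)]
          linear_scale[OF lin(2)] scaleR_conv_of_real[where 'a = complex] k0 field_simps)+
    show "\<exists>x. ?Z x = z \<and> ?W x = w" for z w
    proof -
      let ?x = "vector [Re (z + k * w / 2), Im (z - k * w / 2) * -1, Im (z + k * w / 2), Re (z - k * w / 2)] :: real^4"
      have x: "z1 ?x = z + k * w / 2" "z2 ?x = \<i> * (z - k * w / 2)"
        by (simp_all add: z1_def z2_def complex_eq_iff)
      have "?Z ?x = z" unfolding x by (simp add: field_simps)
      moreover have "?W ?x = w" unfolding x using k0 by (simp add: field_simps)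
      ultimately have "?Z ?x = z \<and> ?W ?x = w" by (rule conjI)
      then show ?thesis by blast
    qed
    show "x = 0" if "?Z x = 0" "?W x = 0" for x
    proof -
      have "z1 x = \<i> * z2 x" "z1 x + \<i> * z2 x = 0" using that k0 by auto
      then have "z1 x = 0" "z2 x = 0" by auto
      then show ?thesis by (simp add: z1_def z2_def complex_eq_iff vec_eq_iff forall_4)
    qed
    show "br (?Z x \<star> p + ?W x \<star> q) (?Z y \<star> p + ?W y \<star> q)
      = ?Z (bracket abelian4 x y) \<star> p + ?W (bracket abelian4 x y) \<star> q" for x y
      by (simp add: regular_abelian[OF rf] abelian4_def z1_def z2_def zero_complex.code[symmetric])
    show "metric G (?Z x \<star> p + ?W x \<star> q) (?Z y \<star> p + ?W y \<star> q) = metric abelian4 x y" for x y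
    proof -
      have ck: "2 * of_real a * (1 + \<i>) = cnj k" "2 * of_real a * (1 - \<i>) = k"
        by (simp_all add: k_def)
      have d: "cnj k * u * cnj (t / k) = u * cnj t" "k * (t / k) * u = t * u" for u t
        using k0 by simp_all
      have h: "herm (?Z x \<star> p + ?W x \<star> q) (?Z y \<star> p + ?W y \<star> q)
          = (z1 x - \<i> * z2 x) / 2 * cnj (z1 y + \<i> * z2 y) + (z1 x + \<i> * z2 x) * cnj (z1 y - \<i> * z2 y) / 2"
        unfolding herm ck d by simp
      show ?thesis unfolding g_herm h
        by (simp add: abelian4_def z1_def z2_def field_simps)
    qed
    show "?Z (cplx abelian4 x) = \<i> * ?Z x" "?W (cplx abelian4 x) = \<i> * ?W x" for x
    proof -
      have "z1 (cplx abelian4 x) = \<i> * z1 x" "z2 (cplx abelian4 x) = \<i> * z2 x"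
        by (simp_all add: abelian4_def z1_def z2_def complex_eq_iff)
      then show "?Z (cplx abelian4 x) = \<i> * ?Z x" "?W (cplx abelian4 x) = \<i> * ?W x"
        by (simp_all add: algebra_simps)
    qed
  qed
  have "aw_related G flat_plane \<phi> abelian4 flat_plane (abelian4_action1 a)"
  proof (rule aw_relatedI[OF ext ext _ _ iso turn_isomorphism[OF \<zeta>]])
    show "\<phi> A (\<phi> B u) = \<phi> B (\<phi> A u)" for A B u by (simp add: phi_act act_commute)
    fix A :: "real^2" and x :: "real^4"
    let ?b = "Complex (A$1) (A$2)"
    have Z: "?Z (abelian4_action1 a A x)
        = \<i> * of_real \<delta> * ?b * cnj (?W x) + of_real \<delta> / 2 * (1 - \<i>) * (cnj ?b - ?b) * ?W x"
    proof -
      have ck: "of_real \<delta> = of_real a * (1 - \<i>) / 2 * cnj k" "of_real \<delta> / 2 * (1 - \<i>) = of_real a / 2 * k"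
        by (simp_all add: k_def \<delta> field_simps)
      have d: "\<i> * (u * cnj k) * r * cnj (t / k) = \<i> * u * r * cnj t" "u * k * r * (t / k) = u * r * t" for u r t
        using k0 by simp_all
      have "\<i> * of_real \<delta> * ?b * cnj (?W x) + of_real \<delta> / 2 * (1 - \<i>) * (cnj ?b - ?b) * ?W x
        = \<i> * (of_real a * (1 - \<i>) / 2) * ?b * cnj (z1 x + \<i> * z2 x)
          + of_real a / 2 * (cnj ?b - ?b) * (z1 x + \<i> * z2 x)"
        unfolding ck(2) unfolding ck(1) unfolding d ..
      also have "\<dots> = ?Z (abelian4_action1 a A x)"
        by (simp add: z1_def z2_def abelian4_action1_components complex_eq_iff field_simps)
      finally show ?thesis by simp
    qed
    have W: "?W (abelian4_action1 a A x)
        = ?b * cnj (?Z x) + \<i> / 2 * (1 + \<i>) * (cnj ?b + ?b) * ?Z x"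
    proof -
      have "k * (?b * cnj (?Z x) + \<i> / 2 * (1 + \<i>) * (cnj ?b + ?b) * ?Z x)
        = z1 (abelian4_action1 a A x) + \<i> * z2 (abelian4_action1 a A x)"
        by (simp add: z1_def z2_def abelian4_action1_components k_def complex_eq_iff field_simps)
      then show ?thesis using k0 by (simp add: field_simps)
    qed
    show "?Z (abelian4_action1 a A x) \<star> p + ?W (abelian4_action1 a A x) \<star> q
      = \<phi> (turn \<zeta> A) (?Z x \<star> p + ?W x \<star> q)"
      unfolding phi_turn act Z W by (rule refl)
  qed simp
  then show ?thesis using a by blast
qed

end

section \<open>Classification\<close>

theorem theorem3p7:
  fixes G :: "'g::real_vector pk_structure" and \<phi> :: "real^2 \<Rightarrow> 'g \<Rightarrow> 'g"
  assumes "pk_extension G flat_plane \<phi>"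
    and "dim (UNIV :: 'g set) = 4"
    and "\<not> trivial_extension G flat_plane \<phi>"
  shows "(\<exists>a>0. aw_related G flat_plane \<phi> abelian4 flat_plane (abelian4_action1 a)) \<or>
    (\<exists>a b c. a > 0 \<and> (b = 0 \<and> c = 0 \<or> c \<noteq> 0) \<and>
       aw_related G flat_plane \<phi> abelian4 flat_plane (abelian4_action2 a b c)) \<or>
    (\<exists>a>0. aw_related G flat_plane \<phi> rh3 flat_plane (rh3_action a)) \<or>
    (\<exists>a12 a13 a14 a. a13^2 + a14^2 \<noteq> 0 \<and> a > 0 \<and>
       aw_related G flat_plane \<phi> (r2' a12 a13 a14) flat_plane (r2'_action a))"
    (is "?one \<or> ?two \<or> ?three \<or> ?four")
proof -
  interpret flat_extension G \<phi>
    using assms(1,2) by unfold_locales (auto simp: pk_extension_def)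
  obtain x0 where x0: "S x0 \<noteq> 0" using trivial_if_S_zero assms(3) by blast
  show ?thesis
  proof (cases "\<exists>k. k \<noteq> 0 \<and> S k = 0")
    case False
    then obtain p q y \<delta> where "pair.regular_form p q y \<delta>" using pair.regular_form_exists by blast
    then have ?one by (rule regular_model)
    then show ?thesis by blast
  next
    case True
    then obtain p q x y where sf: "pair.singular_form p q x y" using pair.singular_form_exists x0 by blast
    show ?thesis
    proof (cases "x = 0")
      case False
      then obtain b c where bc: "c \<noteq> 0" "aw_related G flat_plane \<phi> abelian4 flat_plane (abelian4_action2 1 b c)"
        using singular_nonzero_model[OF sf] by blast
      have ?two by (rule exI[of _ 1], rule exI[of _ b], rule exI[of _ c]) (use bc in simp)
      then show ?thesis by blast
    next
      case True
      then obtain p q u v \<alpha> where nd: "null_data p q u v \<alpha>"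
        using singular_zero_null_data sf by blast
      consider "\<alpha> \<noteq> 0" | "\<alpha> = 0" "v \<noteq> 0" | "\<alpha> = 0" "v = 0" by blast
      then show ?thesis
      proof cases
        case 1
        then obtain a12 a13 a14 where "a13^2 + a14^2 \<noteq> 0"
            "aw_related G flat_plane \<phi> (r2' a12 a13 a14) flat_plane (r2'_action 1)"
          using null_data_r2'_model[OF nd] by blast
        then have ?four by (intro exI[of _ a12] exI[of _ a13] exI[of _ a14] exI[of _ 1]) simp
        then show ?thesis by blast
      next
        case 2
        then have ?three using null_data_rh3_model nd by blast
        then show ?thesis by blast
      next
        case 3
        then have "aw_related G flat_plane \<phi> abelian4 flat_plane (abelian4_action2 1 0 0)"
          using null_data_abelian_model nd by blast
        then have ?two by (intro exI[of _ 1] exI[of _ 0]) simp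
        then show ?thesis by blast
      qed
    qed
  qed
qed

end
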